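(* Let $K$ be any field of prime characteristic $p$, let $R:=K[[x_1,\ldots,x_n]]$, let $\Delta$ be a simplicial complex on the vertex set $[n]=\{1,\ldots,n\}$, let $I=I_\Delta\subseteq R$ be the corresponding squarefree monomial ideal, let $A:=R/I$, and let $E_A$ denote the injective hull of $K$ as $A$-module. If the Frobenius algebra $\mathcal{F}^{E_A}$ is infinitely generated as $A$-algebra, then the number of new generators appearing on each graded piece of $\mathcal{F}^{E_A}$ is always less than or equal to the number of maximal free pairs of the simplicial complex $\Delta$.
   Context: A simplicial complex $\Delta$ on $[n]$ is a non-empty collection of subsets of $[n]$ (faces) closed under taking subsets; facets are the inclusion-maximal faces. $I_\Delta$ is generated by the monomials $\prod_{i\in N}x_i$ with $N\subseteq[n]$, $N\notin\Delta$. For an $A$-module $M$, a $p^e$-linear map on $M$ is an additive map $\phi:M\to M$ with $\phi(am)=a^{p^e}\phi(m)$ for all $a\in A$, $m\in M$; $\operatorname{End}_{p^e}(M)$ is the group of these maps, and $\mathcal{F}^M:=\bigoplus_{e\geq0}\operatorname{End}_{p^e}(M)$ is a graded, associative ring under composition, called the algebra of Frobenius operators (Frobenius algebra) of $M$. For $M=E_A$ the degree-zero piece is $\operatorname{End}_A(E_A)\cong A$ (as $A$ is complete), and each graded piece is a left $A$-module via $(a\phi)(m)=a\phi(m)$. "Infinitely generated as $A$-algebra" means not finitely generated as a ring over its degree-zero piece $A$. New generators are generators of $\mathcal{F}^{E_A}$ over its degree-zero piece: the number of new generators appearing on the graded piece of degree $e\geq 1$ is the minimal number of generators of the left $A$-module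 $\operatorname{End}_{p^e}(E_A)/\mathcal{G}_e$, where $\mathcal{G}_e$ is the degree-$e$ part of the subring of $\mathcal{F}^{E_A}$ generated by all homogeneous elements of degree $<e$ (so $\mathcal{G}_1=0$). A free pair of $\Delta$ is a pair $(F,G)$ of non-empty subsets of $[n]$ with $F\cap G=\emptyset$, $F\cup G\in\Delta$, and such that $F\cup G$ equals the intersection of all facets of $\Delta$ containing $F$. Free pairs are partially ordered by $(F,G)\leq(F',G')$ iff $F\supseteq F'$ and $G\subseteq G'$. A maximal free pair is a maximal element of this poset.
   Formalization: In degree e = 1 the bound proved is the number of maximal free pairs plus one, since the stated bound fails there when all degree-1 generators count as new (e.g. I = (xy, xz): 3 new generators, 2 maximal free pairs); for every e ≥ 2 the stated bound is proved. *)

theory Defs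
  imports
    "HOL-Computational_Algebra.Primes"
    "HOL-Algebra.Module"
    "HOL-Algebra.Generated_Rings"
    "HOL-Library.Extended_Nat"
begin

section \<open>Formal power series in finitely many variables\<close>

text \<open>Exponent vectors are functions on \<open>nat\<close>; only the coordinates \<open>1, \<dots>, n\<close> are used.\<close>

type_synonym 'k mpseries = "(nat \<Rightarrow> nat) \<Rightarrow> 'k"

definition mpseries_ring :: "nat \<Rightarrow> 'k::field mpseries ring" where
  "mpseries_ring n =
    \<lparr>carrier = {f. \<forall>u. f u \<noteq> 0 \<longrightarrow> {i. u i \<noteq> 0} \<subseteq> {1..n}},
     mult = (\<lambda>f g u. \<Sum>v | v \<le> u. f v * g (\<lambda>i. u i - v i)),
     one = (\<lambda>u. if u = (\<lambda>_. 0) then 1 else 0),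
     zero = (\<lambda>_. 0),
     add = (\<lambda>f g u. f u + g u)\<rparr>"

definition squarefree_monomial :: "nat set \<Rightarrow> 'k::field mpseries" where
  "squarefree_monomial N = (\<lambda>u. if u = (\<lambda>i. if i \<in> N then 1 else 0) then 1 else 0)"


section \<open>Simplicial complexes and free pairs\<close>

definition simplicial_complex :: "nat \<Rightarrow> nat set set \<Rightarrow> bool" where
  "simplicial_complex n \<Delta> \<longleftrightarrow>
     \<Delta> \<noteq> {} \<and> \<Delta> \<subseteq> Pow {1..n} \<and> (\<forall>F\<in>\<Delta>. \<forall>G. G \<subseteq> F \<longrightarrow> G \<in> \<Delta>)"

definition facets :: "nat set set \<Rightarrow> nat set set" where
  "facets \<Delta> = {H \<in> \<Delta>. \<forall>H'\<in>\<Delta>. H \<subseteq> H' \<longrightarrow> H' = H}"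

definition free_pairs :: "nat \<Rightarrow> nat set set \<Rightarrow> (nat set \<times> nat set) set" where
  "free_pairs n \<Delta> =
     {(F, G). F \<subseteq> {1..n} \<and> G \<subseteq> {1..n} \<and> F \<noteq> {} \<and> G \<noteq> {} \<and> F \<inter> G = {} \<and>
              F \<union> G \<in> \<Delta> \<and> F \<union> G = \<Inter>{H \<in> facets \<Delta>. F \<subseteq> H}}"

definition free_pair_le :: "nat set \<times> nat set \<Rightarrow> nat set \<times> nat set \<Rightarrow> bool" where
  "free_pair_le P P' \<longleftrightarrow> fst P' \<subseteq> fst P \<and> snd P \<subseteq> snd P'"

definition maximal_free_pairs :: "nat \<Rightarrow> nat set set \<Rightarrow> (nat set \<times> nat set) set" where
  "maximal_free_pairs n \<Delta> =
     {P \<in> free_pairs n \<Delta>. \<forall>P'\<in>free_pairs n \<Delta>. free_pair_le P P' \<longrightarrow> P' = P}"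


section \<open>The complete Stanley--Reisner ring\<close>

definition stanley_reisner_ideal :: "nat \<Rightarrow> nat set set \<Rightarrow> 'k::field mpseries set" where
  "stanley_reisner_ideal n \<Delta> =
     genideal (mpseries_ring n) (squarefree_monomial ` {N. N \<subseteq> {1..n} \<and> N \<notin> \<Delta>})"

definition stanley_reisner_ring :: "nat \<Rightarrow> nat set set \<Rightarrow> 'k::field mpseries set ring" where
  "stanley_reisner_ring n \<Delta> = mpseries_ring n Quot stanley_reisner_ideal n \<Delta>"

text \<open>The residue field \<open>K\<close> as a module over the Stanley--Reisner ring: a residue class acts
  through its constant coefficient, which does not depend on the representative because every
  generator of the ideal has zero constant coefficient (the empty set is a face).\<close>

definition residue_module :: "('k::field mpseries set, 'k) module" where
  "residue_module =
    \<lparr>carrier = UNIV, mult = (*), one = 1, zero = 0, add = (+),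
     smult = (\<lambda>a c. (THE d. \<forall>f\<in>a. f (\<lambda>_. 0) = d) * c)\<rparr>"


section \<open>Modules and injective hulls\<close>

text \<open>The ring-multiplication fields \<open>mult\<close> and \<open>one\<close> of the record type \<open>module\<close> carry no
  information about a module and are ignored (or set to \<open>undefined\<close>) throughout.\<close>

definition module_hom :: "('a, 'c) ring_scheme \<Rightarrow> ('a, 'b) module \<Rightarrow> ('a, 'e) module \<Rightarrow> ('b \<Rightarrow> 'e) set" where
  "module_hom A M N =
     {h \<in> carrier M \<rightarrow> carrier N.
        (\<forall>x\<in>carrier M. \<forall>y\<in>carrier M. h (x \<oplus>\<^bsub>M\<^esub> y) = h x \<oplus>\<^bsub>N\<^esub> h y) \<and>
        (\<forall>a\<in>carrier A. \<forall>x\<in>carrier M. h (a \<odot>\<^bsub>M\<^esub> x) = a \<odot>\<^bsub>N\<^esub> h x)}"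

text \<open>HOL cannot quantify over all types inside a formula, so the test modules range over the
  modules whose elements have the same type as those of the ring. These include the ring itself
  with its ideals, so by Baer's criterion this is injectivity with respect to all modules.\<close>

definition injective_module :: "('a, 'c) ring_scheme \<Rightarrow> ('a, 'e) module \<Rightarrow> bool" where
  "injective_module A E \<longleftrightarrow> module A E \<and>
     (\<forall>(M :: ('a, 'a) module) N h.
        module A M \<longrightarrow> submodule N A M \<longrightarrow> h \<in> module_hom A (M\<lparr>carrier := N\<rparr>) E \<longrightarrow>
        (\<exists>g \<in> module_hom A M E. \<forall>x\<in>N. g x = h x))"

definition injective_hull :: "('a, 'c) ring_scheme \<Rightarrow> ('a, 'b) module \<Rightarrow> ('a, 'e) module \<Rightarrow> bool" where
  "injective_hull A M E \<longleftrightarrow> module A M \<and> injective_module A E \<and>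
     (\<exists>\<iota> \<in> module_hom A M E. inj_on \<iota> (carrier M) \<and>
        (\<forall>N. submodule N A E \<longrightarrow> N \<noteq> {\<zero>\<^bsub>E\<^esub>} \<longrightarrow> N \<inter> \<iota> ` carrier M \<noteq> {\<zero>\<^bsub>E\<^esub>}))"

definition quotient_module :: "('a, 'e) module \<Rightarrow> 'e set \<Rightarrow> ('a, 'e set) module" where
  "quotient_module M N =
    \<lparr>carrier = a_rcosets\<^bsub>M\<^esub> N, mult = undefined, one = undefined,
     zero = N, add = set_add M,
     smult = (\<lambda>a X. {a \<odot>\<^bsub>M\<^esub> x \<oplus>\<^bsub>M\<^esub> y | x y. x \<in> X \<and> y \<in> N})\<rparr>"

definition generated_submodule :: "('a, 'c) ring_scheme \<Rightarrow> ('a, 'e) module \<Rightarrow> 'e set \<Rightarrow> 'e set" where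
  "generated_submodule A M S = \<Inter>{N. submodule N A M \<and> S \<subseteq> N}"

text \<open>The value is \<open>\<infinity>\<close> if the module is not finitely generated.\<close>

definition min_number_of_generators :: "('a, 'c) ring_scheme \<Rightarrow> ('a, 'e) module \<Rightarrow> enat" where
  "min_number_of_generators A M =
     (INF S \<in> {S. finite S \<and> S \<subseteq> carrier M \<and> generated_submodule A M S = carrier M}. enat (card S))"


section \<open>The algebra of Frobenius operators\<close>

text \<open>Maps on a module are normalised to be \<open>undefined\<close> outside the carrier, so that equality of
  functions is equality of maps.\<close>

definition zero_map :: "('a, 'e) module \<Rightarrow> 'e \<Rightarrow> 'e" where
  "zero_map M = (\<lambda>x\<in>carrier M. \<zero>\<^bsub>M\<^esub>)"

definition frobenius_maps ::
  "nat \<Rightarrow> ('a, 'c) ring_scheme \<Rightarrow> ('a, 'e) module \<Rightarrow> nat \<Rightarrow> ('e \<Rightarrow> 'e) set" where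
  "frobenius_maps p A M e =
     {\<phi> \<in> carrier M \<rightarrow>\<^sub>E carrier M.
        (\<forall>x\<in>carrier M. \<forall>y\<in>carrier M. \<phi> (x \<oplus>\<^bsub>M\<^esub> y) = \<phi> x \<oplus>\<^bsub>M\<^esub> \<phi> y) \<and>
        (\<forall>a\<in>carrier A. \<forall>x\<in>carrier M. \<phi> (a \<odot>\<^bsub>M\<^esub> x) = (a [^]\<^bsub>A\<^esub> (p ^ e)) \<odot>\<^bsub>M\<^esub> \<phi> x)}"

definition frobenius_module ::
  "nat \<Rightarrow> ('a, 'c) ring_scheme \<Rightarrow> ('a, 'e) module \<Rightarrow> nat \<Rightarrow> ('a, 'e \<Rightarrow> 'e) module" where
  "frobenius_module p A M e =
    \<lparr>carrier = frobenius_maps p A M e, mult = undefined, one = undefined,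
     zero = zero_map M,
     add = (\<lambda>\<phi> \<psi>. \<lambda>x\<in>carrier M. \<phi> x \<oplus>\<^bsub>M\<^esub> \<psi> x),
     smult = (\<lambda>a \<phi>. \<lambda>x\<in>carrier M. a \<odot>\<^bsub>M\<^esub> \<phi> x)\<rparr>"

text \<open>The sum over all degrees is an external direct sum: an element is the family of its
  homogeneous components, almost all of them zero.\<close>

definition frobenius_algebra ::
  "nat \<Rightarrow> ('a, 'c) ring_scheme \<Rightarrow> ('a, 'e) module \<Rightarrow> (nat \<Rightarrow> 'e \<Rightarrow> 'e) ring" where
  "frobenius_algebra p A M =
    \<lparr>carrier = {\<Phi>. (\<forall>e. \<Phi> e \<in> frobenius_maps p A M e) \<and> finite {e. \<Phi> e \<noteq> zero_map M}},
     mult = (\<lambda>\<Phi> \<Psi> e. \<lambda>x\<in>carrier M. \<Oplus>\<^bsub>M\<^esub>i\<in>{..e}. \<Phi> i (\<Psi> (e - i) x)),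
     one = (\<lambda>e. if e = 0 then \<lambda>x\<in>carrier M. x else zero_map M),
     zero = (\<lambda>e. zero_map M),
     add = (\<lambda>\<Phi> \<Psi> e. \<lambda>x\<in>carrier M. \<Phi> e x \<oplus>\<^bsub>M\<^esub> \<Psi> e x)\<rparr>"

definition homogeneous_element :: "('a, 'e) module \<Rightarrow> nat \<Rightarrow> ('e \<Rightarrow> 'e) \<Rightarrow> nat \<Rightarrow> 'e \<Rightarrow> 'e" where
  "homogeneous_element M e \<phi> = (\<lambda>d. if d = e then \<phi> else zero_map M)"

definition graded_piece ::
  "nat \<Rightarrow> ('a, 'c) ring_scheme \<Rightarrow> ('a, 'e) module \<Rightarrow> nat \<Rightarrow> (nat \<Rightarrow> 'e \<Rightarrow> 'e) set" where
  "graded_piece p A M e = homogeneous_element M e ` frobenius_maps p A M e"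

definition frobenius_algebra_finitely_generated ::
  "nat \<Rightarrow> ('a, 'c) ring_scheme \<Rightarrow> ('a, 'e) module \<Rightarrow> bool" where
  "frobenius_algebra_finitely_generated p A M \<longleftrightarrow>
     (\<exists>S. finite S \<and> S \<subseteq> carrier (frobenius_algebra p A M) \<and>
          generate_ring (frobenius_algebra p A M) (graded_piece p A M 0 \<union> S)
            = carrier (frobenius_algebra p A M))"

text \<open>The degree-\<open>e\<close> part of the subring generated by the homogeneous elements of degree less
  than \<open>e\<close>.\<close>

definition old_maps ::
  "nat \<Rightarrow> ('a, 'c) ring_scheme \<Rightarrow> ('a, 'e) module \<Rightarrow> nat \<Rightarrow> ('e \<Rightarrow> 'e) set" where
  "old_maps p A M e =
     {\<phi> \<in> frobenius_maps p A M e.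
        homogeneous_element M e \<phi>
          \<in> generate_ring (frobenius_algebra p A M) (\<Union>d<e. graded_piece p A M d)}"

text \<open>In degree \<open>1\<close> only the zero map is old, so every minimal generator counts as new there. For
  a Stanley--Reisner ring this includes the Frobenius action multiplied by the \<open>(p - 1)\<close>-st power
  of the product of the variables outside the intersection of all facets; it corresponds to no free
  pair, and its analogues in higher degrees are products of maps of lower degree.\<close>

definition number_of_new_generators ::
  "nat \<Rightarrow> ('a, 'c) ring_scheme \<Rightarrow> ('a, 'e) module \<Rightarrow> nat \<Rightarrow> enat" where
  "number_of_new_generators p A M e =
     min_number_of_generators A (quotient_module (frobenius_module p A M e) (old_maps p A M e))"

end

theory Submission
  imports Defs "HOL-Library.Function_Algebras"
begin
text \<open>
  The injective hull \<open>E\<close> of the residue field is identified with the module of inverse polynomials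
  supported on faces of \<open>\<Delta>\<close>. The embedding comes from injectivity; it is onto because, by the
  ascending chain condition, every element of \<open>E\<close> is killed by a power of the maximal ideal.

  With \<open>q = p\<^sup>e\<close>, every \<open>q\<close>-linear map on inverse polynomials is \<open>c \<mapsto> g \<cdot> F c\<close> for some power
  series \<open>g\<close>, where \<open>F\<close> raises coefficients to the power \<open>q\<close> and sends the monomial of exponent
  \<open>u\<close> to the one of exponent \<open>q u + (q - 1)\<close>. The admissible \<open>g\<close> are those whose exponents \<open>\<gamma>\<close> are such
  that \<open>P = {i. \<gamma> i \<ge> q}\<close> is a face and \<open>{i. \<gamma> i < q - 1}\<close> lies in every facet containing \<open>P\<close>. The
  minimal such exponents come from the maximal free pairs \<open>(F, G)\<close>, with value \<open>q\<close> on \<open>F\<close>, \<open>0\<close> on \<open>G\<close>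
  and \<open>q - 1\<close> elsewhere, and from the pair \<open>({}, C)\<close> with \<open>C\<close> the intersection of all facets. The
  generator of the latter pair is a product of maps of lower degree as soon as \<open>e \<ge> 2\<close>.
\<close>


section \<open>Power series as a commutative ring type\<close>

text \<open>The hull is given only abstractly, on an arbitrary type, and its injectivity may be
  tested only against modules whose elements have the type of the elements of \<open>A\<close>. The
  identification therefore uses injectivity of \<open>E\<close> alone: the inclusion of the residue
  field is extended to inverse polynomials and surjectivity is checked by hand, instead of comparing
  two injective hulls. That every element is torsion follows from essentiality only once a chain of
  annihilators is known to become stationary, which is why Dickson's lemma and division of power
  series are developed. The condition on \<gamma> is the one of Fedder's colon ideals: x^\<gamma>
  carries the ideal I into its Frobenius power I^[q] without lying in I^[q]. Multiplication raises
  exponents, so generators are found by minimising \<gamma>. Shrinking F and enlarging G lowers the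
  exponent of a pair, and this is exactly the order on free pairs.\<close>

definition supp :: "(nat \<Rightarrow> nat) \<Rightarrow> nat set" where
  "supp u = {i. u i \<noteq> 0}"

lemma supp_0 [simp]: "supp (\<lambda>_. 0) = {}" "supp 0 = {}"
  by (simp_all add: supp_def)

lemma supp_add [simp]: "supp (u + v) = supp u \<union> supp v"
  by (auto simp: supp_def)

lemma finite_le_fun:
  fixes u :: "nat \<Rightarrow> nat"
  assumes "finite (supp u)"
  shows "finite {v. v \<le> u}"
proof -
  \<comment> \<open>The total degree of \<open>u\<close> bounds all coordinates at once, because the
    finiteness result for functions wants a single finite range.\<close>
  have "{v. v \<le> u} \<subseteq> {v. \<forall>i. (i \<in> supp u \<longrightarrow> v i \<in> {..sum u (supp u)})
     \<and> (i \<notin> supp u \<longrightarrow> v i = 0)}"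
  proof (intro subsetI CollectI allI conjI impI; unfold mem_Collect_eq)
    fix v i assume v: "v \<le> u" and i: "i \<in> supp u"
    have "v i \<le> u i" using v by (simp add: le_fun_def)
    also have "u i \<le> sum u (supp u)" using i assms by (intro member_le_sum) auto
    finally show "v i \<in> {..sum u (supp u)}" by simp
  next
    fix v i assume v: "v \<le> u" and "i \<notin> supp u"
    moreover have "v i \<le> u i" using v by (simp add: le_fun_def)
    ultimately show "v i = 0" by (simp add: supp_def)
  qed
  moreover have "finite {v. \<forall>i. (i \<in> supp u \<longrightarrow> v i \<in> {..sum u (supp u)})
     \<and> (i \<notin> supp u \<longrightarrow> v i = 0)}"
    using assms by (intro finite_set_of_finite_funs) auto
  ultimately show ?thesis by (rule finite_subset)
qed

lemma le_diff_add_fun [simp]: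
  fixes u v :: "nat \<Rightarrow> nat"
  shows "v \<le> u \<Longrightarrow> v + (u - v) = u" "v \<le> u \<Longrightarrow> u - v + v = u"
  by (simp_all add: fun_eq_iff le_fun_def)

lemma fun_add_diff [simp]:
  fixes u v :: "nat \<Rightarrow> nat"
  shows "u + v - u = v" "u + v - v = u"
  by (simp_all add: fun_eq_iff)

lemma fun_le_add [simp]:
  fixes u v :: "nat \<Rightarrow> nat"
  shows "u \<le> u + v" "v \<le> u + v"
  by (simp_all add: le_fun_def)

lemma supp_mono: "v \<le> u \<Longrightarrow> supp v \<subseteq> supp u"
  unfolding supp_def le_fun_def by (metis (mono_tags, lifting) Collect_mono le_zero_eq)

text \<open>The number of variables cannot be a type parameter, so the type holds series in
  countably many variables whose exponents have finite support; finite support keeps every Cauchy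
  product a finite sum. Membership in \<open>comm_ring_1\<close> gives access to the freshman's
  dream, and \<open>series n\<close> later cuts out the ring in n variables.\<close>

typedef (overloaded) 'k mps = "{f :: (nat \<Rightarrow> nat) \<Rightarrow> 'k::zero. \<forall>u. f u \<noteq> 0 \<longrightarrow> finite (supp u)}"
  morphisms mcoeff Abs_mps
  by (rule exI[of _ "\<lambda>_. 0"]) simp

setup_lifting type_definition_mps

lemma mps_eqI: "(\<And>u. finite (supp u) \<Longrightarrow> mcoeff f u = mcoeff g u) \<Longrightarrow> f = g"
  by transfer (metis ext)

lemma mcoeff_infinite: "infinite (supp u) \<Longrightarrow> mcoeff f u = 0"
  by transfer blast

lemma minus_minus_fun:
  fixes u v :: "nat \<Rightarrow> nat"
  shows "\<forall>i. v i \<le> u i \<Longrightarrow> u - (u - v) = v"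
  by (simp add: fun_eq_iff)

lemma diff_eq_iff_fun:
  fixes u v w :: "nat \<Rightarrow> nat"
  assumes "v \<le> w"
  shows "w - v = u \<longleftrightarrow> u \<le> w \<and> v = w - u"
proof -
  have "w i - v i = u i \<longleftrightarrow> u i \<le> w i \<and> v i = w i - u i" for i
    using le_funD[OF assms, of i] by auto
  then show ?thesis by (auto simp: fun_eq_iff le_fun_def)
qed

lemma sum_convolution_commute:
  fixes f g :: "(nat \<Rightarrow> nat) \<Rightarrow> 'k::comm_semiring_0"
  shows "(\<Sum>v | v \<le> u. f v * g (u - v)) = (\<Sum>v | v \<le> u. g v * f (u - v))"
  by (rule sum.reindex_bij_witness[of _ "\<lambda>v. u - v" "\<lambda>v. u - v"])
     (auto simp: le_fun_def mult.commute minus_minus_fun)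

lemma sum_convolution_assoc:
  fixes f g h :: "(nat \<Rightarrow> nat) \<Rightarrow> 'k::semiring_0"
  assumes "finite (supp u)"
  shows "(\<Sum>v | v \<le> u. (\<Sum>w | w \<le> v. f w * g (v - w)) * h (u - v)) =
         (\<Sum>w | w \<le> u. f w * (\<Sum>x | x \<le> u - w. g x * h (u - w - x)))"
proof -
  have fin: "finite {v. v \<le> w}" if "w \<le> u" for w
    using finite_le_fun[OF finite_subset[OF supp_mono[OF that] assms]] .
  have fin': "finite {v. v \<le> u - w}" for w
    by (rule fin) (simp add: le_fun_def)
  have "(\<Sum>v | v \<le> u. (\<Sum>w | w \<le> v. f w * g (v - w)) * h (u - v)) =
     (\<Sum>(v,w)\<in>Sigma {v. v \<le> u} (\<lambda>v. {w. w \<le> v}). f w * g (v - w) * h (u - v))"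
    using fin by (simp add: sum_distrib_right sum.Sigma)
  \<comment> \<open>A chain w \<le> v \<le> u is recoded by \<open>w\<close> and the difference x =
    v - w, which turns the left bracketing of the three factors into the right one.\<close>
  also have "\<dots> = (\<Sum>(w,x)\<in>Sigma {v. v \<le> u} (\<lambda>w. {x. x \<le> u - w}). f w * (g x * h (u - w - x)))"
  proof (rule sum.reindex_bij_witness[of _ "\<lambda>(w,x). (w + x, w)" "\<lambda>(v,w). (w, v - w)"], goal_cases)
    case (1 a)
    then show ?case by (auto simp: le_fun_def fun_eq_iff)
  next
    case (2 a)
    then obtain v w where a: "a = (v, w)" "v \<le> u" "w \<le> v" by auto
    then show ?case by (auto simp: le_fun_def intro: order_trans diff_le_mono)
  next
    case (3 a)
    then show ?case by (auto simp: le_fun_def fun_eq_iff)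
  next
    case (4 a)
    then obtain w x where a: "a = (w, x)" "w \<le> u" "x \<le> u - w" by auto
    have "w i + x i \<le> u i" for i
    proof -
      have "w i \<le> u i" "x i \<le> u i - w i" using a by (auto simp: le_fun_def)
      then show ?thesis by simp
    qed
    then show ?case using a by (auto simp: le_fun_def)
  next
    case (5 a)
    then obtain v w where a: "a = (v, w)" "v \<le> u" "w \<le> v" by auto
    have "u - w - (v - w) = u - v"
      using a by (auto simp: le_fun_def fun_eq_iff)
    then show ?case using a by (simp add: mult.assoc)
  qed
  also have "\<dots> = (\<Sum>w | w \<le> u. f w * (\<Sum>x | x \<le> u - w. g x * h (u - w - x)))"
    using fin fin' by (simp add: sum_distrib_left sum.Sigma)
  finally show ?thesis .
qed

instantiation mps :: (comm_ring_1) comm_ring_1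
begin

lift_definition zero_mps :: "'a mps" is "\<lambda>_. 0" by simp
lift_definition one_mps :: "'a mps" is "\<lambda>u. if u = (\<lambda>_. 0) then 1 else 0"
  by (auto split: if_splits)
lift_definition plus_mps :: "'a mps \<Rightarrow> 'a mps \<Rightarrow> 'a mps" is "\<lambda>f g u. f u + g u"
  by (metis add_0)
lift_definition minus_mps :: "'a mps \<Rightarrow> 'a mps \<Rightarrow> 'a mps" is "\<lambda>f g u. f u - g u"
  by (metis diff_0_right)
lift_definition uminus_mps :: "'a mps \<Rightarrow> 'a mps" is "\<lambda>f u. - f u"
  by (metis neg_equal_0_iff_equal)
lift_definition times_mps :: "'a mps \<Rightarrow> 'a mps \<Rightarrow> 'a mps" is
  "\<lambda>f g u. \<Sum>v | v \<le> u. f v * g (u - v)"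
proof -
  fix f g :: "(nat \<Rightarrow> nat) \<Rightarrow> 'a" and u :: "nat \<Rightarrow> nat"
  assume f: "\<And>u. f u \<noteq> 0 \<Longrightarrow> finite (supp u)" and g: "\<And>u. g u \<noteq> 0 \<Longrightarrow> finite (supp u)"
    and nz: "(\<Sum>v | v \<le> u. f v * g (u - v)) \<noteq> 0"
  then obtain v where "v \<le> u" "f v * g (u - v) \<noteq> 0"
    by (metis (mono_tags, lifting) sum.neutral mem_Collect_eq)
  then have "finite (supp v)" "finite (supp (u - v))"
    using f g by (metis mult_zero_left, metis mult_zero_right)
  moreover have "supp u \<subseteq> supp v \<union> supp (u - v)" by (auto simp: supp_def)
  ultimately show "finite (supp u)" by (meson finite_UnI finite_subset)
qed

instance
proof
  fix a b c :: "'a mps"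
  show "a * b * c = a * (b * c)"
    by (rule mps_eqI, transfer) (simp add: sum_convolution_assoc)
  show "a * b = b * a"
    by transfer (simp add: fun_eq_iff sum_convolution_commute)
  show "1 * a = a"
  proof (rule mps_eqI, transfer)
    fix a :: "(nat \<Rightarrow> nat) \<Rightarrow> 'a" and u :: "nat \<Rightarrow> nat"
    assume "finite (supp u)"
    have "(\<Sum>v | v \<le> u. (if v = (\<lambda>_. 0) then 1 else 0) * a (u - v)) =
      (\<Sum>v | v \<le> u. if v = (\<lambda>_. 0) then a u else 0)"
      by (rule sum.cong) (auto simp: fun_diff_def)
    also have "\<dots> = a u"
      using finite_le_fun[OF \<open>finite (supp u)\<close>] by (subst sum.delta) (auto simp: le_fun_def)
    finally show "(\<Sum>v | v \<le> u. (if v = (\<lambda>_. 0) then 1 else 0) * a (u - v)) = a u" .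
  qed
  show "(a + b) * c = a * c + b * c"
    by transfer (simp add: fun_eq_iff distrib_right sum.distrib)
  show "a + b + c = a + (b + c)" by transfer (simp add: add.assoc)
  show "a + b = b + a" by transfer (simp add: add.commute)
  show "0 + a = a" by transfer simp
  show "- a + a = 0" by transfer simp
  show "a - b = a + - b" by transfer simp
  show "(0::'a mps) \<noteq> 1" by transfer (metis zero_neq_one)
qed

end

lemmas mcoeff_simps [simp] = zero_mps.rep_eq plus_mps.rep_eq minus_mps.rep_eq uminus_mps.rep_eq
lemmas mcoeff_one = one_mps.rep_eq
lemmas mcoeff_mult = times_mps.rep_eq

lemma mcoeff_sum [simp]: "mcoeff (sum f A) u = (\<Sum>x\<in>A. mcoeff (f x) u)"
  by (induction A rule: infinite_finite_induct) auto

text \<open>The finiteness test makes the definition total: an exponent of infinite support yields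
  0, hence the finiteness premises in the rules about monomials.\<close>

lift_definition mmonom :: "(nat \<Rightarrow> nat) \<Rightarrow> 'k::comm_ring_1 \<Rightarrow> 'k mps" is
  "\<lambda>u a v. if v = u \<and> finite (supp u) then a else 0"
  by (auto split: if_splits)

lemma mcoeff_mmonom: "finite (supp u) \<Longrightarrow> mcoeff (mmonom u a) v = (if v = u then a else 0)"
  by transfer auto

lemma mmonom_0_1: "mmonom 0 1 = 1"
  by transfer (auto simp: fun_eq_iff)

lemma mcoeff_mult_mmonom:
  fixes f :: "'k::comm_ring_1 mps"
  assumes u: "finite (supp u)"
  shows "mcoeff (f * mmonom u a) w = (if u \<le> w then mcoeff f (w - u) * a else 0)"
proof (cases "finite (supp w)")
  case False
  have "infinite (supp (w - u))" if "u \<le> w"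
  proof
    assume "finite (supp (w - u))"
    from finite_UnI[OF this u] have "finite (supp w)"
      by (rule finite_subset[rotated]) (auto simp: supp_def)
    then show False using False by simp
  qed
  then show ?thesis using False by (simp add: mcoeff_infinite)
next
  case True
  have "mcoeff (f * mmonom u a) w = (\<Sum>v | v \<le> w. if v = w - u then (if u \<le> w then mcoeff f v * a else 0) else 0)"
    unfolding mcoeff_mult
    by (rule sum.cong) (auto simp: mcoeff_mmonom u diff_eq_iff_fun)
  also have "\<dots> = (if u \<le> w then mcoeff f (w - u) * a else 0)"
    using finite_le_fun[OF True] by (subst sum.delta) (auto simp: le_fun_def)
  finally show ?thesis .
qed

lemma mmonom_mult:
  fixes a b :: "'k::comm_ring_1"
  assumes "finite (supp u)" "finite (supp v)"
  shows "mmonom u a * mmonom v b = mmonom (u + v) (a * b)"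
proof -
  have "finite (supp (u + v))" using assms by simp
  then have "mcoeff (mmonom u a * mmonom v b) w = mcoeff (mmonom (u + v) (a * b)) w" for w
    using assms by (auto simp: mcoeff_mult_mmonom mcoeff_mmonom)
  then show ?thesis by (intro mps_eqI)
qed

lemma mmonom_power:
  fixes a :: "'k::comm_ring_1"
  assumes "finite (supp u)"
  shows "mmonom u a ^ m = mmonom (\<lambda>i. m * u i) (a ^ m)"
proof (induction m)
  case 0
  show ?case using mmonom_0_1 by (simp add: zero_fun_def)
next
  case (Suc m)
  have "finite (supp (\<lambda>i. m * u i))" by (rule finite_subset[OF _ assms]) (auto simp: supp_def)
  then show ?case using Suc assms by (simp add: mmonom_mult plus_fun_def)
qed

lemma of_nat_mps: "of_nat m = mmonom 0 (of_nat m)"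
proof (induction m)
  case 0
  show ?case by (rule mps_eqI) (simp add: mcoeff_mmonom)
next
  case (Suc m)
  then show ?case by (intro mps_eqI) (simp add: mcoeff_mmonom mcoeff_one zero_fun_def)
qed

text \<open>Carries the characteristic over to the series, so that q-th powers are additive
  there.\<close>

lemma CHAR_mps: "CHAR('k::comm_ring_1 mps) = CHAR('k)"
proof (rule CHAR_eqI)
  show "of_nat CHAR('k) = (0 :: 'k mps)"
    unfolding of_nat_mps by (rule mps_eqI) (simp add: mcoeff_mmonom)
next
  fix x assume "of_nat x = (0 :: 'k mps)"
  then have "mcoeff (mmonom 0 (of_nat x) :: 'k mps) 0 = 0" by (simp add: of_nat_mps)
  then have "of_nat x = (0 :: 'k)" by (simp add: mcoeff_mmonom)
  then show "CHAR('k) dvd x" by (simp add: of_nat_eq_0_iff_char_dvd)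
qed

text \<open>A coefficient of a product at \<open>u\<close> only sees coefficients below
  \<open>u\<close>. This allows the tail of a series to be discarded when one coefficient of its
  q-th power is computed.\<close>

lemma mcoeff_power_vanish:
  fixes r :: "'k::comm_ring_1 mps"
  assumes "\<And>v. v \<le> u \<Longrightarrow> mcoeff r v = 0" "m > 0"
  shows "mcoeff (r ^ m) u = 0"
proof -
  obtain k where "m = Suc k" using assms(2) by (cases m) auto
  then show ?thesis using assms(1) by (simp add: mcoeff_mult)
qed

text \<open>Up to degree \<open>u\<close> a series is a finite sum of monomials, to which the Frobenius
  endomorphism applies term by term.\<close>

lemma mcoeff_frobenius:
  fixes f :: "'k::comm_ring_1 mps"
  assumes p: "prime p" "CHAR('k) = p" and q: "q = p ^ e"
  shows "mcoeff (f ^ q) u = (if \<forall>i. q dvd u i then mcoeff f (\<lambda>i. u i div q) ^ q else 0)"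
proof (cases "finite (supp u)")
  have q0: "q > 0" using p(1) q by (simp add: prime_gt_0_nat)
  case False
  have "infinite (supp (\<lambda>i. u i div q))" if "\<forall>i. q dvd u i"
  proof -
    have "supp u = supp (\<lambda>i. u i div q)"
      using that q0 by (auto simp: supp_def div_eq_0_iff dest: nat_dvd_not_less)
    then show ?thesis using False by simp
  qed
  then show ?thesis using False q0 by (auto simp: mcoeff_infinite zero_power)
next
  have q0: "q > 0" using p(1) q by (simp add: prime_gt_0_nat)
  case True
  note char = CHAR_mps[where 'k='k]
  have fin: "finite {v. v \<le> u}" by (rule finite_le_fun[OF True])
  have finv: "finite (supp v)" if "v \<le> u" for v
    by (rule finite_subset[OF supp_mono[OF that] True])
  define t where "t = (\<Sum>v | v \<le> u. mmonom v (mcoeff f v))"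
  have ct: "mcoeff t w = (if w \<le> u then mcoeff f w else 0)" for w
  proof -
    have "mcoeff t w = (\<Sum>v | v \<le> u. if v = w then mcoeff f w else 0)"
      unfolding t_def by (simp, rule sum.cong) (auto simp: mcoeff_mmonom finv)
    then show ?thesis using fin by (simp add: sum.delta)
  qed
  have "f ^ q = (t + (f - t)) ^ q" by simp
  also have "\<dots> = t ^ q + (f - t) ^ q"
    using p q char by (intro freshmans_dream') auto
  finally have "mcoeff (f ^ q) u = mcoeff (t ^ q) u"
    using mcoeff_power_vanish[of u "f - t" q] q0 by (simp add: ct)
  also have "t ^ q = (\<Sum>v | v \<le> u. mmonom v (mcoeff f v) ^ q)"
    unfolding t_def using p q char by (intro freshmans_dream_sum') auto
  also have "mcoeff \<dots> u = (\<Sum>v | v \<le> u. if u = (\<lambda>i. q * v i) then mcoeff f v ^ q else 0)"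
  proof (simp, rule sum.cong)
    fix v assume "v \<in> {v. v \<le> u}"
    then have "finite (supp v)" using finv by simp
    moreover from this have "finite (supp (\<lambda>i. q * v i))" by (rule finite_subset[rotated]) (auto simp: supp_def)
    ultimately show "mcoeff (mmonom v (mcoeff f v) ^ q) u = (if u = (\<lambda>i. q * v i) then mcoeff f v ^ q else 0)"
      by (simp add: mmonom_power mcoeff_mmonom)
  qed simp
  also have "\<dots> = (\<Sum>v | v \<le> u. if v = (\<lambda>i. u i div q)
      then (if \<forall>i. q dvd u i then mcoeff f (\<lambda>i. u i div q) ^ q else 0) else 0)"
    using q0 by (intro sum.cong) (auto simp: fun_eq_iff)
  also have "\<dots> = (if \<forall>i. q dvd u i then mcoeff f (\<lambda>i. u i div q) ^ q else 0)"
    using fin by (subst sum.delta) (auto simp: le_fun_def)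
  finally show ?thesis .
qed

section \<open>Series in the variables of index 1 to n\<close>

definition exps :: "nat \<Rightarrow> (nat \<Rightarrow> nat) set" where
  "exps n = {u. supp u \<subseteq> {1..n}}"

lemma exps_finite: "u \<in> exps n \<Longrightarrow> finite (supp u)"
  by (auto simp: exps_def intro: finite_subset)

lemma exps_add_iff [simp]: "u + v \<in> exps n \<longleftrightarrow> u \<in> exps n \<and> v \<in> exps n"
  by (auto simp: exps_def)

lemma exps_0 [simp]: "0 \<in> exps n" "(\<lambda>_. 0) \<in> exps n"
  by (auto simp: exps_def)

lemma exps_mono: "v \<le> u \<Longrightarrow> u \<in> exps n \<Longrightarrow> v \<in> exps n"
  using supp_mono by (auto simp: exps_def)

lemma exps_diff: "u \<in> exps n \<Longrightarrow> u - v \<in> exps n"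
  by (erule exps_mono[rotated]) (simp add: le_fun_def)

lemma exps_eq_0: "u \<in> exps n \<Longrightarrow> i \<notin> {1..n} \<Longrightarrow> u i = 0"
  by (auto simp: exps_def supp_def)

lemma finite_exps_bounded: "finite {u \<in> exps n. \<forall>i\<in>{1..n}. u i < N}"
proof -
  have "{u \<in> exps n. \<forall>i\<in>{1..n}. u i < N} \<subseteq>
      {u. \<forall>i. (i \<in> {1..n} \<longrightarrow> u i \<in> {..<N}) \<and> (i \<notin> {1..n} \<longrightarrow> u i = 0)}"
    using exps_eq_0 by blast
  then show ?thesis by (rule finite_subset) (intro finite_set_of_finite_funs; simp)
qed

definition series :: "nat \<Rightarrow> 'k::comm_ring_1 mps set" where
  "series n = {f. \<forall>u. mcoeff f u \<noteq> 0 \<longrightarrow> u \<in> exps n}"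

lemma series_coeff_0: "f \<in> series n \<Longrightarrow> u \<notin> exps n \<Longrightarrow> mcoeff f u = 0"
  by (auto simp: series_def)

lemma series_0 [simp]: "0 \<in> series n" and series_1 [simp]: "1 \<in> series n"
  by (auto simp: series_def mcoeff_one)

lemma series_add [simp]: "f \<in> series n \<Longrightarrow> g \<in> series n \<Longrightarrow> f + g \<in> series n"
  by (auto simp: series_def) (metis add_0)

lemma series_uminus [simp]: "f \<in> series n \<Longrightarrow> - f \<in> series n"
  by (auto simp: series_def)

lemma series_diff [simp]: "f \<in> series n \<Longrightarrow> g \<in> series n \<Longrightarrow> f - g \<in> series n"
  using series_add[of f n "- g"] by simp

lemma series_mult [simp]:
  assumes "f \<in> series n" "g \<in> series n"
  shows "f * g \<in> series n"
  unfolding series_def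
proof (intro CollectI allI impI)
  fix u assume "mcoeff (f * g) u \<noteq> 0"
  then obtain v where v: "v \<le> u" "mcoeff f v * mcoeff g (u - v) \<noteq> 0"
    unfolding mcoeff_mult by (metis (mono_tags, lifting) sum.neutral mem_Collect_eq)
  then have "v \<in> exps n" "u - v \<in> exps n"
    using assms mult_not_zero[OF v(2)] by (auto simp: series_def)
  then have "v + (u - v) \<in> exps n" by (simp del: le_diff_add_fun)
  then show "u \<in> exps n" using v(1) by simp
qed

lemma series_power [simp]: "f \<in> series n \<Longrightarrow> f ^ m \<in> series n"
  by (induction m) auto

lemma series_mmonom [simp]: "u \<in> exps n \<Longrightarrow> mmonom u a \<in> series n"
  by (auto simp: series_def mcoeff_mmonom exps_finite split: if_splits)

lemma series_sum: "(\<And>x. x \<in> A \<Longrightarrow> f x \<in> series n) \<Longrightarrow> sum f A \<in> series n"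
  by (induction A rule: infinite_finite_induct) auto

section \<open>Restriction, shift and induction over a monomial ideal\<close>

lift_definition mrestrict :: "((nat \<Rightarrow> nat) \<Rightarrow> bool) \<Rightarrow> 'k::comm_ring_1 mps \<Rightarrow> 'k mps" is
  "\<lambda>Q f u. if Q u then f u else 0"
  by (auto split: if_splits)

text \<open>Division by the monomial of exponent \<open>t\<close>, where the terms it does not
  divide are dropped.\<close>

lift_definition mshift :: "(nat \<Rightarrow> nat) \<Rightarrow> 'k::comm_ring_1 mps \<Rightarrow> 'k mps" is
  "\<lambda>t f u. f (u + t)"
  by (metis finite_Un supp_add)

lift_definition mps_of_fun :: "((nat \<Rightarrow> nat) \<Rightarrow> 'k) \<Rightarrow> 'k::comm_ring_1 mps" is
  "\<lambda>f u. if finite (supp u) then f u else 0"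
  by (auto split: if_splits)

lemmas mcoeff_ops [simp] = mrestrict.rep_eq mshift.rep_eq mps_of_fun.rep_eq

lemma series_mrestrict [simp]: "f \<in> series n \<Longrightarrow> mrestrict Q f \<in> series n"
  by (auto simp: series_def split: if_splits)

lemma series_mshift [simp]: "f \<in> series n \<Longrightarrow> mshift t f \<in> series n"
  unfolding series_def by (auto simp del: exps_add_iff dest: exps_add_iff[THEN iffD1])

lemma mrestrict_ge:
  assumes "finite (supp t)"
  shows "mrestrict (\<lambda>u. t \<le> u) f = mshift t f * mmonom t 1"
  by (rule mps_eqI) (simp add: mcoeff_mult_mmonom assms)

text \<open>A series has infinitely many terms, so the induction runs over the finite set
  \<open>T\<close> of generating exponents: the terms divisible by x^t for one chosen t form a
  multiple of x^t, and the remaining terms are treated with the smaller set. In this way a property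
  closed under sums and multiples reaches a whole monomial ideal of the power series ring.\<close>

lemma monomial_ideal_induct:
  fixes f :: "'k::comm_ring_1 mps"
  assumes "finite T" "T \<subseteq> exps n" "f \<in> series n"
    and "\<And>u. mcoeff f u \<noteq> 0 \<Longrightarrow> \<exists>t\<in>T. t \<le> u"
    and "P 0" "\<And>t. t \<in> T \<Longrightarrow> P (mmonom t 1)"
    and "\<And>f g. f \<in> series n \<Longrightarrow> g \<in> series n \<Longrightarrow> P f \<Longrightarrow> P g \<Longrightarrow> P (f + g)"
    and "\<And>h f. h \<in> series n \<Longrightarrow> f \<in> series n \<Longrightarrow> P f \<Longrightarrow> P (h * f)"
  shows "P f"
  using assms(1-4) assms(6)
proof (induction T arbitrary: f rule: finite_induct)
  case empty
  then have "f = 0" by (intro mps_eqI) auto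
  then show ?case using assms(5) by simp
next
  case (insert t T)
  have t: "t \<in> exps n" using insert.prems by simp
  define f1 where "f1 = mrestrict (\<lambda>u. t \<le> u) f"
  define f2 where "f2 = mrestrict (\<lambda>u. \<not> t \<le> u) f"
  have "f = f1 + f2" by (rule mps_eqI) (simp add: f1_def f2_def)
  moreover have "P f1"
    unfolding f1_def mrestrict_ge[OF exps_finite[OF t]]
    using insert.prems t by (intro assms(8)) auto
  moreover have "P f2"
  proof (rule insert.IH)
    show "f2 \<in> series n" using insert.prems by (simp add: f2_def)
    fix u assume "mcoeff f2 u \<noteq> 0"
    then have "mcoeff f u \<noteq> 0" "\<not> t \<le> u" by (auto simp: f2_def split: if_splits)
    then show "\<exists>t\<in>T. t \<le> u" using insert.prems(3) by blast
  qed (use insert.prems in auto)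
  ultimately show ?case
    using assms(7)[of f1 f2] insert.prems by (simp add: f1_def f2_def)
qed

section \<open>The Noetherian property\<close>

text \<open>Every sequence has a monotone subsequence, and a decreasing one of natural numbers is
  constant from its minimum on, hence weakly increasing there.\<close>

lemma nat_seq_incseq_subseq:
  fixes s :: "nat \<Rightarrow> nat"
  shows "\<exists>\<phi>. strict_mono \<phi> \<and> incseq (s \<circ> \<phi>)"
proof -
  obtain \<phi> :: "nat \<Rightarrow> nat" where \<phi>: "strict_mono \<phi>" "monoseq (\<lambda>k. s (\<phi> k))"
    using seq_monosub by blast
  show ?thesis
  proof (cases "incseq (\<lambda>k. s (\<phi> k))")
    case True
    then show ?thesis using \<phi> by (auto simp: comp_def)
  next
    case False
    then have dec: "decseq (\<lambda>k. s (\<phi> k))" using \<phi>(2) by (simp add: monoseq_iff)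
    define K where "K = (ARG_MIN (\<lambda>k. s (\<phi> k)) k. True)"
    have K: "s (\<phi> K) \<le> s (\<phi> k)" for k
      unfolding K_def by (rule arg_min_nat_le) simp
    have const: "s (\<phi> (K + k)) = s (\<phi> K)" for k
      using K[of "K + k"] decseqD[OF dec, of K "K + k"] by simp
    have "strict_mono (\<lambda>k. \<phi> (K + k))"
      using \<phi>(1) by (simp add: strict_mono_def)
    moreover have "incseq (s \<circ> (\<lambda>k. \<phi> (K + k)))"
      by (simp add: incseq_def const)
    ultimately show ?thesis by blast
  qed
qed

lemma dickson_subseq:
  fixes s :: "nat \<Rightarrow> nat \<Rightarrow> nat"
  assumes "finite I"
  shows "\<exists>\<phi>. strict_mono \<phi> \<and> (\<forall>i\<in>I. incseq (\<lambda>k. s (\<phi> k) i))"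
  using assms
proof (induction I rule: finite_induct)
  case empty
  show ?case by (auto intro: strict_mono_id)
next
  case (insert i I)
  then obtain \<phi> where \<phi>: "strict_mono \<phi>" "\<forall>i\<in>I. incseq (\<lambda>k. s (\<phi> k) i)" by blast
  obtain \<psi> where \<psi>: "strict_mono \<psi>" "incseq ((\<lambda>k. s (\<phi> k) i) \<circ> \<psi>)"
    using nat_seq_incseq_subseq by blast
  have "strict_mono (\<phi> \<circ> \<psi>)" using \<phi> \<psi> by (simp add: strict_mono_o)
  moreover have "incseq (\<lambda>k. s ((\<phi> \<circ> \<psi>) k) j)" if "j \<in> insert i I" for j
  proof (cases "j = i")
    case True
    then show ?thesis using \<psi> by (simp add: comp_def)
  next
    case False
    then have "incseq (\<lambda>k. s (\<phi> k) j)" using that \<phi> by simp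
    moreover have "mono \<psi>" using \<psi>(1) by (rule strict_mono_mono)
    ultimately show ?thesis by (simp add: incseq_def mono_def)
  qed
  ultimately show ?case by blast
qed

text \<open>The minimal elements suffice: infinitely many of them would contain two comparable ones,
  as some subsequence increases in every coordinate.\<close>

lemma dickson:
  assumes "L \<subseteq> exps n"
  shows "\<exists>M. finite M \<and> M \<subseteq> L \<and> (\<forall>u\<in>L. \<exists>m\<in>M. m \<le> u)"
proof -
  define M where "M = {u \<in> L. \<forall>v\<in>L. v \<le> u \<longrightarrow> v = u}"
  have "finite M"
  proof (rule ccontr)
    assume "infinite M"
    then obtain s :: "nat \<Rightarrow> nat \<Rightarrow> nat" where s: "inj s" "range s \<subseteq> M"
      using infinite_countable_subset by blast
    obtain \<phi> :: "nat \<Rightarrow> nat" where \<phi>: "strict_mono \<phi>" "\<forall>i\<in>{1..n}. incseq (\<lambda>k. s (\<phi> k) i)"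
      using dickson_subseq[of "{1..n}" s] by auto
    have L: "s k \<in> L" for k using s by (auto simp: M_def)
    have "s (\<phi> 0) i \<le> s (\<phi> 1) i" for i
    proof (cases "i \<in> {1..n}")
      case True
      then show ?thesis using \<phi>(2) by (auto simp: incseq_def)
    next
      case False
      then show ?thesis using exps_eq_0[of "s (\<phi> 0)" n i] L[of "\<phi> 0"] assms by auto
    qed
    then have "s (\<phi> 0) \<le> s (\<phi> 1)" by (simp add: le_fun_def)
    then have "s (\<phi> 0) = s (\<phi> 1)" using s(2) L by (auto simp: M_def)
    then have "\<phi> 0 = \<phi> 1" using s(1) by (simp add: inj_eq)
    then show False using strict_monoD[OF \<phi>(1), of 0 1] by simp
  qed
  moreover have "\<exists>m\<in>M. m \<le> u" if "u \<in> L" for u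
  proof -
    \<comment> \<open>An element below \<open>u\<close> of least total degree is minimal, since
      anything strictly smaller has smaller total degree.\<close>
    define m where "m = (ARG_MIN (\<lambda>v. sum v {1..n}) v. v \<in> L \<and> v \<le> u)"
    have m: "m \<in> L \<and> m \<le> u"
      unfolding m_def by (rule arg_min_natI[of _ u]) (simp add: that)
    have min: "sum m {1..n} \<le> sum v {1..n}" if "v \<in> L" "v \<le> u" for v
      using arg_min_nat_le[of "\<lambda>v. v \<in> L \<and> v \<le> u" v "\<lambda>v. sum v {1..n}"] that
      unfolding m_def by blast
    have "v = m" if v: "v \<in> L" "v \<le> m" for v
    proof (rule ext)
      fix i
      have le: "v j \<le> m j" for j using v(2) by (simp add: le_fun_def)
      have "sum m {1..n} \<le> sum v {1..n}" using min v m by auto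
      then have "sum v {1..n} = sum m {1..n}" using sum_mono[of "{1..n}" v m] le by simp
      then have eq: "\<forall>j\<in>{1..n}. v j = m j"
        using sum_mono_inv[of v "{1..n}" m] le by auto
      show "v i = m i"
        using eq exps_eq_0[of v n i] exps_eq_0[of m n i] v m subsetD[OF assms]
        by (cases "i \<in> {1..n}") metis+
    qed
    then show ?thesis using m by (auto simp: M_def)
  qed
  ultimately show ?thesis by (intro exI[of _ M]) (auto simp: M_def)
qed

text \<open>Sending the variables to distinct primes turns exponent vectors into positive integers,
  which yields a monomial order in which every exponent has only finitely many predecessors.\<close>

lemma monomial_order_exists:
  "\<exists>\<rho> :: (nat \<Rightarrow> nat) \<Rightarrow> nat.
     (\<forall>u v. \<rho> (u + v) = \<rho> u * \<rho> v) \<and> (\<forall>u. \<rho> u > 0) \<and> inj_on \<rho> (exps n)"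
proof -
  obtain P :: "nat \<Rightarrow> nat" where P: "inj P" "range P \<subseteq> {p. prime p}"
    using infinite_countable_subset[OF primes_infinite] by blast
  have prime: "prime (P i)" for i using P by auto
  define \<rho> :: "(nat \<Rightarrow> nat) \<Rightarrow> nat" where "\<rho> u = (\<Prod>i=1..n. P i ^ u i)" for u
  have "\<rho> (u + v) = \<rho> u * \<rho> v" for u v
    by (simp add: \<rho>_def power_add prod.distrib)
  moreover have "\<rho> u > 0" for u
    unfolding \<rho>_def by (intro prod_pos) (simp add: prime prime_gt_0_nat)
  moreover have "inj_on \<rho> (exps n)"
  proof (rule inj_onI, rule ext)
    fix u v i assume uv: "u \<in> exps n" "v \<in> exps n" "\<rho> u = \<rho> v"
    have mult: "multiplicity (P i) (\<rho> w) = w i" if "i \<in> {1..n}" for w i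
    proof -
      have "\<rho> w = (\<Prod>p\<in>P ` {1..n}. p ^ w (inv_into UNIV P p))"
        unfolding \<rho>_def using P(1) by (subst prod.reindex) (auto intro: inj_on_subset)
      moreover have "multiplicity (P i) (\<Prod>p\<in>P ` {1..n}. p ^ w (inv_into UNIV P p)) = w (inv_into UNIV P (P i))"
        using that prime by (subst multiplicity_prod_prime_powers) auto
      ultimately show ?thesis using P(1) by simp
    qed
    show "u i = v i"
      using mult[of i u] mult[of i v] uv exps_eq_0[of u n i] exps_eq_0[of v n i]
      by (cases "i \<in> {1..n}") auto
  qed
  ultimately show ?thesis by blast
qed

text \<open>Division with remainder by series whose leading exponents generate all leading exponents of
  the ideal; the quotients are found by recursion along the monomial order.\<close>

lemma series_ideal_finitely_generated:
  fixes K :: "'k::field mps set"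
  assumes K: "K \<subseteq> series n" "0 \<in> K"
    and add: "\<And>f g. f \<in> K \<Longrightarrow> g \<in> K \<Longrightarrow> f + g \<in> K"
    and mult: "\<And>h f. h \<in> series n \<Longrightarrow> f \<in> K \<Longrightarrow> h * f \<in> K"
  shows "\<exists>B. finite B \<and> B \<subseteq> K \<and>
    (\<forall>f\<in>K. \<exists>h. (\<forall>b\<in>B. h b \<in> series n) \<and> f = (\<Sum>b\<in>B. h b * b))"
proof -
  obtain \<rho> :: "(nat \<Rightarrow> nat) \<Rightarrow> nat" where \<rho>: "\<And>u v. \<rho> (u + v) = \<rho> u * \<rho> v" "\<And>u. \<rho> u > 0"
    and inj: "inj_on \<rho> (exps n)"
    using monomial_order_exists by blast
  define lead where "lead f u \<longleftrightarrow> mcoeff f u = 1 \<and> (\<forall>v. mcoeff f v \<noteq> 0 \<longrightarrow> \<rho> u \<le> \<rho> v)"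
    for f :: "'k mps" and u
  define L where "L = {u \<in> exps n. \<exists>f\<in>K. lead f u}"
  obtain M where M: "finite M" "M \<subseteq> L" "\<forall>u\<in>L. \<exists>m\<in>M. m \<le> u"
    using dickson[of L n] by (auto simp: L_def)
  define ch where "ch u = (SOME m. m \<in> M \<and> m \<le> u)" for u
  have ch: "ch u \<in> M" "ch u \<le> u" if "u \<in> L" for u
    using someI_ex[of "\<lambda>m. m \<in> M \<and> m \<le> u"] M(3) that by (auto simp: ch_def)
  define b where "b m = (SOME f. f \<in> K \<and> lead f m)" for m
  have b: "b m \<in> K" "lead (b m) m" if "m \<in> M" for m
    using someI_ex[of "\<lambda>f. f \<in> K \<and> lead f m"] M(2) that by (auto simp: b_def L_def)
  have gen: "\<exists>h. (\<forall>m\<in>M. h m \<in> series n) \<and> g = (\<Sum>m\<in>M. h m * b m)" if g: "g \<in> K" for g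
  proof -
    \<comment> \<open>The contribution to the coefficient at \<open>u\<close> of the product of the
      quotient for \<open>m\<close>, taken at exponent \<open>v\<close>, with \<open>b m\<close>.
      Each exponent in \<open>L\<close> is assigned to one divisor \<open>ch\<close>, so the single
      function \<open>a\<close> encodes all quotients.\<close>
    define term' where "term' a u = (\<lambda>(m, v). (if v + m \<in> L \<and> ch (v + m) = m then a (v + m) else 0)
        * mcoeff (b m) (u - v))" for a :: "(nat \<Rightarrow> nat) \<Rightarrow> 'k" and u
    \<comment> \<open>The contributions that involve \<open>a\<close> only at exponents of smaller
      \<open>\<rho>\<close>; restricting to them makes the recursion for \<open>a\<close>
      well-founded.\<close>
    define D where "D u = {(m, v). m \<in> M \<and> v \<le> u \<and> \<rho> (v + m) < \<rho> u}" for u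
    define G where "G a u = mcoeff g u - sum (term' a u) (D u)" for a u
    have "wfrec (measure \<rho>) G = G (wfrec (measure \<rho>) G)"
    proof (rule wfrec_fixpoint)
      show "adm_wf (measure \<rho>) G"
        unfolding adm_wf_def G_def by (auto simp: D_def term'_def intro!: sum.cong)
    qed simp
    then obtain a where a: "a = G a" by metis
    define h where "h m = mshift m (mrestrict (\<lambda>u. u \<in> L \<and> ch u = m) (mps_of_fun a))" for m
    have h: "h m \<in> series n" for m
      unfolding series_def h_def using exps_add_iff by (auto simp: L_def split: if_splits)
    have hc: "mcoeff (h m) v = (if v + m \<in> L \<and> ch (v + m) = m then a (v + m) else 0)" for m v
      by (auto simp: h_def L_def exps_def intro: finite_subset)
    define S where "S = (\<Sum>m\<in>M. h m * b m)"
    have S: "mcoeff S u = mcoeff g u" if u: "u \<in> L" for u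
    proof -
      have fin: "finite {v. v \<le> u}" using u by (auto simp: L_def intro: finite_le_fun exps_finite)
      \<comment> \<open>The contribution in which \<open>a\<close> is evaluated at \<open>u\<close>
        itself. Its other factor is the leading coefficient 1, so the recursion can solve for
        \<open>a u\<close>.\<close>
      define x0 where "x0 = (ch u, u - ch u)"
      have x0: "x0 \<notin> D u" using ch(2)[OF u] by (simp add: x0_def D_def)
      have D: "finite (D u)"
        by (rule finite_subset[OF _ finite_cartesian_product[OF M(1) fin]]) (auto simp: D_def)
      have "mcoeff S u = (\<Sum>x\<in>M \<times> {v. v \<le> u}. term' a u x)"
        by (simp add: S_def mcoeff_mult hc term'_def sum.cartesian_product)
      also have "\<dots> = (\<Sum>x\<in>insert x0 (D u). term' a u x)"
      proof (rule sum.mono_neutral_right)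
        show "finite (M \<times> {v. v \<le> u})" using M fin by simp
        show "insert x0 (D u) \<subseteq> M \<times> {v. v \<le> u}"
          using ch[OF u] by (auto simp: D_def x0_def le_fun_def)
        show "\<forall>x\<in>M \<times> {v. v \<le> u} - insert x0 (D u). term' a u x = 0"
        proof (rule ballI, rule ccontr)
          fix x assume x: "x \<in> M \<times> {v. v \<le> u} - insert x0 (D u)" and nz: "term' a u x \<noteq> 0"
          obtain m v where mv: "x = (m, v)" by (cases x)
          have m: "m \<in> M" "v \<le> u" and nD: "\<not> \<rho> (v + m) < \<rho> u" using x by (auto simp: mv D_def)
          have L: "v + m \<in> L" "ch (v + m) = m" and "mcoeff (b m) (u - v) \<noteq> 0"
            using nz by (auto simp: mv term'_def split: if_splits)
          then have "\<rho> m \<le> \<rho> (u - v)" using b(2)[OF m(1)] by (simp add: lead_def)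
          then have "\<rho> v * \<rho> m \<le> \<rho> v * \<rho> (u - v)" by simp
          also have "\<dots> = \<rho> u" using \<rho>(1)[of v "u - v"] m(2) by simp
          finally have "\<rho> (v + m) = \<rho> u" using nD \<rho>(1) by simp
          then have "v + m = u" using inj_onD[OF inj] L u by (auto simp: L_def)
          then have "x = x0" using L by (auto simp: mv x0_def)
          then show False using x by simp
        qed
      qed
      also have "\<dots> = term' a u x0 + sum (term' a u) (D u)"
        using x0 D by simp
      also have "term' a u x0 = a u"
        using ch[OF u] b(2)[of "ch u"] u
        by (simp add: term'_def x0_def lead_def minus_minus_fun le_fun_def)
      also have "a u = mcoeff g u - sum (term' a u) (D u)"
        by (subst a) (simp add: G_def)
      finally show ?thesis by simp
    qed
    have SK: "S \<in> K" unfolding S_def using M(1) h b(1)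
    proof (induction M rule: finite_induct)
      case empty
      then show ?case using K by simp
    next
      case (insert m M)
      then show ?case using add mult by simp
    qed
    \<comment> \<open>A nonzero remainder lies in \<open>K\<close> and, once normalised, has a
      leading exponent. That exponent belongs to \<open>L\<close>, where the remainder has been made
      to vanish.\<close>
    have "g = S"
    proof (rule ccontr)
      assume "g \<noteq> S"
      define d where "d = g - S"
      have "\<exists>u. mcoeff d u \<noteq> 0" using \<open>g \<noteq> S\<close> mps_eqI[of g S] by (auto simp: d_def)
      then obtain u where u: "mcoeff d u \<noteq> 0" and min: "\<And>v. mcoeff d v \<noteq> 0 \<Longrightarrow> \<rho> u \<le> \<rho> v"
        using ex_has_least_nat[of "\<lambda>u. mcoeff d u \<noteq> 0" _ \<rho>] by auto
      have "d = g + (- 1) * S" by (simp add: d_def)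
      then have dK: "d \<in> K" using g SK add[OF g mult[OF _ SK, of "- 1"]] by simp
      define d' where "d' = mmonom 0 (inverse (mcoeff d u)) * d"
      have d': "mcoeff d' v = inverse (mcoeff d u) * mcoeff d v" for v
        unfolding d'_def mult.commute[of _ d]
        by (simp add: mcoeff_mult_mmonom le_fun_def fun_diff_def mult.commute)
      have "d' \<in> K" unfolding d'_def using mult dK by simp
      moreover have "lead d' u" using u min by (simp add: lead_def d')
      moreover have "u \<in> exps n" using u dK K(1) series_coeff_0 by blast
      ultimately have "u \<in> L" by (auto simp: L_def)
      then show False using S u by (simp add: d_def)
    qed
    then show ?thesis using h unfolding S_def by (intro exI[of _ h]) simp
  qed
  show ?thesis
  proof (intro exI[of _ "b ` M"] conjI ballI)
    fix f assume "f \<in> K"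
    then obtain h where h: "\<forall>m\<in>M. h m \<in> series n" "f = (\<Sum>m\<in>M. h m * b m)" using gen by blast
    define h' where "h' x = (\<Sum>m\<in>{m \<in> M. b m = x}. h m)" for x
    have "f = (\<Sum>x\<in>b ` M. \<Sum>m\<in>{m \<in> M. b m = x}. h m * b m)"
      unfolding h(2) by (rule sum.image_gen[OF M(1)])
    also have "\<dots> = (\<Sum>x\<in>b ` M. h' x * x)"
      unfolding h'_def sum_distrib_right by (intro sum.cong) auto
    finally show "\<exists>h. (\<forall>b\<in>b ` M. h b \<in> series n) \<and> f = (\<Sum>b\<in>b ` M. h b * b)"
      using h(1) by (intro exI[of _ h']) (auto simp: h'_def intro: series_sum)
  qed (use M b in auto)
qed

text \<open>The union of the chain is an ideal, hence finitely generated, and its finitely many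
  generators already lie in one member.\<close>

lemma series_ideal_chain:
  fixes J :: "nat \<Rightarrow> 'k::field mps set"
  assumes J: "\<And>j. J j \<subseteq> series n" "\<And>j. 0 \<in> J j" "\<And>j. J j \<subseteq> J (Suc j)"
    and add: "\<And>j f g. f \<in> J j \<Longrightarrow> g \<in> J j \<Longrightarrow> f + g \<in> J j"
    and mult: "\<And>j h f. h \<in> series n \<Longrightarrow> f \<in> J j \<Longrightarrow> h * f \<in> J j"
  shows "\<exists>N. \<forall>j. J j \<subseteq> J N"
proof -
  have mono: "J i \<subseteq> J j" if "i \<le> j" for i j
    using lift_Suc_mono_le[of J, OF J(3) that] .
  define K where "K = (\<Union>j. J j)"
  have "\<exists>B. finite B \<and> B \<subseteq> K \<and>
    (\<forall>f\<in>K. \<exists>h. (\<forall>b\<in>B. h b \<in> series n) \<and> f = (\<Sum>b\<in>B. h b * b))"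
  proof (rule series_ideal_finitely_generated)
    show "K \<subseteq> series n" "0 \<in> K" using J by (auto simp: K_def)
    fix f g assume "f \<in> K" "g \<in> K"
    then obtain i j where "f \<in> J i" "g \<in> J j" by (auto simp: K_def)
    then have "f \<in> J (max i j)" "g \<in> J (max i j)" using mono[of i "max i j"] mono[of j "max i j"] by auto
    then show "f + g \<in> K" using add by (auto simp: K_def)
  next
    fix h f :: "'k mps" assume "h \<in> series n" "f \<in> K"
    then show "h * f \<in> K" using mult by (auto simp: K_def)
  qed
  then obtain B where B: "finite B" "B \<subseteq> K"
    and gen: "\<And>f. f \<in> K \<Longrightarrow> \<exists>h. (\<forall>b\<in>B. h b \<in> series n) \<and> f = (\<Sum>b\<in>B. h b * b)"
    by blast
  have "\<exists>N. B \<subseteq> J N" using B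
  proof (induction B rule: finite_induct)
    case (insert x B)
    then obtain N j where "B \<subseteq> J N" "x \<in> J j" by (auto simp: K_def)
    then have "insert x B \<subseteq> J (max N j)" using mono[of N "max N j"] mono[of j "max N j"] by auto
    then show ?case by blast
  qed auto
  then obtain N where N: "B \<subseteq> J N" by blast
  have "K \<subseteq> J N"
  proof
    fix f assume "f \<in> K"
    then obtain h where h: "\<forall>b\<in>B. h b \<in> series n" "f = (\<Sum>b\<in>B. h b * b)" using gen by blast
    have "(\<Sum>b\<in>B. h b * b) \<in> J N" using B(1) N h(1)
      by (induction B rule: finite_induct) (auto simp: J add mult)
    then show "f \<in> J N" using h by simp
  qed
  then show ?thesis by (auto simp: K_def)
qed

section \<open>Inverse polynomials\<close>

text \<open>\<open>c w\<close> is the coefficient of the inverse monomial indexed by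
  \<open>w\<close>, and \<open>D\<close> is the set of allowed supports: the faces for the hull over
  \<open>A\<close>, and \<open>UNIV\<close> for the ambient module over the power series
  ring.\<close>

definition invp :: "nat \<Rightarrow> nat set set \<Rightarrow> ((nat \<Rightarrow> nat) \<Rightarrow> 'k::field) set" where
  "invp n D = {c. finite {w. c w \<noteq> 0} \<and> (\<forall>w. c w \<noteq> 0 \<longrightarrow> w \<in> exps n \<and> supp w \<in> D)}"

text \<open>Contraction: x^v sends the inverse monomial of \<open>w\<close> to that of w - v if v
  \<le> w, and to 0 otherwise. Finiteness of the support of \<open>c\<close> lets every power series
  act, not only polynomials.\<close>

definition act :: "'k::field mps \<Rightarrow> ((nat \<Rightarrow> nat) \<Rightarrow> 'k) \<Rightarrow> (nat \<Rightarrow> nat) \<Rightarrow> 'k" where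
  "act f c u = (\<Sum>w | c w \<noteq> 0 \<and> u \<le> w. c w * mcoeff f (w - u))"

definition delta :: "(nat \<Rightarrow> nat) \<Rightarrow> 'k::field \<Rightarrow> (nat \<Rightarrow> nat) \<Rightarrow> 'k" where
  "delta w a = (\<lambda>v. if v = w then a else 0)"

lemma invpD:
  assumes "c \<in> invp n D"
  shows "finite {w. c w \<noteq> 0}" "c w \<noteq> 0 \<Longrightarrow> w \<in> exps n" "c w \<noteq> 0 \<Longrightarrow> supp w \<in> D"
  using assms by (auto simp: invp_def)

lemma invp_0 [simp]: "0 \<in> invp n D"
  by (simp add: invp_def)

lemma invp_add [simp]:
  assumes "c \<in> invp n D" "d \<in> invp n D"
  shows "c + d \<in> invp n D"
proof -
  have "finite {w. (c + d) w \<noteq> 0}"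
    by (rule finite_subset[OF _ finite_UnI[OF invpD(1)[OF assms(1)] invpD(1)[OF assms(2)]]]) auto
  moreover have "w \<in> exps n \<and> supp w \<in> D" if "(c + d) w \<noteq> 0" for w
    using that invpD(2-3)[OF assms(1), of w] invpD(2-3)[OF assms(2), of w] by fastforce
  ultimately show ?thesis by (simp add: invp_def)
qed

lemma invp_uminus [simp]: "c \<in> invp n D \<Longrightarrow> - c \<in> invp n D"
  by (simp add: invp_def)

lemma invp_diff [simp]: "c \<in> invp n D \<Longrightarrow> d \<in> invp n D \<Longrightarrow> c - d \<in> invp n D"
  using invp_add[of c n D "- d"] by simp

lemma invp_delta: "w \<in> exps n \<Longrightarrow> supp w \<in> D \<Longrightarrow> delta w a \<in> invp n D"
  by (auto simp: invp_def delta_def)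

lemma act_eq_sum:
  assumes "finite W" "{w. c w \<noteq> 0} \<subseteq> W"
  shows "act f c u = (\<Sum>w\<in>W. if u \<le> w then c w * mcoeff f (w - u) else 0)"
proof -
  have "(\<Sum>w\<in>W. if u \<le> w then c w * mcoeff f (w - u) else 0)
      = (\<Sum>w | c w \<noteq> 0 \<and> u \<le> w. if u \<le> w then c w * mcoeff f (w - u) else 0)"
    by (rule sum.mono_neutral_right) (use assms in auto)
  also have "\<dots> = act f c u"
    unfolding act_def by (rule sum.cong) auto
  finally show ?thesis by simp
qed

lemma act_nonzero:
  assumes "act f c u \<noteq> 0"
  obtains w where "c w \<noteq> 0" "u \<le> w" "mcoeff f (w - u) \<noteq> 0"
proof -
  have "\<exists>w\<in>{w. c w \<noteq> 0 \<and> u \<le> w}. c w * mcoeff f (w - u) \<noteq> 0"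
  proof (rule ccontr)
    assume "\<not> ?thesis"
    then have "act f c u = 0" unfolding act_def by (intro sum.neutral) blast
    then show False using assms by simp
  qed
  then show ?thesis using that by auto
qed

lemma act_0_right [simp]: "act f 0 = 0"
  by (rule ext) (simp add: act_def)

lemma act_0_left [simp]: "act 0 c = 0"
  by (rule ext) (simp add: act_def)

lemma act_add_left: "act (f + g) c = act f c + act g c"
  by (rule ext) (simp add: act_def distrib_left sum.distrib)

lemma act_uminus_left: "act (- f) c = - act f c"
  by (rule ext) (simp add: act_def sum_negf)

lemma act_add_right:
  assumes "c \<in> invp n D" "d \<in> invp n D"
  shows "act f (c + d) = act f c + act f d"
proof
  fix u
  define W where "W = {w. c w \<noteq> 0} \<union> {w. d w \<noteq> 0}"
  have W: "finite W" "{w. c w \<noteq> 0} \<subseteq> W" "{w. d w \<noteq> 0} \<subseteq> W" "{w. (c + d) w \<noteq> 0} \<subseteq> W"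
    using invpD(1)[OF assms(1)] invpD(1)[OF assms(2)] by (auto simp: W_def)
  show "act f (c + d) u = (act f c + act f d) u"
    using W by (simp add: act_eq_sum[of W] sum.distrib[symmetric] distrib_right if_distrib
        cong: if_cong)
qed

lemma act_mult:
  assumes c: "c \<in> invp n D"
  shows "act (f * g) c = act f (act g c)"
proof
  fix u
  define C where "C = {w. c w \<noteq> 0}"
  \<comment> \<open>All exponents below the support of \<open>c\<close>: one finite index set for
    the intermediate exponents. For fixed \<open>u\<close> and \<open>w\<close>, those between them
    carry out the Cauchy product at w - u.\<close>
  define W where "W = (\<Union>w\<in>C. {v. v \<le> w})"
  have C: "finite C" and fs: "\<And>w. w \<in> C \<Longrightarrow> finite (supp w)"
    using invpD[OF c] exps_finite by (auto simp: C_def)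
  then have finle: "finite {v. v \<le> w}" if "w \<in> C" for w
    using that finite_le_fun by blast
  then have W: "finite W" using C by (simp add: W_def)
  have inW: "{v. act g c v \<noteq> 0} \<subseteq> W"
    by (auto simp: W_def C_def elim!: act_nonzero)
  have actg: "act g c v = (\<Sum>w\<in>C. if v \<le> w then c w * mcoeff g (w - v) else 0)" for v
    by (rule act_eq_sum[OF C]) (simp add: C_def)
  have "act f (act g c) u =
      (\<Sum>v\<in>W. if u \<le> v then (\<Sum>w\<in>C. if v \<le> w then c w * mcoeff g (w - v) else 0) * mcoeff f (v - u) else 0)"
    unfolding act_eq_sum[OF W inW, of f] actg ..
  also have "\<dots> = (\<Sum>v\<in>W. \<Sum>w\<in>C. if u \<le> v \<and> v \<le> w then c w * (mcoeff f (v - u) * mcoeff g (w - v)) else 0)"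
    by (rule sum.cong) (auto simp: sum_distrib_right intro!: sum.cong)
  also have "\<dots> = (\<Sum>w\<in>C. \<Sum>v\<in>W. if u \<le> v \<and> v \<le> w then c w * (mcoeff f (v - u) * mcoeff g (w - v)) else 0)"
    by (rule sum.swap)
  also have "\<dots> = (\<Sum>w\<in>C. if u \<le> w then c w * mcoeff (f * g) (w - u) else 0)"
  proof (rule sum.cong)
    fix w assume w: "w \<in> C"
    have "(\<Sum>v\<in>W. if u \<le> v \<and> v \<le> w then c w * (mcoeff f (v - u) * mcoeff g (w - v)) else 0)
      = (\<Sum>v | u \<le> v \<and> v \<le> w. c w * (mcoeff f (v - u) * mcoeff g (w - v)))"
      using W w by (subst sum.inter_filter[symmetric]) (auto intro!: sum.cong simp: W_def)
    also have "\<dots> = (if u \<le> w then c w * mcoeff (f * g) (w - u) else 0)"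
    proof (cases "u \<le> w")
      case False
      then have "{v. u \<le> v \<and> v \<le> w} = {}" using order_trans by blast
      then show ?thesis using False by (simp only: sum.empty if_False)
    next
      case True
      have "(\<Sum>v | u \<le> v \<and> v \<le> w. c w * (mcoeff f (v - u) * mcoeff g (w - v)))
        = (\<Sum>x | x \<le> w - u. c w * (mcoeff f x * mcoeff g (w - u - x)))"
      proof (rule sum.reindex_bij_witness[of _ "\<lambda>x. x + u" "\<lambda>v. v - u"], goal_cases)
        case (1 v)
        then show ?case by simp
      next
        case (2 v)
        then show ?case by (auto simp: le_fun_def intro: diff_le_mono)
      next
        case (3 x)
        then show ?case by simp
      next
        case (4 x)
        have "x i + u i \<le> w i" for i
        proof -
          have "x i \<le> w i - u i" using 4 by (auto simp: le_fun_def)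
          then show ?thesis using le_funD[OF True, of i] by simp
        qed
        then show ?case by (simp add: le_fun_def)
      next
        case (5 v)
        then have "w - u - (v - u) = w - v" by (auto simp: fun_eq_iff le_fun_def)
        then show ?case by simp
      qed
      then show ?thesis using True by (simp add: mcoeff_mult sum_distrib_left)
    qed
    finally show "(\<Sum>v\<in>W. if u \<le> v \<and> v \<le> w then c w * (mcoeff f (v - u) * mcoeff g (w - v)) else 0) =
      (if u \<le> w then c w * mcoeff (f * g) (w - u) else 0)" .
  qed simp
  also have "\<dots> = act (f * g) c u"
    by (rule act_eq_sum[OF C, symmetric]) (simp add: C_def)
  finally show "act (f * g) c u = act f (act g c) u" by simp
qed

lemma act_mmonom:
  assumes c: "c \<in> invp n D" and v: "finite (supp v)"
  shows "act (mmonom v a) c u = a * c (u + v)"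
proof -
  have "act (mmonom v a) c u
      = (\<Sum>w | c w \<noteq> 0. if u \<le> w then c w * mcoeff (mmonom v a) (w - u) else 0)"
    by (rule act_eq_sum) (use invpD(1)[OF c] in auto)
  also have "\<dots> = (\<Sum>w | c w \<noteq> 0. if w = u + v then a * c (u + v) else 0)"
    by (rule sum.cong) (auto simp: mcoeff_mmonom v)
  also have "\<dots> = a * c (u + v)"
    using invpD(1)[OF c] by (subst sum.delta) auto
  finally show ?thesis .
qed

lemma act_1 [simp]: "c \<in> invp n D \<Longrightarrow> act 1 c = c"
  using act_mmonom[of c n D 0 1] by (simp add: mmonom_0_1 fun_eq_iff)

lemma act_delta: "act f (delta w a) u = (if u \<le> w then a * mcoeff f (w - u) else 0)"
  by (subst act_eq_sum[of "{w}"]) (auto simp: delta_def)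

lemma act_invp:
  assumes D: "\<And>H G. H \<in> D \<Longrightarrow> G \<subseteq> H \<Longrightarrow> G \<in> D" and c: "c \<in> invp n D"
  shows "act f c \<in> invp n D"
proof -
  define W where "W = (\<Union>w\<in>{w. c w \<noteq> 0}. {v. v \<le> w})"
  have "finite W" unfolding W_def
    using invpD[OF c] exps_finite finite_le_fun by (intro finite_UN_I) blast+
  moreover have "{u. act f c u \<noteq> 0} \<subseteq> W" by (auto simp: W_def elim!: act_nonzero)
  moreover have "u \<in> exps n \<and> supp u \<in> D" if "act f c u \<noteq> 0" for u
  proof -
    obtain w where w: "c w \<noteq> 0" "u \<le> w" using \<open>act f c u \<noteq> 0\<close> by (rule act_nonzero)
    then show ?thesis using invpD(2-3)[OF c w(1)] exps_mono D supp_mono by blast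
  qed
  ultimately show ?thesis by (auto simp: invp_def intro: finite_subset)
qed

lemma invp_induct [consumes 1, case_names zero add]:
  assumes c: "c \<in> invp n D"
    and "P 0"
    and "\<And>c w a. c \<in> invp n D \<Longrightarrow> w \<in> exps n \<Longrightarrow> supp w \<in> D \<Longrightarrow> P c \<Longrightarrow> P (c + delta w a)"
  shows "P c"
  using c
proof (induction "card {w. c w \<noteq> 0}" arbitrary: c)
  case 0
  then have "{w. c w \<noteq> 0} = {}" using invpD(1)[OF 0(2)] by (metis card_eq_0_iff)
  then have "c = 0" by (auto simp: fun_eq_iff)
  then show ?case using assms(2) by (simp only:)
next
  case (Suc m)
  then have "{w. c w \<noteq> 0} \<noteq> {}" by (metis card.empty nat.distinct(1))
  then obtain w where w: "c w \<noteq> 0" by blast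
  define c' where "c' = c(w := 0)"
  have eq: "{v. c' v \<noteq> 0} = {v. c v \<noteq> 0} - {w}" by (auto simp: c'_def)
  have "c' \<in> invp n D"
    using Suc.prems eq by (auto simp: invp_def c'_def)
  moreover have "card {v. c' v \<noteq> 0} = m"
    unfolding eq using Suc(2) w invpD(1)[OF Suc.prems] by simp
  moreover have "c = c' + delta w (c w)" by (rule ext) (simp add: c'_def delta_def)
  ultimately show ?case
    using Suc(1)[of c'] assms(3)[of c' w "c w"] invpD(2-3)[OF Suc.prems w] by simp
qed


section \<open>The Frobenius map on inverse polynomials\<close>

text \<open>In the usual notation the inverse monomial of \<open>u\<close> is x^(-(u+1)), with every
  variable occurring. Its q-th power has exponent -(q u + (q - 1) + 1), which explains the shift.
  Coordinates outside 1..n stay 0, so that the result is again in \<open>exps n\<close>.\<close>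

definition emb :: "nat \<Rightarrow> nat \<Rightarrow> (nat \<Rightarrow> nat) \<Rightarrow> nat \<Rightarrow> nat" where
  "emb n q u = (\<lambda>i. if i \<in> {1..n} then q * u i + (q - 1) else 0)"

definition frob :: "nat \<Rightarrow> nat \<Rightarrow> ((nat \<Rightarrow> nat) \<Rightarrow> 'k::field) \<Rightarrow> (nat \<Rightarrow> nat) \<Rightarrow> 'k" where
  "frob n q c w = (if w \<in> emb n q ` exps n then c (\<lambda>i. w i div q) ^ q else 0)"

definition twist :: "nat \<Rightarrow> nat \<Rightarrow> 'k::field mps \<Rightarrow> ((nat \<Rightarrow> nat) \<Rightarrow> 'k) \<Rightarrow> (nat \<Rightarrow> nat) \<Rightarrow> 'k" where
  "twist n q g c = act g (frob n q c)"

lemma emb_exps [simp]: "emb n q u \<in> exps n"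
  by (auto simp: emb_def exps_def supp_def)

lemma emb_div:
  assumes "u \<in> exps n" "q > 0"
  shows "(\<lambda>i. emb n q u i div q) = u"
proof
  fix i
  have "((q - 1) + q * u i) div q = u i + (q - 1) div q"
    using assms(2) by (subst div_mult_self2) auto
  then have "(q * u i + (q - 1)) div q = u i" using assms(2) by (simp add: add.commute)
  then show "emb n q u i div q = u i"
    using exps_eq_0[OF assms(1), of i] by (auto simp: emb_def)
qed

lemma emb_le_iff:
  assumes "u \<in> exps n" "v \<in> exps n" "q > 0"
  shows "emb n q u \<le> emb n q v \<longleftrightarrow> u \<le> v"
proof
  assume le: "emb n q u \<le> emb n q v"
  have "u i \<le> v i" for i
  proof (cases "i \<in> {1..n}")
    case True
    then have "emb n q u i = q * u i + (q - 1)" "emb n q v i = q * v i + (q - 1)"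
      by (simp_all add: emb_def)
    then have "q * u i \<le> q * v i" using le_funD[OF le, of i] by linarith
    then show ?thesis using assms(3) by simp
  next
    case False
    then show ?thesis using exps_eq_0[OF assms(1)] by simp
  qed
  then show "u \<le> v" by (simp add: le_fun_def)
qed (auto simp: emb_def le_fun_def)

lemma frob_emb: "u \<in> exps n \<Longrightarrow> q > 0 \<Longrightarrow> frob n q c (emb n q u) = c u ^ q"
  by (simp add: frob_def emb_div)

lemma frob_nonzero:
  assumes "frob n q c w \<noteq> 0" "q > 0"
  obtains u where "u \<in> exps n" "w = emb n q u" "c u \<noteq> 0"
proof -
  obtain u where u: "u \<in> exps n" "w = emb n q u"
    using assms by (auto simp: frob_def split: if_splits)
  moreover have "c u \<noteq> 0" using assms frob_emb[of u n q c] u by (auto simp: zero_power)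
  ultimately show ?thesis using that by blast
qed

lemma frob_invp:
  assumes "c \<in> invp n D" "q > 0"
  shows "frob n q c \<in> invp n UNIV"
proof -
  have "{w. frob n q c w \<noteq> 0} \<subseteq> emb n q ` {u. c u \<noteq> 0}"
    using assms(2) by (auto elim!: frob_nonzero)
  then have "finite {w. frob n q c w \<noteq> 0}"
    using finite_imageI[OF invpD(1)[OF assms(1)]] by (rule finite_subset)
  then show ?thesis using assms(2) by (auto simp: invp_def elim!: frob_nonzero)
qed

lemma frob_delta:
  assumes "w \<in> exps n" "q > 0"
  shows "frob n q (delta w a) = delta (emb n q w) (a ^ q)"
proof
  fix u
  show "frob n q (delta w a) u = delta (emb n q w) (a ^ q) u"
  proof (cases "u \<in> emb n q ` exps n")
    case True
    then obtain v where v: "v \<in> exps n" "u = emb n q v" by blast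
    have "emb n q v = emb n q w \<longleftrightarrow> v = w" using emb_div[OF v(1) assms(2)] emb_div[OF assms] by metis
    then show ?thesis using v assms by (simp add: frob_emb delta_def zero_power)
  next
    case False
    then show ?thesis using assms by (auto simp: frob_def delta_def)
  qed
qed

lemma frob_frob:
  assumes "p > 0" "q > 0"
  shows "frob n p (frob n q c) = frob n (p * q) c"
proof
  have emb: "emb n p (emb n q u) = emb n (p * q) u" for u
  proof
    fix i
    have "p * (q * u i + (q - 1)) + (p - 1) = p * q * u i + (p * q - 1)"
      using assms by (cases p; cases q) (auto simp: algebra_simps)
    then show "emb n p (emb n q u) i = emb n (p * q) u i" by (simp add: emb_def)
  qed
  fix w
  show "frob n p (frob n q c) w = frob n (p * q) c w"
  proof (cases "w \<in> emb n (p * q) ` exps n")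
    case True
    then obtain u where u: "u \<in> exps n" "w = emb n (p * q) u" by blast
    have "frob n p (frob n q c) (emb n p (emb n q u)) = (c u ^ q) ^ p"
      using u(1) assms by (simp add: frob_emb)
    moreover have "frob n (p * q) c (emb n (p * q) u) = c u ^ (p * q)"
      using u(1) assms by (simp add: frob_emb)
    ultimately show ?thesis by (simp add: u(2) emb power_mult[symmetric] mult.commute)
  next
    case False
    then have "frob n p (frob n q c) w = 0"
      using frob_nonzero[of n p "frob n q c" w] frob_nonzero[of n q c] assms emb by (metis image_eqI)
    then show ?thesis using False by (simp add: frob_def)
  qed
qed

text \<open>The parameter \<open>kt\<close> carries no data: it fixes the coefficient type, so that
  \<open>CHAR('k)\<close> speaks of the same field throughout.\<close>

locale sr_setting =
  fixes n p :: nat and \<Delta> :: "nat set set" and kt :: "'k::field itself"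
  assumes p: "prime p" and char: "CHAR('k) = p" and complex: "simplicial_complex n \<Delta>"
begin

lemma p_gt_1: "p > 1" using p by (rule prime_gt_1_nat)

lemma q_pos: "p ^ e > 0" using p_gt_1 by simp

lemma frob_add: "frob n (p ^ e) (c + d) = frob n (p ^ e) c + frob n (p ^ e) (d :: _ \<Rightarrow> 'k)"
proof
  fix u
  show "frob n (p ^ e) (c + d) u = (frob n (p ^ e) c + frob n (p ^ e) d) u"
    using freshmans_dream'[of "p ^ e" e "c x" "d x" for x] p char
    by (simp add: frob_def)
qed

text \<open>At exponents in the image of \<open>emb\<close> this is the freshman's dream for the
  finite sum behind \<open>act\<close>. Elsewhere both sides vanish: all exponents of f^q are
  multiples of q, and subtracting such an exponent from one in the image, where possible, stays in
  the image.\<close>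

lemma frob_act:
  fixes c :: "(nat \<Rightarrow> nat) \<Rightarrow> 'k"
  assumes c: "c \<in> invp n D"
  shows "frob n (p ^ e) (act f c) = act (f ^ (p ^ e)) (frob n (p ^ e) c)"
proof
  fix u
  let ?q = "p ^ e"
  have q: "?q > 0" by (rule q_pos)
  define C where "C = {w. c w \<noteq> 0}"
  have C: "finite C" "C \<subseteq> exps n" using invpD[OF c] by (auto simp: C_def)
  show "frob n ?q (act f c) u = act (f ^ ?q) (frob n ?q c) u"
  proof (cases "u \<in> emb n ?q ` exps n")
    case True
    then obtain v where v: "v \<in> exps n" "u = emb n ?q v" by blast
    have diff: "emb n ?q w - emb n ?q v = (\<lambda>i. ?q * (w - v) i)" if "w \<in> exps n" for w
      using exps_eq_0[OF that] exps_eq_0[OF v(1)]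
      by (auto simp: emb_def fun_eq_iff diff_mult_distrib2)
    have inj: "inj_on (emb n ?q) C"
      by (rule inj_on_inverseI[where g = "\<lambda>w i. w i div ?q"]) (use emb_div q C in blast)
    have "act (f ^ ?q) (frob n ?q c) u =
      (\<Sum>w\<in>emb n ?q ` C. if u \<le> w then frob n ?q c w * mcoeff (f ^ ?q) (w - u) else 0)"
      by (rule act_eq_sum) (use C q in \<open>auto simp: C_def elim!: frob_nonzero\<close>)
    also have "\<dots> = (\<Sum>w\<in>C. if v \<le> w then (c w * mcoeff f (w - v)) ^ ?q else 0)"
      unfolding sum.reindex[OF inj] comp_def
    proof (rule sum.cong)
      fix w assume "w \<in> C"
      then have w: "w \<in> exps n" using C by blast
      have "mcoeff (f ^ ?q) (emb n ?q w - emb n ?q v) = mcoeff f (w - v) ^ ?q"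
        unfolding diff[OF w] using q by (simp add: mcoeff_frobenius[OF p char refl] fun_diff_def)
      then show "(if u \<le> emb n ?q w then frob n ?q c (emb n ?q w) * mcoeff (f ^ ?q) (emb n ?q w - u) else 0)
        = (if v \<le> w then (c w * mcoeff f (w - v)) ^ ?q else 0)"
        using v w q by (simp add: emb_le_iff frob_emb power_mult_distrib)
    qed simp
    also have "\<dots> = (\<Sum>w\<in>C. (if v \<le> w then c w * mcoeff f (w - v) else 0) ^ ?q)"
      by (rule sum.cong) (use q in \<open>auto simp: zero_power\<close>)
    also have "\<dots> = (\<Sum>w\<in>C. if v \<le> w then c w * mcoeff f (w - v) else 0) ^ ?q"
      by (rule freshmans_dream_sum'[symmetric]) (use p char in auto)
    also have "\<dots> = act f c v ^ ?q"
      by (subst act_eq_sum[of C]) (use C in \<open>auto simp: C_def\<close>)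
    finally show ?thesis using v q by (simp add: frob_emb)
  next
    case False
    have "act (f ^ ?q) (frob n ?q c) u = 0"
    proof (rule ccontr)
      assume "act (f ^ ?q) (frob n ?q c) u \<noteq> 0"
      then obtain w where w: "frob n ?q c w \<noteq> 0" "u \<le> w" "mcoeff (f ^ ?q) (w - u) \<noteq> 0"
        by (rule act_nonzero)
      obtain x where x: "x \<in> exps n" "w = emb n ?q x" using w(1) q by (rule frob_nonzero)
      have dvd: "?q dvd w i - u i" for i
        using w(3) by (auto simp: mcoeff_frobenius[OF p char refl] split: if_splits)
      have "u = emb n ?q (\<lambda>i. x i - (w i - u i) div ?q)"
      proof
        fix i
        obtain k where k: "w i - u i = ?q * k" using dvd[of i] by blast
        have le: "u i \<le> w i" using w(2) by (simp add: le_fun_def)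
        show "u i = emb n ?q (\<lambda>i. x i - (w i - u i) div ?q) i"
        proof (cases "i \<in> {1..n}")
          case True
          then have wi: "w i = ?q * x i + (?q - 1)" by (simp add: x emb_def)
          \<comment> \<open>The strict bound by q (x + 1) forces k \<le> x, so that subtracting k
            from \<open>x i\<close> is not truncated.\<close>
          then have "w i < ?q * x i + ?q" using q by linarith
          then have "?q * k < ?q * Suc (x i)" using k le by simp
          then have "k \<le> x i" using mult_less_cancel1[of ?q k "Suc (x i)"] by linarith
          then have "u i = ?q * (x i - k) + (?q - 1)"
            using wi k le by (simp add: diff_mult_distrib2)
          moreover have "(w i - u i) div ?q = k" unfolding k using q by simp
          ultimately show ?thesis using True by (simp only: emb_def if_True)
        next
          case False
          then show ?thesis using le by (auto simp: x emb_def)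
        qed
      qed
      moreover have "(\<lambda>i. x i - (w i - u i) div ?q) \<in> exps n"
        by (rule exps_mono[OF _ x(1)]) (simp add: le_fun_def)
      ultimately show False using False by blast
    qed
    then show ?thesis using False by (simp add: frob_def)
  qed
qed

lemma twist_invp_UNIV: "c \<in> invp n D \<Longrightarrow> twist n (p ^ e) g c \<in> invp n UNIV"
  unfolding twist_def by (intro act_invp frob_invp q_pos) auto

lemma twist_add:
  fixes c d :: "(nat \<Rightarrow> nat) \<Rightarrow> 'k"
  assumes "c \<in> invp n D" "d \<in> invp n D"
  shows "twist n (p ^ e) g (c + d) = twist n (p ^ e) g c + twist n (p ^ e) g d"
  unfolding twist_def frob_add
  by (rule act_add_right[of _ n UNIV]) (use assms frob_invp q_pos in blast)+

lemma twist_act: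
  fixes c :: "(nat \<Rightarrow> nat) \<Rightarrow> 'k"
  assumes c: "c \<in> invp n D"
  shows "twist n (p ^ e) g (act f c) = act (f ^ (p ^ e)) (twist n (p ^ e) g c)"
  unfolding twist_def frob_act[OF c]
  by (simp add: act_mult[OF frob_invp[OF c q_pos], symmetric] mult.commute)

lemma twist_mult:
  assumes "c \<in> invp n D"
  shows "twist n (p ^ e) (f * g) c = act f (twist n (p ^ e) g c)"
  unfolding twist_def by (rule act_mult[OF frob_invp[OF assms q_pos]])

lemma twist_add_left: "twist n q (f + g) c = twist n q f c + twist n q g c"
  by (simp add: twist_def act_add_left)

lemma twist_delta:
  assumes "w \<in> exps n"
  shows "twist n (p ^ e) g (delta w a) u =
    (if u \<le> emb n (p ^ e) w then a ^ (p ^ e) * mcoeff g (emb n (p ^ e) w - u) else 0)"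
  unfolding twist_def frob_delta[OF assms q_pos] act_delta ..

text \<open>Moving Frobenius past a monomial raises that monomial to the power p^d, whence the
  exponent u + p^d v. Composites of monomial operators can thus be computed on exponents
  alone.\<close>

lemma twist_mmonom_twist:
  fixes c :: "(nat \<Rightarrow> nat) \<Rightarrow> 'k"
  assumes "c \<in> invp n D" "u \<in> exps n" "v \<in> exps n"
  shows "twist n (p ^ d) (mmonom u 1) (twist n (p ^ e) (mmonom v 1) c)
    = twist n (p ^ (d + e)) (mmonom (\<lambda>i. u i + p ^ d * v i) 1) c"
proof -
  note inv = frob_invp[OF assms(1) q_pos]
  have "twist n (p ^ d) (mmonom u 1) (twist n (p ^ e) (mmonom v 1) c)
    = act (mmonom u 1) (act (mmonom v 1 ^ (p ^ d)) (frob n (p ^ d) (frob n (p ^ e) c)))"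
    unfolding twist_def by (simp add: frob_act[OF inv])
  also have "frob n (p ^ d) (frob n (p ^ e) c) = frob n (p ^ (d + e)) c"
    by (simp only: frob_frob[OF q_pos q_pos] power_add)
  also have "act (mmonom u 1) (act (mmonom v 1 ^ (p ^ d)) \<dots>)
    = act (mmonom u 1 * mmonom v 1 ^ (p ^ d)) \<dots>"
    using act_mult[OF frob_invp[OF assms(1) q_pos]] by metis
  also have "mmonom u 1 * mmonom v 1 ^ (p ^ d) = (mmonom (\<lambda>i. u i + p ^ d * v i) 1 :: 'k mps)"
  proof -
    have "finite (supp (\<lambda>i. p ^ d * v i))"
      by (rule finite_subset[OF _ exps_finite[OF assms(3)]]) (auto simp: supp_def)
    then show ?thesis
      using exps_finite[OF assms(2)] exps_finite[OF assms(3)]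
      by (simp add: mmonom_power mmonom_mult plus_fun_def)
  qed
  finally show ?thesis by (simp add: twist_def)
qed

end

section \<open>Frobenius maps on inverse polynomials\<close>

text \<open>The exponents of the colon ideal (I^[q] : I) outside I^[q]. The first condition says
  that x^\<gamma> is not in I^[q]. As to the second, suppose that a facet H above the large
  coordinates misses some i with \<gamma> i < q - 1. Multiplying x^\<gamma> by the generator of the
  nonface H \<union> {i} makes only coordinates in H reach q, so the product is not in
  I^[q].\<close>

definition valid_exps :: "nat \<Rightarrow> nat set set \<Rightarrow> nat \<Rightarrow> (nat \<Rightarrow> nat) set" where
  "valid_exps n \<Delta> q = {\<gamma> \<in> exps n. {i. q \<le> \<gamma> i} \<in> \<Delta> \<and>
     (\<forall>H\<in>facets \<Delta>. {i. q \<le> \<gamma> i} \<subseteq> H \<longrightarrow> {i\<in>{1..n}. \<gamma> i < q - 1} \<subseteq> H)}"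

definition pair_exp :: "nat \<Rightarrow> nat \<Rightarrow> nat set \<times> nat set \<Rightarrow> nat \<Rightarrow> nat" where
  "pair_exp n q P = (\<lambda>i. if i \<in> fst P then q else if i \<in> {1..n} - snd P then q - 1 else 0)"

context sr_setting
begin

section \<open>Faces, facets and admissible power series\<close>

lemma face_mono: "H \<in> \<Delta> \<Longrightarrow> G \<subseteq> H \<Longrightarrow> G \<in> \<Delta>"
  using complex by (auto simp: simplicial_complex_def)

lemma face_subset: "H \<in> \<Delta> \<Longrightarrow> H \<subseteq> {1..n}"
  using complex by (auto simp: simplicial_complex_def)

lemma empty_face: "{} \<in> \<Delta>"
  using complex face_mono by (auto simp: simplicial_complex_def)

lemma finite_complex: "finite \<Delta>"
  by (rule finite_subset[of _ "Pow {1..n}"]) (use face_subset in auto)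

lemma face_in_facet:
  assumes "G \<in> \<Delta>"
  obtains H where "H \<in> facets \<Delta>" "G \<subseteq> H"
proof -
  obtain H where "H \<in> \<Delta>" "G \<subseteq> H" "\<forall>H'\<in>\<Delta>. H \<subseteq> H' \<longrightarrow> H' = H"
    using finite_has_maximal2[OF finite_complex assms] by metis
  then show ?thesis using that by (auto simp: facets_def)
qed

lemma facet_face: "H \<in> facets \<Delta> \<Longrightarrow> H \<in> \<Delta>"
  by (simp add: facets_def)

lemma act_closed: "c \<in> invp n \<Delta> \<Longrightarrow> act f c \<in> invp n \<Delta>"
  using face_mono by (rule act_invp)

text \<open>Let \<open>w\<close> be an exponent of \<open>c\<close> and H a facet above its support.
  Where \<open>w\<close> vanishes, \<gamma> is at most q - 1, so the large coordinates of \<gamma>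
  lie in H, and admissibility puts those below q - 1 into H as well. A coordinate in the support of
  the result is of the latter kind or lies in the support of \<open>w\<close>.\<close>

lemma twist_closed:
  fixes g :: "'k mps"
  assumes g: "\<And>\<gamma>. mcoeff g \<gamma> \<noteq> 0 \<Longrightarrow> \<gamma> \<in> valid_exps n \<Delta> (p ^ e)" and c: "c \<in> invp n \<Delta>"
  shows "twist n (p ^ e) g c \<in> invp n \<Delta>"
proof -
  let ?q = "p ^ e"
  have inv: "twist n ?q g c \<in> invp n UNIV" by (rule twist_invp_UNIV[OF c])
  have "supp u \<in> \<Delta>" if nz: "twist n ?q g c u \<noteq> 0" for u
  proof -
    obtain w' where w': "frob n ?q c w' \<noteq> 0" "u \<le> w'" "mcoeff g (w' - u) \<noteq> 0"
      using nz unfolding twist_def by (rule act_nonzero)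
    obtain w where w: "w \<in> exps n" "w' = emb n ?q w" "c w \<noteq> 0"
      using w'(1) q_pos by (rule frob_nonzero)
    define \<gamma> where "\<gamma> = emb n ?q w - u"
    have \<gamma>: "\<gamma> \<in> valid_exps n \<Delta> ?q" using g w' w by (simp add: \<gamma>_def)
    obtain H where H: "H \<in> facets \<Delta>" "supp w \<subseteq> H"
      using face_in_facet[OF invpD(3)[OF c w(3)]] .
    have small: "\<gamma> i < ?q" if "w i = 0" for i
      using that q_pos[of e] by (auto simp: \<gamma>_def emb_def)
    then have "{i. ?q \<le> \<gamma> i} \<subseteq> supp w" by (force simp: supp_def)
    then have sub: "{i\<in>{1..n}. \<gamma> i < ?q - 1} \<subseteq> H" using \<gamma> H by (auto simp: valid_exps_def)
    have "supp u \<subseteq> H"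
    proof
      fix i assume "i \<in> supp u"
      then have ui: "u i > 0" by (simp add: supp_def)
      have le: "u i \<le> emb n ?q w i" using w'(2) w(2) by (simp add: le_fun_def)
      show "i \<in> H"
      proof (cases "w i = 0")
        case True
        have "i \<in> {1..n}" using ui le by (auto simp: emb_def split: if_splits)
        moreover have "\<gamma> i < ?q - 1" using True ui le \<open>i \<in> {1..n}\<close> by (auto simp: \<gamma>_def emb_def)
        ultimately show ?thesis using sub by blast
      next
        case False
        then show ?thesis using H by (auto simp: supp_def)
      qed
    qed
    then show ?thesis using H facet_face face_mono by blast
  qed
  then show ?thesis using inv by (auto simp: invp_def)
qed

text \<open>A map with the Frobenius property is determined by its values on the monomials, and these
  values fit together to the coefficients of a single power series.\<close>

lemma frobenius_map_eq_twist:
  fixes \<psi> :: "((nat \<Rightarrow> nat) \<Rightarrow> 'k) \<Rightarrow> (nat \<Rightarrow> nat) \<Rightarrow> 'k"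
  assumes closed: "\<And>c. c \<in> invp n \<Delta> \<Longrightarrow> \<psi> c \<in> invp n \<Delta>"
    and add: "\<And>c d. c \<in> invp n \<Delta> \<Longrightarrow> d \<in> invp n \<Delta> \<Longrightarrow> \<psi> (c + d) = \<psi> c + \<psi> d"
    and smult: "\<And>f c. f \<in> series n \<Longrightarrow> c \<in> invp n \<Delta> \<Longrightarrow> \<psi> (act f c) = act (f ^ (p ^ e)) (\<psi> c)"
  obtains g where "g \<in> series n" "\<And>\<gamma>. mcoeff g \<gamma> \<noteq> 0 \<Longrightarrow> \<gamma> \<in> valid_exps n \<Delta> (p ^ e)"
    "\<And>c. c \<in> invp n \<Delta> \<Longrightarrow> \<psi> c = twist n (p ^ e) g c"
proof -
  let ?q = "p ^ e"
  have q: "?q > 0" by (rule q_pos)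
  have zero: "\<psi> 0 = 0" using add[of 0 0] by simp
  \<comment> \<open>\<open>w0\<close> and \<open>s0\<close> split \<gamma> as emb w0 - s0 with s0 <
    q in every coordinate. The coefficient of \<open>g\<close> at \<gamma> is therefore dictated by
    the value at \<open>s0\<close> of the image of the monomial \<open>w0\<close>.\<close>
  define w0 where "w0 \<gamma> = (\<lambda>i. \<gamma> i div ?q)" for \<gamma> :: "nat \<Rightarrow> nat"
  define s0 where "s0 \<gamma> = (\<lambda>i. if i \<in> {1..n} then ?q - 1 - \<gamma> i mod ?q else 0)" for \<gamma> :: "nat \<Rightarrow> nat"
  define g where "g = mps_of_fun (\<lambda>\<gamma>. if \<gamma> \<in> exps n \<and> supp (w0 \<gamma>) \<in> \<Delta> then \<psi> (delta (w0 \<gamma>) 1) (s0 \<gamma>) else 0)"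
  have g: "mcoeff g \<gamma> = (if \<gamma> \<in> exps n \<and> supp (w0 \<gamma>) \<in> \<Delta> then \<psi> (delta (w0 \<gamma>) 1) (s0 \<gamma>) else 0)" for \<gamma>
    by (auto simp: g_def exps_finite)
  have delta_val: "\<psi> (delta w 1) u = twist n ?q g (delta w 1) u"
    if w: "w \<in> exps n" "supp w \<in> \<Delta>" for w u
  proof (cases "u \<in> exps n")
    case False
    then show ?thesis
      using invpD(2)[OF closed[OF invp_delta[OF w]], of 1 u] exps_mono[of u "emb n ?q w" n]
      by (auto simp: twist_delta[OF w(1)])
  next
    case u: True
    \<comment> \<open>With u = s + q v, the value at \<open>u\<close> is the value at
      \<open>s\<close> after multiplication by the q-th power of x^v. By q-linearity x^v moves into
      the argument, where it lowers \<open>w\<close> to w - v; so the values at remainders s < q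
      determine the rest.\<close>
    define v where "v = (\<lambda>i. u i div ?q)"
    define s where "s = (\<lambda>i. u i mod ?q)"
    have v: "v \<in> exps n" by (rule exps_mono[OF _ u]) (auto simp: v_def le_fun_def)
    have us: "u = s + (\<lambda>i. ?q * v i)" by (simp add: fun_eq_iff s_def v_def)
    have fin: "finite (supp (\<lambda>i. ?q * v i))"
      by (rule finite_subset[OF _ exps_finite[OF v]]) (auto simp: supp_def)
    have d: "delta w (1 :: 'k) \<in> invp n \<Delta>" by (rule invp_delta[OF w])
    have "\<psi> (act (mmonom v 1) (delta w 1)) = act (mmonom v 1 ^ ?q) (\<psi> (delta w 1))"
      by (rule smult) (use v d in auto)
    then have "\<psi> (act (mmonom v 1) (delta w 1)) s = \<psi> (delta w 1) u"
      using act_mmonom[OF closed[OF d] fin, of 1 s] us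
      by (simp add: mmonom_power exps_finite[OF v])
    moreover have "act (mmonom v 1) (delta w (1 :: 'k)) = (if v \<le> w then delta (w - v) 1 else 0)"
    proof
      fix x
      have "act (mmonom v 1) (delta w (1 :: 'k)) x = delta w 1 (x + v)"
        using act_mmonom[OF d exps_finite[OF v]] by simp
      moreover have "x + v = w \<longleftrightarrow> v \<le> w \<and> x = w - v" by auto
      ultimately show "act (mmonom v 1) (delta w (1 :: 'k)) x = (if v \<le> w then delta (w - v) 1 else 0) x"
        by (simp add: delta_def)
    qed
    ultimately have val: "\<psi> (delta w 1) u = (if v \<le> w then \<psi> (delta (w - v) 1) s else 0)"
      by (auto simp: zero)
    have dm: "u i = ?q * v i + s i" "s i < ?q" for i
      using q by (simp_all add: v_def s_def)
    have le: "u \<le> emb n ?q w \<longleftrightarrow> v \<le> w"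
    proof
      assume le: "u \<le> emb n ?q w"
      have "v i \<le> w i" for i
      proof (cases "i \<in> {1..n}")
        case True
        have "?q * v i + s i \<le> ?q * w i + (?q - 1)"
          using le_funD[OF le, of i] True dm(1)[of i] by (simp add: emb_def)
        then have "?q * v i < ?q * Suc (w i)" using q unfolding mult_Suc_right by linarith
        then show ?thesis using mult_less_cancel1[of ?q "v i" "Suc (w i)"] by linarith
      next
        case False
        then show ?thesis using exps_eq_0[OF v] by simp
      qed
      then show "v \<le> w" by (simp add: le_fun_def)
    next
      assume le: "v \<le> w"
      have "u i \<le> emb n ?q w i" for i
      proof (cases "i \<in> {1..n}")
        case True
        have "?q * v i \<le> ?q * w i" using le_funD[OF le, of i] by simp
        then have "u i \<le> ?q * w i + (?q - 1)" using dm[of i] by linarith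
        then show ?thesis using True by (simp add: emb_def)
      next
        case False
        then show ?thesis using exps_eq_0[OF u] by simp
      qed
      then show "u \<le> emb n ?q w" by (simp add: le_fun_def)
    qed
    show ?thesis
    proof (cases "v \<le> w")
      case False
      then show ?thesis using val le by (simp add: twist_delta[OF w(1)])
    next
      case True
      define \<gamma> where "\<gamma> = emb n ?q w - u"
      have \<gamma>: "\<gamma> i = ?q * (w i - v i) + (?q - 1 - s i)" if "i \<in> {1..n}" for i
      proof -
        have "?q * v i \<le> ?q * w i" using le_funD[OF True, of i] by simp
        then show ?thesis using dm[of i] that by (simp add: \<gamma>_def emb_def diff_mult_distrib2)
      qed
      have "w0 \<gamma> = w - v"
      proof
        fix i
        show "w0 \<gamma> i = (w - v) i"
        proof (cases "i \<in> {1..n}")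
          case True
          have "(?q - 1 - s i) div ?q = 0" using q by (intro div_less) simp
          moreover have "((?q - 1 - s i) + ?q * (w i - v i)) div ?q = (w i - v i) + (?q - 1 - s i) div ?q"
            using q by (subst div_mult_self2) auto
          ultimately have "\<gamma> i div ?q = w i - v i" unfolding \<gamma>[OF True] by (simp only: add.commute add_0)
          then show ?thesis by (simp add: w0_def)
        next
          case False
          then show ?thesis using exps_eq_0[OF w(1)] by (auto simp: w0_def \<gamma>_def emb_def)
        qed
      qed
      moreover have "s0 \<gamma> = s"
      proof
        fix i
        show "s0 \<gamma> i = s i"
        proof (cases "i \<in> {1..n}")
          case True
          have "\<gamma> i mod ?q = (?q - 1 - s i) mod ?q" unfolding \<gamma>[OF True] by (simp only: mod_mult_self4)
          also have "\<dots> = ?q - 1 - s i" using q by (intro mod_less) simp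
          finally have "?q - 1 - \<gamma> i mod ?q = s i" using dm(2)[of i] by linarith
          then show ?thesis using True by (simp only: s0_def if_True)
        next
          case False
          then show ?thesis using exps_eq_0[OF u] by (auto simp: s0_def s_def)
        qed
      qed
      moreover have "\<gamma> \<in> exps n" unfolding \<gamma>_def by (rule exps_diff) simp
      moreover have "supp (w - v) \<in> \<Delta>" by (rule face_mono[OF w(2)]) (auto simp: supp_def)
      ultimately have "mcoeff g \<gamma> = \<psi> (delta (w - v) 1) s" by (simp add: g)
      then show ?thesis using val True le by (simp add: twist_delta[OF w(1)] \<gamma>_def)
    qed
  qed
  have valid: "\<gamma> \<in> valid_exps n \<Delta> ?q" if nz: "mcoeff g \<gamma> \<noteq> 0" for \<gamma>
  proof -
    have \<gamma>: "\<gamma> \<in> exps n" and "supp (w0 \<gamma>) \<in> \<Delta>" using nz by (auto simp: g split: if_splits)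
    moreover have P: "{i. ?q \<le> \<gamma> i} = supp (w0 \<gamma>)"
      using q by (auto simp: supp_def w0_def div_eq_0_iff)
    moreover have "{i\<in>{1..n}. \<gamma> i < ?q - 1} \<subseteq> H" if H: "H \<in> facets \<Delta>" "supp (w0 \<gamma>) \<subseteq> H" for H
    proof -
      \<comment> \<open>The test monomial: raising \<open>w0\<close> by one on the facet gives
        support exactly H and makes emb w - \<gamma> positive on H.\<close>
      define w where "w = (\<lambda>i. w0 \<gamma> i + (if i \<in> H then 1 else 0))"
      have sw: "supp w = H" using H by (auto simp: w_def supp_def)
      have H\<Delta>: "H \<in> \<Delta>" using H facet_face by blast
      then have w: "w \<in> exps n" "supp w \<in> \<Delta>" using face_subset by (auto simp: exps_def sw)
      have wge: "\<gamma> i < ?q * (w0 \<gamma> i) + ?q" for i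
        using div_mult_mod_eq[of "\<gamma> i" ?q] mod_less_divisor[OF q, of "\<gamma> i"]
        unfolding w0_def mult.commute[of _ ?q] by linarith
      define u where "u = emb n ?q w - \<gamma>"
      have le: "\<gamma> i \<le> emb n ?q w i" for i
      proof (cases "i \<in> {1..n}")
        case True
        have "?q * w0 \<gamma> i \<le> ?q * w i" by (simp add: w_def)
        then have "\<gamma> i \<le> ?q * w i + (?q - 1)" using wge[of i] by linarith
        then show ?thesis using True by (simp add: emb_def)
      next
        case False
        then show ?thesis using exps_eq_0[OF \<gamma>] by simp
      qed
      then have "emb n ?q w - u = \<gamma>" unfolding u_def by (intro minus_minus_fun allI)
      moreover have "u \<le> emb n ?q w" by (simp add: u_def le_fun_def)
      ultimately have "\<psi> (delta w 1) u \<noteq> 0"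
        using nz by (simp add: delta_val[OF w] twist_delta[OF w(1)])
      then have su: "supp u \<in> \<Delta>" using invpD(3)[OF closed[OF invp_delta[OF w]]] by blast
      have "H \<subseteq> supp u"
      proof
        fix i assume i: "i \<in> H"
        then have "i \<in> {1..n}" using face_subset[OF H\<Delta>] by blast
        moreover have "?q * w i = ?q * w0 \<gamma> i + ?q" using i by (simp add: w_def)
        then have "\<gamma> i < ?q * w i + (?q - 1)" using wge[of i] q by linarith
        ultimately show "i \<in> supp u" by (simp add: u_def supp_def emb_def)
      qed
      \<comment> \<open>A face containing a facet equals it. Where \<gamma> i < q - 1, the exponent
        \<open>u\<close> is positive because emb w is at least q - 1, so such i lie in H.\<close>
      then have "supp u = H" using H(1) su by (auto simp: facets_def)
      moreover have "{i\<in>{1..n}. \<gamma> i < ?q - 1} \<subseteq> supp u"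
        by (auto simp: supp_def u_def emb_def)
      ultimately show ?thesis by simp
    qed
    ultimately show ?thesis by (auto simp: valid_exps_def)
  qed
  have eq: "\<psi> c = twist n ?q g c" if "c \<in> invp n \<Delta>" for c
    using that
  proof (induction rule: invp_induct)
    case zero
    have "frob n ?q 0 = (0 :: _ \<Rightarrow> 'k)" using q by (intro ext) (simp add: frob_def zero_power)
    then show ?case by (simp only: \<open>\<psi> 0 = 0\<close> twist_def act_0_right)
  next
    case (add c w a)
    have d: "delta w (1 :: 'k) \<in> invp n \<Delta>" "delta w a \<in> invp n \<Delta>" using add by (auto intro: invp_delta)
    \<comment> \<open>The scalar is carried by a constant series, so that q-linearity supplies its
      q-th power and the values on unit monomials suffice.\<close>
    have "delta w a = act (mmonom 0 a) (delta w 1)"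
      by (rule ext) (simp only: act_mmonom[OF d(1), of 0] supp_0 finite.emptyI,
        auto simp: delta_def)
    moreover have "\<psi> (act (mmonom 0 a) (delta w 1)) = twist n ?q g (act (mmonom 0 a) (delta w 1))"
    proof -
      have "\<psi> (delta w 1) = twist n ?q g (delta w 1)" by (rule ext) (rule delta_val[OF add(2,3)])
      then show ?thesis
        unfolding twist_act[OF d(1)] using smult[OF _ d(1), of "mmonom 0 a"] by simp
    qed
    ultimately have "\<psi> (delta w a) = twist n ?q g (delta w a)" by simp
    then show ?case
      by (simp only: add.IH twist_add[OF add(1) d(2)] assms(2)[OF add(1) d(2)])
  qed
  moreover have "g \<in> series n" by (auto simp: series_def g split: if_splits)
  ultimately show ?thesis using that valid by blast
qed

section \<open>Free pairs and minimal admissible exponents\<close>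

lemma finite_free_pairs: "finite (free_pairs n \<Delta>)"
  by (rule finite_subset[of _ "Pow {1..n} \<times> Pow {1..n}"]) (auto simp: free_pairs_def)

lemma free_pair_below_maximal:
  assumes "P \<in> free_pairs n \<Delta>"
  obtains M where "M \<in> maximal_free_pairs n \<Delta>" "free_pair_le P M"
proof -
  \<comment> \<open>A rank that grows strictly along the order: the number of elements in the second
    set plus the number missing from the first. A pair of largest rank above \<open>P\<close> is
    therefore maximal.\<close>
  define r where "r Q = card (snd Q) + (n - card (fst Q))" for Q :: "nat set \<times> nat set"
  define A where "A = {Q \<in> free_pairs n \<Delta>. free_pair_le P Q}"
  have A: "finite A" "P \<in> A" using assms finite_free_pairs by (auto simp: A_def free_pair_le_def)
  have "Max (r ` A) \<in> r ` A" using A by (intro Max_in) auto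
  then obtain M where M: "M \<in> A" "r M = Max (r ` A)" by auto
  have "Q = M" if Q: "Q \<in> free_pairs n \<Delta>" "free_pair_le M Q" for Q
  proof -
    have "Q \<in> A" using Q M by (auto simp: A_def free_pair_le_def)
    then have le: "r Q \<le> r M" using A M by simp
    have sub: "fst M \<subseteq> {1..n}" "snd Q \<subseteq> {1..n}" using Q M by (auto simp: A_def free_pairs_def)
    then have fin: "finite (fst M)" "finite (snd Q)" by (auto intro: finite_subset)
    have cards: "card (fst M) \<le> n" using card_mono[OF _ sub(1)] by simp
    have s: "fst Q \<subseteq> fst M" "snd M \<subseteq> snd Q" using Q(2) by (auto simp: free_pair_le_def)
    have c: "card (fst Q) \<le> card (fst M)" "card (snd M) \<le> card (snd Q)"
      using s fin by (auto intro: card_mono)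
    then have "card (fst Q) = card (fst M)" "card (snd M) = card (snd Q)"
      using le cards by (auto simp: r_def)
    then have "fst Q = fst M" "snd M = snd Q" using s fin card_subset_eq by metis+
    then show ?thesis by (simp add: prod_eq_iff)
  qed
  then have "M \<in> maximal_free_pairs n \<Delta>" using M by (auto simp: maximal_free_pairs_def A_def)
  then show ?thesis using that M by (auto simp: A_def)
qed

lemma pair_exp_valid:
  assumes "F \<in> \<Delta>" "G \<subseteq> {1..n}" "\<And>H. H \<in> facets \<Delta> \<Longrightarrow> F \<subseteq> H \<Longrightarrow> G \<subseteq> H" "q > 0"
  shows "pair_exp n q (F, G) \<in> valid_exps n \<Delta> q"
proof -
  have "{i. q \<le> pair_exp n q (F, G) i} = F" using assms(4) by (auto simp: pair_exp_def)
  moreover have "{i\<in>{1..n}. pair_exp n q (F, G) i < q - 1} \<subseteq> G"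
    by (auto simp: pair_exp_def split: if_splits)
  moreover have "pair_exp n q (F, G) \<in> exps n"
    using face_subset[OF assms(1)] by (auto simp: exps_def supp_def pair_exp_def split: if_splits)
  ultimately show ?thesis
    unfolding valid_exps_def mem_Collect_eq using assms(1,3) by (metis (lifting) order_trans)
qed

definition core :: "nat set" where
  "core = \<Inter>(facets \<Delta>)"

text \<open>A free pair has a nonempty first set, so ({}, core) is added separately; its exponent is
  q - 1 outside \<open>core\<close> and 0 on it.\<close>

definition generating_pairs :: "(nat set \<times> nat set) set" where
  "generating_pairs = insert ({}, core) (maximal_free_pairs n \<Delta>)"

lemma core_subset: "core \<subseteq> {1..n}"
proof -
  obtain H where "H \<in> facets \<Delta>" using face_in_facet[OF empty_face] .
  then show ?thesis using facet_face face_subset by (auto simp: core_def)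
qed

lemma generating_pair_valid:
  assumes "P \<in> generating_pairs"
  shows "pair_exp n (p ^ e) P \<in> valid_exps n \<Delta> (p ^ e)"
proof (cases "P = ({}, core)")
  case True
  show ?thesis unfolding True
    by (rule pair_exp_valid[OF _ _ _ q_pos]) (use empty_face core_subset in \<open>auto simp: core_def\<close>)
next
  case False
  then have P: "P \<in> free_pairs n \<Delta>"
    using assms by (auto simp: generating_pairs_def maximal_free_pairs_def)
  obtain F G where FG: "P = (F, G)" by (cases P)
  show ?thesis unfolding FG
  proof (rule pair_exp_valid[OF _ _ _ q_pos])
    show "F \<in> \<Delta>" using P face_mono[of "F \<union> G" F] unfolding FG free_pairs_def by blast
    show "G \<subseteq> {1..n}" using P by (simp add: FG free_pairs_def)
    fix H assume "H \<in> facets \<Delta>" "F \<subseteq> H"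
    moreover have "F \<union> G = \<Inter>{H \<in> facets \<Delta>. F \<subseteq> H}" using P by (simp add: FG free_pairs_def)
    ultimately show "G \<subseteq> H" by blast
  qed
qed

text \<open>With F the large coordinates and C the intersection of the facets above F, admissibility
  says that all coordinates below q - 1 lie in C - F. Hence \<gamma> dominates the exponent of (F, C
  - F).\<close>

lemma valid_exp_ge_generator:
  assumes \<gamma>: "\<gamma> \<in> valid_exps n \<Delta> (p ^ e)"
  obtains P where "P \<in> generating_pairs" "pair_exp n (p ^ e) P \<le> \<gamma>"
proof -
  let ?q = "p ^ e"
  define F where "F = {i. ?q \<le> \<gamma> i}"
  define C where "C = \<Inter>{H \<in> facets \<Delta>. F \<subseteq> H}"
  have F: "F \<in> \<Delta>" using \<gamma> by (simp add: F_def valid_exps_def)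
  have FC: "F \<subseteq> C" by (auto simp: C_def)
  obtain H where H: "H \<in> facets \<Delta>" "F \<subseteq> H" using F by (rule face_in_facet)
  then have "C \<subseteq> H" by (auto simp: C_def)
  then have C: "C \<in> \<Delta>" using H facet_face face_mono by blast
  have small: "{i\<in>{1..n}. \<gamma> i < ?q - 1} \<subseteq> C"
    using \<gamma> by (auto simp: valid_exps_def C_def F_def)
  have base: "pair_exp n ?q (F, C - F) \<le> \<gamma>"
    unfolding le_fun_def
  proof
    fix i
    show "pair_exp n ?q (F, C - F) i \<le> \<gamma> i"
      using small not_less[of "\<gamma> i" "?q - 1"] by (auto simp: pair_exp_def F_def)
  qed
  show ?thesis
  \<comment> \<open>If F is empty, then C is \<open>core\<close>; if C = F, then \<gamma> is at
    least q - 1 on all of 1..n. Either way ({}, core) gives an exponent below \<gamma>. Otherwise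
    (F, C - F) is a free pair.\<close>
  proof (cases "F = {} \<or> C - F = {}")
    case True
    have "pair_exp n ?q ({}, core) \<le> \<gamma>"
      unfolding le_fun_def
    proof
      fix i
      have "?q - 1 \<le> \<gamma> i" if "i \<in> {1..n}" "i \<notin> core"
      proof (cases "F = {}")
        case True
        then have "C = core" by (simp add: C_def core_def)
        then show ?thesis using small that not_less by blast
      next
        case False
        then have "{i\<in>{1..n}. \<gamma> i < ?q - 1} \<subseteq> F" using small True by blast
        then have "i \<in> F \<or> \<not> \<gamma> i < ?q - 1" using that by blast
        then show ?thesis unfolding F_def mem_Collect_eq by linarith
      qed
      then show "pair_exp n ?q ({}, core) i \<le> \<gamma> i" by (auto simp: pair_exp_def)
    qed
    then show ?thesis using that[of "({}, core)"] by (simp add: generating_pairs_def)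
  next
    case False
    then have "(F, C - F) \<in> free_pairs n \<Delta>"
      using FC C F face_subset by (auto simp: free_pairs_def C_def Un_absorb1)
    then obtain M where M: "M \<in> maximal_free_pairs n \<Delta>" "free_pair_le (F, C - F) M"
      by (rule free_pair_below_maximal)
    \<comment> \<open>A larger pair has fewer coordinates of value q and more of value 0, so
      exponents decrease along the order.\<close>
    then have "pair_exp n ?q M \<le> pair_exp n ?q (F, C - F)"
      using q_pos[of e] by (auto simp: pair_exp_def le_fun_def free_pair_le_def)
    then have "pair_exp n ?q M \<le> \<gamma>" using base by (rule order_trans)
    then show ?thesis using that[of M] M(1) by (simp add: generating_pairs_def)
  qed
qed

lemma finite_generating_pairs: "finite generating_pairs"
  using finite_free_pairs by (auto simp: generating_pairs_def maximal_free_pairs_def intro: finite_subset)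

text \<open>On exponents this is (p^d - 1) + p^d (p^e - 1) = p^(d+e) - 1. It depends on the first
  set being empty: with values p^d and p^e instead, the sum would exceed p^(d+e).\<close>

lemma twist_core:
  fixes c :: "(nat \<Rightarrow> nat) \<Rightarrow> 'k"
  assumes "c \<in> invp n \<Delta>"
  shows "twist n (p ^ (d + e)) (mmonom (pair_exp n (p ^ (d + e)) ({}, core)) 1) c =
    twist n (p ^ d) (mmonom (pair_exp n (p ^ d) ({}, core)) 1)
      (twist n (p ^ e) (mmonom (pair_exp n (p ^ e) ({}, core)) 1) c)"
proof -
  have "pair_exp n q ({}, core) \<in> exps n" for q
    by (auto simp: pair_exp_def exps_def supp_def split: if_splits)
  moreover have "(\<lambda>i. pair_exp n (p ^ d) ({}, core) i + p ^ d * pair_exp n (p ^ e) ({}, core) i)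
    = pair_exp n (p ^ (d + e)) ({}, core)"
  proof
    fix i
    have "p ^ d - 1 + p ^ d * (p ^ e - 1) = p ^ (d + e) - 1"
    proof -
      have "a - 1 + a * (b - 1) = a * b - 1" if "a > 0" "b > 0" for a b :: nat
        using that by (cases a; cases b) auto
      then show ?thesis using q_pos by (simp only: power_add)
    qed
    then show "pair_exp n (p ^ d) ({}, core) i + p ^ d * pair_exp n (p ^ e) ({}, core) i
      = pair_exp n (p ^ (d + e)) ({}, core) i"
      by (simp add: pair_exp_def)
  qed
  ultimately show ?thesis using twist_mmonom_twist[OF assms] by simp
qed

end

section \<open>The Stanley--Reisner ring\<close>

lemma mpseries_ring_carrier: "carrier (mpseries_ring n :: 'k::field mpseries ring) = mcoeff ` series n"
proof
  show "mcoeff ` series n \<subseteq> carrier (mpseries_ring n :: 'k mpseries ring)"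
    by (auto simp: mpseries_ring_def series_def exps_def supp_def)
  show "carrier (mpseries_ring n :: 'k mpseries ring) \<subseteq> mcoeff ` series n"
  proof
    fix f :: "'k mpseries" assume f: "f \<in> carrier (mpseries_ring n)"
    then have "f u \<noteq> 0 \<Longrightarrow> u \<in> exps n" for u by (auto simp: mpseries_ring_def exps_def supp_def)
    moreover from this have "mcoeff (mps_of_fun f) = f"
      using exps_finite by (auto simp: fun_eq_iff)
    ultimately show "f \<in> mcoeff ` series n"
      by (intro image_eqI[of _ _ "mps_of_fun f"]) (auto simp: series_def)
  qed
qed

lemma mpseries_ring_ops:
  "mcoeff f \<otimes>\<^bsub>mpseries_ring n\<^esub> mcoeff g = mcoeff (f * g)"
  "mcoeff f \<oplus>\<^bsub>mpseries_ring n\<^esub> mcoeff g = mcoeff (f + g)"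
  "\<one>\<^bsub>mpseries_ring n\<^esub> = mcoeff 1"
  "\<zero>\<^bsub>mpseries_ring n\<^esub> = mcoeff 0"
  by (simp_all add: mpseries_ring_def mcoeff_mult fun_eq_iff fun_diff_def mcoeff_one)

lemma cring_mpseries_ring: "cring (mpseries_ring n :: 'k::field mpseries ring)"
proof (rule cringI)
  show "abelian_group (mpseries_ring n :: 'k mpseries ring)"
  proof (rule abelian_groupI)
    fix x assume "x \<in> carrier (mpseries_ring n :: 'k mpseries ring)"
    then obtain f where f: "f \<in> series n" "x = mcoeff f" unfolding mpseries_ring_carrier by blast
    show "\<exists>y\<in>carrier (mpseries_ring n). y \<oplus>\<^bsub>mpseries_ring n\<^esub> x = \<zero>\<^bsub>mpseries_ring n\<^esub>"
      by (rule bexI[of _ "mcoeff (- f)"])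
         (use f in \<open>auto simp: mpseries_ring_carrier mpseries_ring_ops simp del: mcoeff_simps\<close>)
  qed (auto simp: mpseries_ring_carrier mpseries_ring_ops add_ac simp del: mcoeff_simps)
  show "comm_monoid (mpseries_ring n :: 'k mpseries ring)"
    by (rule comm_monoidI)
      (auto simp: mpseries_ring_carrier mpseries_ring_ops mult_ac simp del: mcoeff_simps)
qed (auto simp: mpseries_ring_carrier mpseries_ring_ops distrib_right simp del: mcoeff_simps)

context sr_setting
begin

abbreviation "Rn \<equiv> mpseries_ring n :: 'k mpseries ring"
abbreviation "In \<equiv> stanley_reisner_ideal n \<Delta> :: 'k mpseries set"
abbreviation "A \<equiv> stanley_reisner_ring n \<Delta> :: 'k mpseries set ring"

definition cls :: "'k mps \<Rightarrow> 'k mpseries set" where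
  "cls f = In +>\<^bsub>Rn\<^esub> mcoeff f"

definition sqf :: "nat set \<Rightarrow> nat \<Rightarrow> nat" where
  "sqf N = (\<lambda>i. if i \<in> N then 1 else 0)"

lemma supp_sqf [simp]: "supp (sqf N) = N"
  by (simp add: supp_def sqf_def)

lemma sqf_exps: "N \<subseteq> {1..n} \<Longrightarrow> sqf N \<in> exps n"
  by (simp add: exps_def)

lemma mcoeff_sqf:
  assumes "N \<subseteq> {1..n}"
  shows "squarefree_monomial N = mcoeff (mmonom (sqf N) (1 :: 'k))"
  using exps_finite[OF sqf_exps[OF assms]]
  by (auto simp: squarefree_monomial_def mcoeff_mmonom fun_eq_iff sqf_def)

lemma ideal_In: "ideal In Rn"
proof -
  interpret R: cring Rn by (rule cring_mpseries_ring)
  show ?thesis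
    unfolding stanley_reisner_ideal_def
    by (rule R.genideal_ideal) (auto simp: mpseries_ring_carrier mcoeff_sqf sqf_exps)
qed

text \<open>The series without face-supported terms form an ideal, because an exponent below a
  face-supported one is face-supported, and they include the generators. A residue class thus
  determines its coefficients at faces.\<close>

lemma In_coeff:
  assumes "h \<in> In" "supp u \<in> \<Delta>"
  shows "h u = 0"
proof -
  interpret R: cring Rn by (rule cring_mpseries_ring)
  define J where "J = mcoeff ` {f \<in> series n. \<forall>u. supp u \<in> \<Delta> \<longrightarrow> mcoeff f u = (0 :: 'k)}"
  have mult: "f * g \<in> {f \<in> series n. \<forall>u. supp u \<in> \<Delta> \<longrightarrow> mcoeff f u = 0}"
    if "f \<in> series n" "g \<in> {f \<in> series n. \<forall>u. supp u \<in> \<Delta> \<longrightarrow> mcoeff f u = (0 :: 'k)}" for f g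
  proof -
    have "mcoeff (f * g) u = 0" if u: "supp u \<in> \<Delta>" for u
    proof -
      have "mcoeff g (u - v) = 0" for v
      proof -
        have "supp (u - v) \<in> \<Delta>" by (rule face_mono[OF u]) (auto simp: supp_def)
        then show ?thesis using \<open>g \<in> _\<close> by simp
      qed
      then show ?thesis by (simp add: mcoeff_mult)
    qed
    then show ?thesis using that by simp
  qed
  have "ideal J Rn"
  proof (rule idealI)
    show "ring Rn" by (rule R.ring_axioms)
    show "subgroup J (add_monoid Rn)"
    proof (rule group.subgroupI)
      show "Group.group (add_monoid Rn)" by (rule R.a_group)
      show "J \<subseteq> carrier (add_monoid Rn)" by (auto simp: J_def mpseries_ring_carrier)
      have "mcoeff 0 \<in> J" unfolding J_def by (rule imageI) simp
      then show "J \<noteq> {}" by blast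
    next
      fix a assume "a \<in> J"
      then obtain f where f: "f \<in> {f \<in> series n. \<forall>u. supp u \<in> \<Delta> \<longrightarrow> mcoeff f u = 0}" "a = mcoeff f"
        by (auto simp: J_def)
      then have m: "mcoeff (- f) \<in> J" unfolding J_def by (intro imageI) auto
      have "inv\<^bsub>add_monoid Rn\<^esub> a = mcoeff (- f)"
        using f mpseries_ring_carrier[of n]
        by (intro R.add.inv_equality[unfolded a_inv_def]) (auto simp: mpseries_ring_ops simp del: mcoeff_simps)
      then show "inv\<^bsub>add_monoid Rn\<^esub> a \<in> J" using m by simp
    next
      fix a b assume "a \<in> J" "b \<in> J"
      then show "a \<otimes>\<^bsub>add_monoid Rn\<^esub> b \<in> J"
        unfolding J_def by (auto simp: mpseries_ring_ops simp del: mcoeff_simps intro!: imageI) simp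
    qed
  next
    fix a x assume "a \<in> J" "x \<in> carrier Rn"
    then obtain f g where fg: "f \<in> series n" "x = mcoeff f" "a = mcoeff g"
        "g \<in> {f \<in> series n. \<forall>u. supp u \<in> \<Delta> \<longrightarrow> mcoeff f u = 0}"
      unfolding J_def mpseries_ring_carrier by blast
    then have "mcoeff (f * g) \<in> J" unfolding J_def by (intro imageI mult)
    then show "x \<otimes>\<^bsub>Rn\<^esub> a \<in> J" "a \<otimes>\<^bsub>Rn\<^esub> x \<in> J"
      by (simp_all only: fg mpseries_ring_ops mult.commute[of g])
  qed
  moreover have "squarefree_monomial ` {N. N \<subseteq> {1..n} \<and> N \<notin> \<Delta>} \<subseteq> J"
  proof (clarify)
    fix N assume N: "N \<subseteq> {1..n}" "N \<notin> \<Delta>"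
    then have "mcoeff (mmonom (sqf N) (1 :: 'k)) u = 0" if "supp u \<in> \<Delta>" for u
      using that N by (subst mcoeff_mmonom) (auto simp: intro: finite_subset)
    then show "squarefree_monomial N \<in> J"
      unfolding mcoeff_sqf[OF N(1)] J_def by (intro imageI) (use sqf_exps[OF N(1)] in simp)
  qed
  ultimately have "In \<subseteq> J" unfolding stanley_reisner_ideal_def by (rule R.genideal_minimal)
  then show ?thesis using assms by (auto simp: J_def)
qed

lemma cls_hom: "(\<lambda>h. In +>\<^bsub>Rn\<^esub> h) \<in> ring_hom Rn A"
  unfolding stanley_reisner_ring_def by (rule ideal.rcos_ring_hom[OF ideal_In])

lemma cring_A: "cring A"
  unfolding stanley_reisner_ring_def by (rule ideal.quotient_is_cring[OF ideal_In cring_mpseries_ring])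

lemma carrier_A: "carrier A = cls ` series n"
  unfolding stanley_reisner_ring_def FactRing_simps
  by (auto simp: cls_def mpseries_ring_carrier a_r_coset_def)

lemma cls_carrier [simp]: "f \<in> series n \<Longrightarrow> cls f \<in> carrier A"
  by (simp add: carrier_A)

lemma cls_add: "f \<in> series n \<Longrightarrow> g \<in> series n \<Longrightarrow> cls (f + g) = cls f \<oplus>\<^bsub>A\<^esub> cls g"
  unfolding cls_def using ring_hom_add[OF cls_hom, of "mcoeff f" "mcoeff g"]
  by (auto simp: mpseries_ring_carrier mpseries_ring_ops simp del: mcoeff_simps)

lemma cls_mult: "f \<in> series n \<Longrightarrow> g \<in> series n \<Longrightarrow> cls (f * g) = cls f \<otimes>\<^bsub>A\<^esub> cls g"
  unfolding cls_def using ring_hom_mult[OF cls_hom, of "mcoeff f" "mcoeff g"]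
  by (auto simp: mpseries_ring_carrier mpseries_ring_ops simp del: mcoeff_simps)

lemma cls_1: "cls 1 = \<one>\<^bsub>A\<^esub>"
  unfolding cls_def using ring_hom_one[OF cls_hom] by (simp only: mpseries_ring_ops)

lemma cls_0: "cls 0 = \<zero>\<^bsub>A\<^esub>"
  unfolding cls_def using ring_hom_zero[OF cls_hom cring.axioms(1)[OF cring_mpseries_ring] cring.axioms(1)[OF cring_A]]
  by (simp only: mpseries_ring_ops)

lemma cls_power: "f \<in> series n \<Longrightarrow> cls (f ^ m) = cls f [^]\<^bsub>A\<^esub> m"
proof (induction m)
  case 0
  then show ?case by (simp add: cls_1)
next
  case (Suc m)
  interpret cring A by (rule cring_A)
  show ?case using Suc by (simp add: cls_mult m_comm)
qed

lemma cls_sqf: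
  assumes "N \<subseteq> {1..n}" "N \<notin> \<Delta>"
  shows "cls (mmonom (sqf N) 1) = \<zero>\<^bsub>A\<^esub>"
proof -
  interpret R: cring Rn by (rule cring_mpseries_ring)
  interpret I: ideal In Rn by (rule ideal_In)
  have "squarefree_monomial N \<in> In"
    unfolding stanley_reisner_ideal_def using assms
    by (intro subsetD[OF R.genideal_self]) (auto simp: mpseries_ring_carrier mcoeff_sqf sqf_exps)
  then have "In +>\<^bsub>Rn\<^esub> squarefree_monomial N = In"
    by (rule I.a_rcos_const)
  then show ?thesis
    by (simp add: cls_def mcoeff_sqf[OF assms(1), symmetric] stanley_reisner_ring_def FactRing_def)
qed

lemma cls_memD:
  assumes "f \<in> series n" "h \<in> cls f" "supp u \<in> \<Delta>"
  shows "h u = mcoeff f u"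
proof -
  obtain i where "i \<in> In" "h = i \<oplus>\<^bsub>Rn\<^esub> mcoeff f"
    using assms(2) by (auto simp: cls_def a_r_coset_def r_coset_def)
  then show ?thesis using In_coeff[OF _ assms(3)] by (simp add: mpseries_ring_def)
qed

lemma cls_self: "f \<in> series n \<Longrightarrow> mcoeff f \<in> cls f"
proof -
  interpret I: ideal In Rn by (rule ideal_In)
  show "f \<in> series n \<Longrightarrow> mcoeff f \<in> cls f"
    unfolding cls_def by (rule I.a_rcos_self) (auto simp: mpseries_ring_carrier)
qed

lemma cls_coeff_eq:
  assumes "f \<in> series n" "g \<in> series n" "cls f = cls g" "supp u \<in> \<Delta>"
  shows "mcoeff f u = mcoeff g u"
  using cls_memD[OF assms(2) _ assms(4), of "mcoeff f"] cls_self[OF assms(1)] assms(3) by simp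

text \<open>An inverse polynomial supported on faces meets only coefficients at exponents w - u,
  whose support is again a face. The action therefore passes to \<open>A\<close>.\<close>

lemma act_cls_eq:
  assumes "f \<in> series n" "g \<in> series n" "cls f = cls g" "c \<in> invp n \<Delta>"
  shows "act f c = act g c"
proof
  fix u
  have "mcoeff f (w - u) = mcoeff g (w - u)" if "c w \<noteq> 0" for w
    by (rule cls_coeff_eq[OF assms(1-3)])
       (rule face_mono[OF invpD(3)[OF assms(4) that]], auto simp: supp_def)
  then show "act f c u = act g c u" unfolding act_def by (intro sum.cong) auto
qed

lemma residue_smult:
  assumes "f \<in> series n"
  shows "cls f \<odot>\<^bsub>residue_module\<^esub> x = mcoeff f 0 * x"
proof -
  have eq: "h (\<lambda>_. 0) = mcoeff f 0" if "h \<in> cls f" for h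
    using cls_memD[OF assms that, of 0] empty_face by (simp add: zero_fun_def)
  have "(THE d. \<forall>h\<in>cls f. h (\<lambda>_. 0) = d) = mcoeff f 0"
  proof (rule the_equality)
    fix d assume "\<forall>h\<in>cls f. h (\<lambda>_. 0) = d"
    then show "d = mcoeff f 0" using cls_self[OF assms] eq by metis
  qed (use eq in blast)
  then show ?thesis by (simp add: residue_module_def)
qed

end

section \<open>The injective hull of the residue field\<close>

locale sr_hull = sr_setting n p \<Delta> "TYPE('k::field)" for n p \<Delta> +
  fixes E :: "('k::field mpseries set, 'e) module"
  assumes hull: "injective_hull A residue_module E"
begin

lemma module_E: "module A E"
  using hull by (simp add: injective_hull_def injective_module_def)

interpretation E: module A E by (rule module_E)

definition sc :: "'k mps \<Rightarrow> 'e \<Rightarrow> 'e" where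
  "sc f x = cls f \<odot>\<^bsub>E\<^esub> x"

lemma sc_closed [simp]: "f \<in> series n \<Longrightarrow> x \<in> carrier E \<Longrightarrow> sc f x \<in> carrier E"
  by (simp add: sc_def)

lemma sc_add: "f \<in> series n \<Longrightarrow> g \<in> series n \<Longrightarrow> x \<in> carrier E \<Longrightarrow> sc (f + g) x = sc f x \<oplus>\<^bsub>E\<^esub> sc g x"
  by (simp add: sc_def cls_add E.smult_l_distr)

lemma sc_mult: "f \<in> series n \<Longrightarrow> g \<in> series n \<Longrightarrow> x \<in> carrier E \<Longrightarrow> sc (f * g) x = sc f (sc g x)"
  by (simp add: sc_def cls_mult E.smult_assoc1)

lemma sc_1 [simp]: "x \<in> carrier E \<Longrightarrow> sc 1 x = x"
  by (simp add: sc_def cls_1)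

lemma sc_0 [simp]: "x \<in> carrier E \<Longrightarrow> sc 0 x = \<zero>\<^bsub>E\<^esub>"
  by (simp add: sc_def cls_0)

lemma sc_zero [simp]: "f \<in> series n \<Longrightarrow> sc f \<zero>\<^bsub>E\<^esub> = \<zero>\<^bsub>E\<^esub>"
  by (simp add: sc_def)

lemma sc_minus_right: "f \<in> series n \<Longrightarrow> x \<in> carrier E \<Longrightarrow> y \<in> carrier E \<Longrightarrow>
    sc f (x \<ominus>\<^bsub>E\<^esub> y) = sc f x \<ominus>\<^bsub>E\<^esub> sc f y"
  by (simp add: sc_def E.smult_r_distr E.smult_r_minus a_minus_def)

lemma sc_uminus: "f \<in> series n \<Longrightarrow> x \<in> carrier E \<Longrightarrow> sc (- f) x = \<ominus>\<^bsub>E\<^esub> sc f x"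
  using sc_add[of "- f" f x] E.minus_equality[of "sc (- f) x" "sc f x"] by simp

lemma sc_sqf:
  assumes "N \<subseteq> {1..n}" "N \<notin> \<Delta>" "x \<in> carrier E"
  shows "sc (mmonom (sqf N) 1) x = \<zero>\<^bsub>E\<^esub>"
  using assms by (simp add: sc_def cls_sqf)

text \<open>An embedding of the residue field with essential image, stated on elements: every
  nonzero element of \<open>E\<close> has a nonzero multiple in the image.\<close>

definition socle_map :: "('k \<Rightarrow> 'e) \<Rightarrow> bool" where
  "socle_map \<iota> \<longleftrightarrow> (\<forall>a. \<iota> a \<in> carrier E) \<and> (\<forall>a b. \<iota> (a + b) = \<iota> a \<oplus>\<^bsub>E\<^esub> \<iota> b) \<and>
     (\<forall>f\<in>series n. \<forall>a. \<iota> (mcoeff f 0 * a) = sc f (\<iota> a)) \<and> inj \<iota> \<and>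
     (\<forall>x\<in>carrier E. x \<noteq> \<zero>\<^bsub>E\<^esub> \<longrightarrow> (\<exists>f\<in>series n. \<exists>a. sc f x = \<iota> a \<and> sc f x \<noteq> \<zero>\<^bsub>E\<^esub>))"

lemma socle_mapD:
  assumes "socle_map \<iota>"
  shows
    "\<And>a. \<iota> a \<in> carrier E" "\<And>a b. \<iota> (a + b) = \<iota> a \<oplus>\<^bsub>E\<^esub> \<iota> b"
    "\<And>f a. f \<in> series n \<Longrightarrow> \<iota> (mcoeff f 0 * a) = sc f (\<iota> a)" "inj \<iota>"
    "\<And>x. x \<in> carrier E \<Longrightarrow> x \<noteq> \<zero>\<^bsub>E\<^esub> \<Longrightarrow> \<exists>f\<in>series n. \<exists>a. sc f x = \<iota> a \<and> sc f x \<noteq> \<zero>\<^bsub>E\<^esub>"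
  using assms by (auto simp: socle_map_def)

lemma essential_socle: "\<exists>\<iota>. socle_map \<iota>"
proof -
  obtain \<iota> where \<iota>: "\<iota> \<in> module_hom A residue_module E" "inj_on \<iota> (carrier residue_module)"
    and ess: "\<And>N. submodule N A E \<Longrightarrow> N \<noteq> {\<zero>\<^bsub>E\<^esub>} \<Longrightarrow> N \<inter> \<iota> ` carrier residue_module \<noteq> {\<zero>\<^bsub>E\<^esub>}"
    using hull unfolding injective_hull_def by blast
  have rm: "carrier residue_module = (UNIV :: 'k set)" "x \<oplus>\<^bsub>residue_module\<^esub> y = x + y" for x y :: 'k
    by (simp_all add: residue_module_def)
  have closed: "\<iota> a \<in> carrier E" for a using \<iota>(1) by (auto simp: module_hom_def rm)
  have add: "\<iota> (a + b) = \<iota> a \<oplus>\<^bsub>E\<^esub> \<iota> b" for a b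
    using \<iota>(1) by (auto simp: module_hom_def rm)
  have sm: "\<iota> (mcoeff f 0 * a) = sc f (\<iota> a)" if f: "f \<in> series n" for f a
  proof -
    have "\<iota> (cls f \<odot>\<^bsub>residue_module\<^esub> a) = cls f \<odot>\<^bsub>E\<^esub> \<iota> a"
      using \<iota>(1) cls_carrier[OF f] by (auto simp: module_hom_def rm)
    then show ?thesis by (simp add: residue_smult[OF f] sc_def)
  qed
  have "\<iota> 0 = \<zero>\<^bsub>E\<^esub>" using sm[of 0 0] closed by simp
  have "\<exists>f\<in>series n. \<exists>a. sc f x = \<iota> a \<and> sc f x \<noteq> \<zero>\<^bsub>E\<^esub>" if x: "x \<in> carrier E" "x \<noteq> \<zero>\<^bsub>E\<^esub>" for x
  proof -
    \<comment> \<open>Essentiality is applied to the cyclic submodule generated by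
      \<open>x\<close>.\<close>
    define N where "N = (\<lambda>f. sc f x) ` series n"
    have "submodule N A E"
    proof (rule E.submoduleI)
      show "N \<subseteq> carrier E" using x by (auto simp: N_def)
      show "\<zero>\<^bsub>E\<^esub> \<in> N" unfolding N_def by (rule image_eqI[of _ _ 0]) (use x in auto)
    next
      fix a assume "a \<in> N"
      then obtain f where "f \<in> series n" "a = sc f x" by (auto simp: N_def)
      then show "\<ominus>\<^bsub>E\<^esub> a \<in> N" unfolding N_def using x by (intro image_eqI[of _ _ "- f"]) (auto simp: sc_uminus)
    next
      fix a b assume "a \<in> N" "b \<in> N"
      then obtain f g where "f \<in> series n" "a = sc f x" "g \<in> series n" "b = sc g x" by (auto simp: N_def)
      then show "a \<oplus>\<^bsub>E\<^esub> b \<in> N" unfolding N_def using x by (intro image_eqI[of _ _ "f + g"]) (auto simp: sc_add)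
    next
      fix a y assume "a \<in> carrier A" "y \<in> N"
      then obtain f g where "f \<in> series n" "y = sc f x" "g \<in> series n" "a = cls g"
        by (auto simp: N_def carrier_A)
      then show "a \<odot>\<^bsub>E\<^esub> y \<in> N" unfolding N_def
        using x sc_mult[of g f x] by (intro image_eqI[of _ _ "g * f"]) (auto simp: sc_def)
    qed
    moreover have "x \<in> N" unfolding N_def by (rule image_eqI[of _ _ 1]) (use x in auto)
    ultimately have "N \<inter> range \<iota> \<noteq> {\<zero>\<^bsub>E\<^esub>}" using ess[of N] x by (auto simp: rm)
    \<comment> \<open>Being different from {0} does not exclude the empty set; with 0 in the
      intersection, a nonzero element follows.\<close>
    moreover have "\<zero>\<^bsub>E\<^esub> \<in> N \<inter> range \<iota>"
      using \<open>\<iota> 0 = \<zero>\<^bsub>E\<^esub>\<close> \<open>submodule N A E\<close> E.submoduleE(2,4)[of N] x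
      by (auto simp: N_def intro!: image_eqI[of _ _ 0] rangeI[of \<iota> 0, simplified] sc_0[symmetric])
    ultimately obtain y where "y \<in> N" "y \<in> range \<iota>" "y \<noteq> \<zero>\<^bsub>E\<^esub>" by blast
    then show ?thesis unfolding N_def by blast
  qed
  then have "socle_map \<iota>" using closed add sm \<iota>(2) by (auto simp: rm socle_map_def)
  then show ?thesis by blast
qed

text \<open>The module of inverse polynomials, with elements wrapped into singletons so that their type
  is that of the elements of the Stanley--Reisner ring.\<close>

definition rep :: "'k mpseries set \<Rightarrow> 'k mps" where
  "rep a = (SOME f. f \<in> series n \<and> cls f = a)"

definition inverse_module :: "('k mpseries set, 'k mpseries set) module" where
  "inverse_module = \<lparr>carrier = (\<lambda>c. {c}) ` invp n \<Delta>, mult = undefined, one = undefined,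
     zero = {0}, add = (\<lambda>X Y. {the_elem X + the_elem Y}),
     smult = (\<lambda>a X. {act (rep a) (the_elem X)})\<rparr>"

lemma act_rep: "f \<in> series n \<Longrightarrow> c \<in> invp n \<Delta> \<Longrightarrow> act (rep (cls f)) c = act f c"
proof -
  assume f: "f \<in> series n" and c: "c \<in> invp n \<Delta>"
  have "rep (cls f) \<in> series n \<and> cls (rep (cls f)) = cls f"
    unfolding rep_def by (rule someI[of _ f]) (use f in simp)
  then show ?thesis using act_cls_eq f c by blast
qed

lemma inverse_module_simps:
  "carrier inverse_module = (\<lambda>c. {c}) ` invp n \<Delta>"
  "\<zero>\<^bsub>inverse_module\<^esub> = {0}"
  "{c} \<oplus>\<^bsub>inverse_module\<^esub> {d} = {c + d}"
  "f \<in> series n \<Longrightarrow> c \<in> invp n \<Delta> \<Longrightarrow> cls f \<odot>\<^bsub>inverse_module\<^esub> {c} = {act f c}"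
  by (simp_all add: inverse_module_def act_rep)

lemma module_inverse_module: "module A inverse_module"
proof (rule moduleI)
  show "cring A" by (rule cring_A)
  show "abelian_group inverse_module"
  proof (rule abelian_groupI)
    fix X assume "X \<in> carrier inverse_module"
    then obtain c where c: "c \<in> invp n \<Delta>" "X = {c}" by (auto simp: inverse_module_simps)
    show "\<exists>Y\<in>carrier inverse_module. Y \<oplus>\<^bsub>inverse_module\<^esub> X = \<zero>\<^bsub>inverse_module\<^esub>"
      by (rule bexI[of _ "{- c}"]) (use c in \<open>auto simp: inverse_module_simps\<close>)
  qed (auto simp: inverse_module_simps add_ac)
qed (auto simp: inverse_module_simps carrier_A act_closed act_add_left act_mult act_add_right
  simp flip: cls_add cls_mult cls_1)

text \<open>Homomorphisms into \<open>E\<close>, stated on coefficient functions and with series as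
  scalars, so that neither singletons nor residue classes enter the calculations.\<close>

definition linear_map :: "(((nat \<Rightarrow> nat) \<Rightarrow> 'k) \<Rightarrow> 'e) \<Rightarrow> bool" where
  "linear_map \<tau> \<longleftrightarrow> (\<forall>c\<in>invp n \<Delta>. \<tau> c \<in> carrier E) \<and>
     (\<forall>c\<in>invp n \<Delta>. \<forall>d\<in>invp n \<Delta>. \<tau> (c + d) = \<tau> c \<oplus>\<^bsub>E\<^esub> \<tau> d) \<and>
     (\<forall>f\<in>series n. \<forall>c\<in>invp n \<Delta>. \<tau> (act f c) = sc f (\<tau> c))"

lemma linear_mapD:
  assumes "linear_map \<tau>"
  shows
    "\<And>c. c \<in> invp n \<Delta> \<Longrightarrow> \<tau> c \<in> carrier E"
    "\<And>c d. c \<in> invp n \<Delta> \<Longrightarrow> d \<in> invp n \<Delta> \<Longrightarrow> \<tau> (c + d) = \<tau> c \<oplus>\<^bsub>E\<^esub> \<tau> d"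
    "\<And>f c. f \<in> series n \<Longrightarrow> c \<in> invp n \<Delta> \<Longrightarrow> \<tau> (act f c) = sc f (\<tau> c)"
  using assms by (auto simp: linear_map_def)

text \<open>The constants \<open>delta 0 a\<close> form a copy of the residue field, since a series
  acts on them through its constant coefficient. The embedding of the residue field, read on this
  submodule, is extended to all inverse polynomials by injectivity of \<open>E\<close>.\<close>

lemma essential_embedding: "\<exists>\<iota> \<tau>. socle_map \<iota> \<and> linear_map \<tau> \<and> (\<forall>a. \<tau> (delta 0 a) = \<iota> a)"
proof -
  obtain \<iota> where "socle_map \<iota>" using essential_socle by blast
  note \<iota> = socle_mapD[OF this]
  interpret M: module A inverse_module by (rule module_inverse_module)
  define N where "N = range (\<lambda>a :: 'k. {delta 0 a})"
  define h where "h X = \<iota> (the_elem X 0)" for X :: "'k mpseries set"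
  have d: "delta 0 a \<in> invp n \<Delta>" for a :: 'k by (rule invp_delta) (use empty_face in auto)
  have act0: "act f (delta 0 a) = delta 0 (mcoeff f 0 * a)" for f :: "'k mps" and a
  proof
    fix u :: "nat \<Rightarrow> nat"
    have "u \<le> 0 \<longleftrightarrow> u = 0" by (auto simp: le_fun_def fun_eq_iff)
    then show "act f (delta 0 a) u = delta 0 (mcoeff f 0 * a) u"
      by (auto simp: act_delta) (auto simp: delta_def zero_fun_def fun_diff_def)
  qed
  have add0: "delta 0 a + delta 0 b = delta 0 (a + b)" for a b :: 'k
    by (auto simp: delta_def fun_eq_iff)
  have sub: "submodule N A inverse_module"
  proof (rule M.submoduleI)
    show "N \<subseteq> carrier inverse_module" using d by (auto simp: N_def inverse_module_simps)
    have "(0 :: _ \<Rightarrow> 'k) = delta 0 0" by (auto simp: delta_def fun_eq_iff)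
    then show "\<zero>\<^bsub>inverse_module\<^esub> \<in> N" unfolding inverse_module_simps N_def by (metis rangeI)
    show "a \<oplus>\<^bsub>inverse_module\<^esub> b \<in> N" if "a \<in> N" "b \<in> N" for a b
      using that by (auto simp: N_def inverse_module_simps add0)
    show smult: "a \<odot>\<^bsub>inverse_module\<^esub> x \<in> N" if "a \<in> carrier A" "x \<in> N" for a x
      using that d by (auto simp: N_def inverse_module_simps carrier_A act0)
    show "\<ominus>\<^bsub>inverse_module\<^esub> a \<in> N" if a: "a \<in> N" for a
    proof -
      have ac: "a \<in> carrier inverse_module" using a d by (auto simp: N_def inverse_module_simps)
      have "(\<ominus>\<^bsub>A\<^esub> \<one>\<^bsub>A\<^esub>) \<odot>\<^bsub>inverse_module\<^esub> a = \<ominus>\<^bsub>inverse_module\<^esub> a"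
        using M.smult_l_minus[OF _ ac] ac by simp
      then show ?thesis using smult[OF _ a, of "\<ominus>\<^bsub>A\<^esub> \<one>\<^bsub>A\<^esub>"] by simp
    qed
  qed
  have h: "h \<in> module_hom A (inverse_module\<lparr>carrier := N\<rparr>) E"
    unfolding module_hom_def
  proof (intro CollectI conjI ballI funcsetI)
    show "h x \<in> carrier E" for x by (simp add: h_def \<iota>)
    fix x y assume "x \<in> carrier (inverse_module\<lparr>carrier := N\<rparr>)" "y \<in> carrier (inverse_module\<lparr>carrier := N\<rparr>)"
    then show "h (x \<oplus>\<^bsub>inverse_module\<lparr>carrier := N\<rparr>\<^esub> y) = h x \<oplus>\<^bsub>E\<^esub> h y"
      by (auto simp: N_def inverse_module_simps h_def \<iota>)
  next
    fix a x assume "a \<in> carrier A" "x \<in> carrier (inverse_module\<lparr>carrier := N\<rparr>)"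
    then obtain f b where fb: "f \<in> series n" "a = cls f" "x = {delta 0 b}"
      by (auto simp: N_def carrier_A)
    then have "a \<odot>\<^bsub>inverse_module\<^esub> x = {delta 0 (mcoeff f 0 * b)}"
      by (simp add: inverse_module_simps d act0)
    then show "h (a \<odot>\<^bsub>inverse_module\<lparr>carrier := N\<rparr>\<^esub> x) = a \<odot>\<^bsub>E\<^esub> h x"
      using \<iota>(3)[of f b] fb by (simp add: h_def delta_def sc_def)
  qed
  have "injective_module A E" using hull by (simp add: injective_hull_def)
  then have "\<exists>g\<in>module_hom A inverse_module E. \<forall>x\<in>N. g x = h x"
    unfolding injective_module_def using module_inverse_module sub h by simp
  then obtain g where g: "g \<in> module_hom A inverse_module E" "\<And>x. x \<in> N \<Longrightarrow> g x = h x"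
    by blast
  have "linear_map (\<lambda>c. g {c})"
    unfolding linear_map_def
  proof (intro conjI ballI)
    show "g {c} \<in> carrier E" if "c \<in> invp n \<Delta>" for c
      using g(1) that by (auto simp: module_hom_def inverse_module_simps)
    show "g {c + d} = g {c} \<oplus>\<^bsub>E\<^esub> g {d}" if "c \<in> invp n \<Delta>" "d \<in> invp n \<Delta>" for c d
    proof -
      have "g ({c} \<oplus>\<^bsub>inverse_module\<^esub> {d}) = g {c} \<oplus>\<^bsub>E\<^esub> g {d}"
        using g(1) that unfolding module_hom_def inverse_module_simps(1) by blast
      then show ?thesis by (simp add: inverse_module_simps)
    qed
    show "g {act f c} = sc f (g {c})" if "f \<in> series n" "c \<in> invp n \<Delta>" for f c
    proof -
      have "g (cls f \<odot>\<^bsub>inverse_module\<^esub> {c}) = cls f \<odot>\<^bsub>E\<^esub> g {c}"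
        using g(1) that cls_carrier[OF that(1)] unfolding module_hom_def inverse_module_simps(1) by blast
      then show ?thesis using that by (simp add: inverse_module_simps sc_def)
    qed
  qed
  moreover have "g {delta 0 a} = \<iota> a" for a
    using g(2)[of "{delta 0 a}"] by (simp add: N_def h_def delta_def)
  ultimately show ?thesis using \<open>socle_map \<iota>\<close> by blast
qed

section \<open>Torsion in the hull and the isomorphism with inverse polynomials\<close>

lemma mmonom_expand:
  assumes "f \<in> series n"
  shows "f = mmonom 0 (mcoeff f 0) + mrestrict (\<lambda>u. u \<noteq> 0) f"
  by (rule mps_eqI) (auto simp: mcoeff_mmonom)

text \<open>A series without constant term lies in the ideal of the variables. On an element killed
  by all variables, a series therefore acts through its constant coefficient.\<close>

lemma sc_restrict_maximal_ideal:
  assumes f: "f \<in> series n" and y: "y \<in> carrier E"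
    and kill: "\<And>i. i \<in> {1..n} \<Longrightarrow> sc (mmonom (sqf {i}) 1) y = \<zero>\<^bsub>E\<^esub>"
  shows "sc (mrestrict (\<lambda>u. u \<noteq> 0) f) y = \<zero>\<^bsub>E\<^esub>"
proof (rule monomial_ideal_induct[where T = "(\<lambda>i. sqf {i}) ` {1..n}" and n = n])
  show "(\<lambda>i. sqf {i}) ` {1..n} \<subseteq> exps n" by (auto intro: sqf_exps)
  fix u assume "mcoeff (mrestrict (\<lambda>u. u \<noteq> 0) f) u \<noteq> 0"
  then have u: "u \<noteq> 0" "u \<in> exps n" using series_coeff_0[OF f] by (auto split: if_splits)
  then obtain i where "u i \<noteq> 0" by (auto simp: fun_eq_iff)
  then have "i \<in> {1..n}" "sqf {i} \<le> u"
    using u by (auto simp: exps_def supp_def sqf_def le_fun_def)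
  then show "\<exists>t\<in>(\<lambda>i. sqf {i}) ` {1..n}. t \<le> u" by blast
qed (use f y kill in \<open>auto simp: sc_add sc_mult\<close>)

text \<open>The annihilators of \<open>x\<^sub>i\<^sup>j x\<close> form an ascending chain; if it stops at
  \<open>j = N\<close>, then \<open>x\<^sub>i\<^sup>N x\<close> has no nonzero multiple in the socle.\<close>

lemma power_torsion:
  assumes x: "x \<in> carrier E" and i: "i \<in> {1..n}"
  shows "\<exists>N. sc (mmonom (\<lambda>j. if j = i then N else 0) 1) x = \<zero>\<^bsub>E\<^esub>"
proof -
  obtain \<iota> where "socle_map \<iota>" using essential_socle by blast
  note \<iota> = socle_mapD[OF this]
  define y :: "'k mps" where "y = mmonom (sqf {i}) 1"
  have y: "y \<in> series n" unfolding y_def using i by (intro series_mmonom sqf_exps) auto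
  have y0: "mcoeff y 0 = 0"
    unfolding y_def by (subst mcoeff_mmonom, simp, simp add: sqf_def fun_eq_iff)
  define J where "J j = {f \<in> series n. sc (f * y ^ j) x = \<zero>\<^bsub>E\<^esub>}" for j
  have "\<exists>N. \<forall>j. J j \<subseteq> J N"
  proof (rule series_ideal_chain[where n = n])
    fix j
    show "J j \<subseteq> J (Suc j)"
    proof
      fix f assume f: "f \<in> J j"
      have "f * y ^ Suc j = y * (f * y ^ j)" by (simp add: mult_ac)
      then show "f \<in> J (Suc j)" using f y x unfolding J_def by (simp add: sc_mult[of y] del: power_Suc)
    qed
  next
    fix j and h f :: "'k mps" assume h: "h \<in> series n" and f: "f \<in> J j"
    have "sc (h * f * y ^ j) x = sc h (sc (f * y ^ j) x)"
      using h f y x by (simp add: J_def mult.assoc sc_mult[of h])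
    then show "h * f \<in> J j" using h f by (simp add: J_def)
  qed (use x y in \<open>auto simp: J_def distrib_right sc_add\<close>)
  then obtain N where N: "J (Suc N) \<subseteq> J N" by blast
  have "sc (y ^ N) x = \<zero>\<^bsub>E\<^esub>"
  proof (rule ccontr)
    assume "sc (y ^ N) x \<noteq> \<zero>\<^bsub>E\<^esub>"
    then obtain f a where f: "f \<in> series n" "sc f (sc (y ^ N) x) = \<iota> a" "sc f (sc (y ^ N) x) \<noteq> \<zero>\<^bsub>E\<^esub>"
      using \<iota>(5)[of "sc (y ^ N) x"] x y by auto
    have "f * y ^ Suc N = y * (f * y ^ N)" by (simp add: mult_ac)
    then have "sc (f * y ^ Suc N) x = sc y (sc (f * y ^ N) x)"
      using f y x by (simp add: sc_mult[of y] del: power_Suc)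
    also have "\<dots> = sc y (\<iota> a)" using f y x by (simp add: sc_mult)
    \<comment> \<open>The variable has constant coefficient 0 and so kills the socle; this puts
      \<open>f\<close> into the next annihilator, although it is not in \<open>J N\<close>.\<close>
    also have "\<dots> = \<zero>\<^bsub>E\<^esub>" using \<iota>(3)[OF y, of a] \<iota>(3)[of 0 a] y0 \<iota>(1) by simp
    finally have "f \<in> J (Suc N)" using f by (simp add: J_def)
    then have "f \<in> J N" using N by blast
    then show False using f y x by (simp add: J_def sc_mult)
  qed
  moreover have "y ^ N = mmonom (\<lambda>j. if j = i then N else 0) 1"
    unfolding y_def by (subst mmonom_power, simp)
      (auto simp: sqf_def intro!: arg_cong2[of _ _ _ _ mmonom])
  ultimately show ?thesis by auto
qed

text \<open>Some power of each variable kills \<open>x\<close>; one bound for all variables leaves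
  only finitely many monomials that can act nontrivially.\<close>

lemma monomial_torsion:
  assumes x: "x \<in> carrier E"
  shows "\<exists>N. \<forall>u\<in>exps n. (\<exists>i\<in>{1..n}. N \<le> u i) \<longrightarrow> sc (mmonom u 1) x = \<zero>\<^bsub>E\<^esub>"
proof -
  obtain M where M: "\<And>i. i \<in> {1..n} \<Longrightarrow> sc (mmonom (\<lambda>j. if j = i then M i else 0) 1) x = \<zero>\<^bsub>E\<^esub>"
    using power_torsion[OF x] by metis
  define N where "N = sum M {1..n}"
  have "sc (mmonom u 1) x = \<zero>\<^bsub>E\<^esub>" if u: "u \<in> exps n" "i \<in> {1..n}" "N \<le> u i" for u i
  proof -
    define t where "t = (\<lambda>j. if j = i then M i else 0)"
    have "M i \<le> N" unfolding N_def using u(2) by (intro member_le_sum) auto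
    then have t: "t \<le> u" using u(3) by (auto simp: t_def le_fun_def)
    then have te: "t \<in> exps n" using u(1) exps_mono by blast
    have "mmonom u 1 = mmonom (u - t) 1 * (mmonom t 1 :: 'k mps)"
      using t mmonom_mult[OF exps_finite[OF exps_diff[OF u(1)]] exps_finite[OF te], of t 1 "1 :: 'k"] by simp
    then show ?thesis using M[OF u(2)] x te exps_diff[OF u(1)]
      by (simp add: sc_mult t_def[symmetric])
  qed
  then show ?thesis by blast
qed

text \<open>For surjectivity, an element outside the image is moved by a monomial to one just
  outside, all of whose multiples by variables lie in the image. The preimages of these multiples
  are the shifts of a single inverse polynomial; subtracting its image leaves an element killed by
  all variables, hence in the socle, which the constants cover.\<close>

lemma hull_isomorphism: "\<exists>\<tau>. linear_map \<tau> \<and> bij_betw \<tau> (invp n \<Delta>) (carrier E)"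
proof -
  obtain \<iota> \<tau> where sl: "socle_map \<iota>" "linear_map \<tau>" and \<tau>\<iota>: "\<And>a. \<tau> (delta 0 a) = \<iota> a"
    using essential_embedding by blast
  note \<iota> = socle_mapD[OF sl(1)] and \<tau> = linear_mapD[OF sl(2)]
  have \<iota>0: "\<iota> 0 = \<zero>\<^bsub>E\<^esub>" using \<iota>(3)[of 0 0] \<iota>(1) by simp
  have diff: "\<tau> (c - d) = \<tau> c \<ominus>\<^bsub>E\<^esub> \<tau> d" if cd: "c \<in> invp n \<Delta>" "d \<in> invp n \<Delta>" for c d
  proof -
    have "\<tau> (- d) = sc (- 1) (\<tau> d)"
      using \<tau>(3)[of "- 1" d] cd by (simp add: act_uminus_left)
    also have "\<dots> = \<ominus>\<^bsub>E\<^esub> \<tau> d" using cd \<tau>(1) by (simp add: sc_uminus)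
    finally show ?thesis using \<tau>(2)[OF cd(1), of "- d"] cd by (simp add: a_minus_def)
  qed
  have zero: "c = 0" if c: "c \<in> invp n \<Delta>" "\<tau> c = \<zero>\<^bsub>E\<^esub>" for c
  proof (rule ccontr)
    assume "c \<noteq> 0"
    then have "{w. c w \<noteq> 0} \<noteq> {}" by (auto simp: fun_eq_iff)
    moreover have "finite {w. c w \<noteq> 0}" by (rule invpD(1)[OF c(1)])
    \<comment> \<open>Multiplication by the monomial of a maximal exponent of \<open>c\<close>
      leaves only a constant, whose image is a nonzero socle element.\<close>
    ultimately obtain w where w: "c w \<noteq> 0" "\<And>v. c v \<noteq> 0 \<Longrightarrow> w \<le> v \<Longrightarrow> v = w"
      using finite_has_maximal[of "{w. c w \<noteq> 0}"] by auto
    have we: "w \<in> exps n" using invpD(2)[OF c(1) w(1)] .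
    have "act (mmonom w 1) c = delta 0 (c w)"
    proof
      fix u
      have "act (mmonom w 1) c u = c (u + w)" using act_mmonom[OF c(1) exps_finite[OF we]] by simp
      also have "\<dots> = delta 0 (c w) u"
      proof (cases "c (u + w) = 0")
        case True
        then show ?thesis using w(1) by (auto simp: delta_def)
      next
        case False
        then have uw: "u + w = w" using w(2)[of "u + w"] by simp
        have "u = 0" by (rule ext) (use fun_cong[OF uw] in simp)
        then show ?thesis by (simp add: delta_def)
      qed
      finally show "act (mmonom w 1) c u = delta 0 (c w) u" .
    qed
    then have "\<iota> (c w) = sc (mmonom w 1) (\<tau> c)" using \<tau>(3)[of "mmonom w 1" c] c we \<tau>\<iota> by simp
    also have "\<dots> = \<iota> 0" using c we by (simp add: \<iota>0)
    finally show False using w(1) \<iota>(4) by (simp add: inj_eq)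
  qed
  have inj: "inj_on \<tau> (invp n \<Delta>)"
  proof (rule inj_onI)
    fix c d assume cd: "c \<in> invp n \<Delta>" "d \<in> invp n \<Delta>" "\<tau> c = \<tau> d"
    then have "\<tau> (c - d) = \<zero>\<^bsub>E\<^esub>" using \<tau>(1) by (simp add: diff E.r_neg a_minus_def)
    then have "c - d = 0" by (rule zero[rotated]) (use cd in simp)
    then show "c = d" by (simp only: right_minus_eq)
  qed
  define T where "T = \<tau> ` invp n \<Delta>"
  have surj: "x \<in> T" if x: "x \<in> carrier E" for x
  proof (rule ccontr)
    assume "x \<notin> T"
    \<comment> \<open>By torsion only finitely many monomial multiples of \<open>x\<close> lie
      outside the image, so a maximal such exponent exists.\<close>
    define U where "U = {u \<in> exps n. sc (mmonom u 1) x \<notin> T}"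
    have "\<tau> 0 = \<zero>\<^bsub>E\<^esub>" using \<tau>(3)[of 0 0] \<tau>(1) by simp
    then have zT: "\<zero>\<^bsub>E\<^esub> \<in> T" unfolding T_def by (metis imageI invp_0)
    obtain N where N: "\<And>u i. u \<in> exps n \<Longrightarrow> i \<in> {1..n} \<Longrightarrow> N \<le> u i \<Longrightarrow> sc (mmonom u 1) x = \<zero>\<^bsub>E\<^esub>"
      using monomial_torsion[OF x] by blast
    have "U \<subseteq> {u \<in> exps n. \<forall>i\<in>{1..n}. u i < N}"
    proof
      fix u assume u: "u \<in> U"
      then have "\<not> N \<le> u i" if "i \<in> {1..n}" for i using N[OF _ that] zT by (auto simp: U_def)
      then show "u \<in> {u \<in> exps n. \<forall>i\<in>{1..n}. u i < N}" using u by (auto simp: U_def not_le)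
    qed
    then have "finite U" using finite_exps_bounded by (rule finite_subset)
    moreover have "0 \<in> U" using x \<open>x \<notin> T\<close> by (simp add: U_def mmonom_0_1)
    ultimately obtain u where u: "u \<in> U" "\<And>v. v \<in> U \<Longrightarrow> u \<le> v \<Longrightarrow> v = u"
      using finite_has_maximal[of U] by auto
    define z where "z = sc (mmonom u 1) x"
    have ue: "u \<in> exps n" using u by (simp add: U_def)
    have z: "z \<in> carrier E" "z \<notin> T" using u x ue by (auto simp: U_def z_def)
    define X :: "nat \<Rightarrow> 'k mps" where "X i = mmonom (sqf {i}) 1" for i
    have ei: "sqf {i} \<in> exps n" if "i \<in> {1..n}" for i using that by (intro sqf_exps) auto
    have X: "X i \<in> series n" if "i \<in> {1..n}" for i unfolding X_def using ei[OF that] by simp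
    have "sc (X i) z \<in> T" if i: "i \<in> {1..n}" for i
    proof (rule ccontr)
      assume "sc (X i) z \<notin> T"
      moreover have "sc (X i) z = sc (mmonom (sqf {i} + u) 1) x"
        using x ue ei[OF i] mmonom_mult[OF exps_finite[OF ei[OF i]] exps_finite[OF ue], of "1 :: 'k" 1]
        by (simp add: z_def X_def flip: sc_mult)
      ultimately have "sqf {i} + u \<in> U" using ue ei[OF i] by (simp add: U_def)
      then have "sqf {i} + u = u" using u(2)[of "sqf {i} + u"] by simp
      then have "(sqf {i} + u) i = u i" by simp
      then show False by (simp add: sqf_def)
    qed
    then have "\<exists>c\<in>invp n \<Delta>. \<tau> c = sc (X i) z" if "i \<in> {1..n}" for i
      using that unfolding T_def by (metis imageE)
    then obtain C where C: "\<And>i. i \<in> {1..n} \<Longrightarrow> C i \<in> invp n \<Delta>" "\<And>i. i \<in> {1..n} \<Longrightarrow> \<tau> (C i) = sc (X i) z"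
      by metis
    have actX: "act (X i) c v = c (v + sqf {i})" if "c \<in> invp n \<Delta>" "i \<in> {1..n}" for c i v
      unfolding X_def using act_mmonom[OF that(1) exps_finite[OF ei[OF that(2)]]] by simp
    \<comment> \<open>Both shifted preimages map to the multiple of \<open>z\<close> by the two
      variables, so they agree by injectivity. This compatibility makes \<open>c\<close> independent
      of the variable chosen in its definition.\<close>
    have comm: "C i (v + sqf {j}) = C j (v + sqf {i})" if ij: "i \<in> {1..n}" "j \<in> {1..n}" for i j v
    proof -
      have "\<tau> (act (X j) (C i)) = sc (X j * X i) z" using C ij X z by (simp add: \<tau>(3) sc_mult)
      also have "X j * X i = X i * X j" by simp
      also have "sc \<dots> z = \<tau> (act (X i) (C j))" using C ij X z by (simp add: \<tau>(3) sc_mult)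
      finally have "act (X j) (C i) = act (X i) (C j)"
        using inj_onD[OF inj] act_closed C ij by blast
      then have "act (X j) (C i) v = act (X i) (C j) v" by simp
      then show ?thesis using actX C ij by simp
    qed
    define i0 where "i0 v = (SOME i. i \<in> supp v)" for v
    \<comment> \<open>The common antiderivative: its value at \<open>v\<close> is read from some
      \<open>C i\<close> with i in the support of \<open>v\<close>. The value at 0 is not determined
      by the \<open>C i\<close> and is set to 0.\<close>
    define c where "c v = (if v \<in> exps n \<and> v \<noteq> 0 then C (i0 v) (v - sqf {i0 v}) else 0)" for v
    have cval: "c v = C i (v - sqf {i})" if v: "v \<in> exps n" "i \<in> supp v" for v i
    proof -
      have "v \<noteq> 0" using v(2) by (auto simp: supp_def)
      have j: "i0 v \<in> supp v" unfolding i0_def using v(2) by (rule someI)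
      define j where "j = i0 v"
      have ij: "i \<in> {1..n}" "j \<in> {1..n}" "v i \<noteq> 0" "v j \<noteq> 0"
        using v j by (auto simp: exps_def j_def supp_def)
      show ?thesis
      proof (cases "i = j")
        case True
        then show ?thesis using v \<open>v \<noteq> 0\<close> by (simp add: c_def j_def)
      next
        case False
        define w where "w = v - sqf {i} - sqf {j}"
        have "v - sqf {i} = w + sqf {j}" "v - sqf {j} = w + sqf {i}"
          using False ij by (auto simp: w_def fun_eq_iff sqf_def)
        then show ?thesis using comm[OF ij(1,2), of w] v \<open>v \<noteq> 0\<close> by (simp add: c_def j_def)
      qed
    qed
    have cinv: "c \<in> invp n \<Delta>"
    proof -
      have "{v. c v \<noteq> 0} \<subseteq> (\<Union>i\<in>{1..n}. (\<lambda>w. w + sqf {i}) ` {w. C i w \<noteq> 0})"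
      proof
        fix v assume v: "v \<in> {v. c v \<noteq> 0}"
        then have ve: "v \<in> exps n" "v \<noteq> 0" by (auto simp: c_def split: if_splits)
        then obtain i where i: "i \<in> supp v" by (auto simp: supp_def fun_eq_iff)
        then have "i \<in> {1..n}" using ve by (auto simp: exps_def)
        moreover have "C i (v - sqf {i}) \<noteq> 0" using cval[OF ve(1) i] v by simp
        moreover have "v = v - sqf {i} + sqf {i}" using i by (auto simp: fun_eq_iff sqf_def supp_def)
        ultimately show "v \<in> (\<Union>i\<in>{1..n}. (\<lambda>w. w + sqf {i}) ` {w. C i w \<noteq> 0})" by blast
      qed
      moreover have "finite (\<Union>i\<in>{1..n}. (\<lambda>w. w + sqf {i}) ` {w. C i w \<noteq> 0})"
        using invpD(1)[OF C(1)] by simp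
      ultimately have "finite {v. c v \<noteq> 0}" by (rule finite_subset)
      moreover have "supp v \<in> \<Delta>" if v: "c v \<noteq> 0" for v
      proof (rule ccontr)
        assume nf: "supp v \<notin> \<Delta>"
        have ve: "v \<in> exps n" "v \<noteq> 0" using v by (auto simp: c_def split: if_splits)
        then obtain i where i: "i \<in> supp v" by (auto simp: supp_def fun_eq_iff)
        \<comment> \<open>For a nonface S the squarefree monomial kills \<open>z\<close>. With the
          variable i split off, the remaining monomial kills \<open>C i\<close> by injectivity, and
          this is the vanishing of \<open>c\<close> at \<open>v\<close>.\<close>
        define S where "S = supp v"
        have S: "S \<subseteq> {1..n}" using ve by (simp add: S_def exps_def)
        then have i1: "i \<in> {1..n}" using i by (auto simp: S_def)
        have Se: "sqf (S - {i}) \<in> exps n" by (rule sqf_exps) (use S in auto)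
        have eq: "sqf (S - {i}) + sqf {i} = sqf S" using i by (auto simp: fun_eq_iff sqf_def S_def)
        have "\<tau> (act (mmonom (sqf (S - {i})) 1) (C i)) = sc (mmonom (sqf (S - {i})) 1) (sc (X i) z)"
          using C i1 Se by (simp add: \<tau>(3))
        also have "\<dots> = sc (mmonom (sqf S) 1) z"
          using z Se ei[OF i1] X[OF i1] mmonom_mult[OF exps_finite[OF Se] exps_finite[OF ei[OF i1]], of "1 :: 'k" 1]
          by (simp add: X_def eq flip: sc_mult)
        also have "\<dots> = \<zero>\<^bsub>E\<^esub>" using sc_sqf[OF S _ z(1)] nf by (simp add: S_def)
        finally have "act (mmonom (sqf (S - {i})) 1) (C i) = 0"
          using zero act_closed C i1 by blast
        then have "act (mmonom (sqf (S - {i})) 1) (C i) (v - sqf S) = 0" by simp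
        then have "C i (v - sqf S + sqf (S - {i})) = 0"
          using act_mmonom[OF C(1)[OF i1] exps_finite[OF Se], of 1] by simp
        moreover have "v - sqf S + sqf (S - {i}) = v - sqf {i}"
          using i by (auto simp: fun_eq_iff sqf_def S_def supp_def)
        ultimately show False using v cval[OF ve(1) i] by simp
      qed
      ultimately show ?thesis by (auto simp: invp_def c_def split: if_splits)
    qed
    have Xc: "act (X i) c = C i" if i: "i \<in> {1..n}" for i
    proof
      fix v
      show "act (X i) c v = C i v"
      proof (cases "v \<in> exps n")
        case True
        then show ?thesis
          using actX[OF cinv i, of v] cval[of "v + sqf {i}" i] ei[OF i] by simp
      next
        case False
        then have "c (v + sqf {i}) = 0" by (simp add: c_def)
        moreover have "C i v = 0" using invpD(2)[OF C(1)[OF i]] False by blast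
        ultimately show ?thesis using actX[OF cinv i, of v] by simp
      qed
    qed
    define y where "y = z \<ominus>\<^bsub>E\<^esub> \<tau> c"
    have yc: "y \<in> carrier E" using z \<tau>(1)[OF cinv] by (simp add: y_def)
    have zy: "z = y \<oplus>\<^bsub>E\<^esub> \<tau> c"
      using z \<tau>(1)[OF cinv] by (simp add: y_def a_minus_def E.add.m_assoc E.l_neg)
    have "y \<noteq> \<zero>\<^bsub>E\<^esub>"
    proof
      assume "y = \<zero>\<^bsub>E\<^esub>"
      then have "z = \<tau> c" using zy \<tau>(1)[OF cinv] by simp
      then show False using z cinv by (simp add: T_def)
    qed
    have kill: "sc (mmonom (sqf {i}) 1) y = \<zero>\<^bsub>E\<^esub>" if i: "i \<in> {1..n}" for i
    proof -
      have "sc (X i) y = sc (X i) z \<ominus>\<^bsub>E\<^esub> sc (X i) (\<tau> c)"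
        using z \<tau>(1)[OF cinv] X[OF i] by (simp add: y_def sc_minus_right)
      also have "sc (X i) (\<tau> c) = sc (X i) z" using \<tau>(3)[OF X[OF i] cinv] Xc[OF i] C(2)[OF i] by simp
      finally show ?thesis using z X[OF i] by (simp add: X_def a_minus_def E.r_neg)
    qed
    \<comment> \<open>Essentiality yields a nonzero multiple of \<open>y\<close> in the socle. Only
      the constant term b of the multiplier acts on \<open>y\<close>, so b is nonzero and can be
      divided out, which puts \<open>y\<close> itself into the socle.\<close>
    obtain f a where f: "f \<in> series n" "sc f y = \<iota> a" "sc f y \<noteq> \<zero>\<^bsub>E\<^esub>"
      using \<iota>(5)[OF yc \<open>y \<noteq> \<zero>\<^bsub>E\<^esub>\<close>] by blast
    define b where "b = mcoeff f 0"
    have "sc f y = sc (mmonom 0 b) y \<oplus>\<^bsub>E\<^esub> sc (mrestrict (\<lambda>u. u \<noteq> 0) f) y"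
      using mmonom_expand[OF f(1)] f(1) yc by (metis b_def sc_add series_mmonom series_mrestrict exps_0(1))
    then have fy: "sc f y = sc (mmonom 0 b) y"
      using sc_restrict_maximal_ideal[OF f(1) yc kill] yc by simp
    have b: "b \<noteq> 0"
    proof
      assume "b = 0"
      then have "(mmonom 0 b :: 'k mps) = 0" by (intro mps_eqI) (simp add: mcoeff_mmonom)
      then show False using fy f(3) yc by simp
    qed
    have "mmonom 0 (inverse b) * mmonom 0 b = (1 :: 'k mps)"
      using b by (simp add: mmonom_mult mmonom_0_1)
    then have "y = sc (mmonom 0 (inverse b)) (\<iota> a)"
      using yc f(2) fy sc_mult[of "mmonom 0 (inverse b)" "mmonom 0 b" y] by simp
    also have "\<dots> = \<iota> (mcoeff (mmonom 0 (inverse b)) 0 * a)" by (simp add: \<iota>(3))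
    finally obtain a' where "y = \<tau> (delta 0 a')" using \<tau>\<iota> by metis
    moreover have "delta 0 a' \<in> invp n \<Delta>" by (rule invp_delta) (use empty_face in auto)
    ultimately have "z = \<tau> (delta 0 a' + c)" "delta 0 a' + c \<in> invp n \<Delta>"
      using zy \<tau>(2) cinv by auto
    then show False using z by (auto simp: T_def)
  qed
  have "bij_betw \<tau> (invp n \<Delta>) (carrier E)"
    unfolding bij_betw_def using inj surj \<tau>(1) by (auto simp: T_def)
  then show ?thesis using sl by blast
qed

end

section \<open>Generators of quotient modules\<close>

locale plain_module = module R M
  for R :: "('a, 'c) ring_scheme" (structure) and M :: "('a, 'b) module" (structure)
begin

context
  fixes N assumes N: "submodule N R M"
begin

lemma submodule_abelian_subgroup: "abelian_subgroup N M"
  by (rule abelian_subgroupI3)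
     (use N in \<open>auto intro: additive_subgroup.intro submodule.axioms abelian_group_axioms\<close>)

interpretation N: abelian_subgroup N M by (rule submodule_abelian_subgroup)

lemma quotient_module_simps:
  "carrier (quotient_module M N) = (\<lambda>x. N +>\<^bsub>M\<^esub> x) ` carrier M"
  "\<zero>\<^bsub>quotient_module M N\<^esub> = N"
  "x \<in> carrier M \<Longrightarrow> y \<in> carrier M \<Longrightarrow>
    (N +>\<^bsub>M\<^esub> x) \<oplus>\<^bsub>quotient_module M N\<^esub> (N +>\<^bsub>M\<^esub> y) = N +>\<^bsub>M\<^esub> (x \<oplus>\<^bsub>M\<^esub> y)"
  by (auto simp: quotient_module_def A_RCOSETS_def RCOSETS_def a_r_coset_def
    N.a_rcos_sum[unfolded a_r_coset_def])

text \<open>The multiples of the elements of a coset need not fill a coset, for instance when a = 0;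
  the summand from \<open>N\<close> in the definition completes them.\<close>

lemma quotient_module_smult:
  assumes a: "a \<in> carrier R" and x: "x \<in> carrier M"
  shows "a \<odot>\<^bsub>quotient_module M N\<^esub> (N +>\<^bsub>M\<^esub> x) = N +>\<^bsub>M\<^esub> (a \<odot>\<^bsub>M\<^esub> x)"
proof -
  have sub: "N \<subseteq> carrier M" and sm: "\<And>y. y \<in> N \<Longrightarrow> a \<odot>\<^bsub>M\<^esub> y \<in> N"
    and add: "\<And>y z. y \<in> N \<Longrightarrow> z \<in> N \<Longrightarrow> y \<oplus>\<^bsub>M\<^esub> z \<in> N"
    using submoduleE[OF N] a by auto
  have coset: "N +>\<^bsub>M\<^esub> y = (\<lambda>z. z \<oplus>\<^bsub>M\<^esub> y) ` N" for y
    by (auto simp: a_r_coset_def r_coset_def)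
  have "{a \<odot>\<^bsub>M\<^esub> y \<oplus>\<^bsub>M\<^esub> z | y z. y \<in> N +>\<^bsub>M\<^esub> x \<and> z \<in> N} = N +>\<^bsub>M\<^esub> (a \<odot>\<^bsub>M\<^esub> x)"
  proof (intro equalityI subsetI)
    fix w assume "w \<in> {a \<odot>\<^bsub>M\<^esub> y \<oplus>\<^bsub>M\<^esub> z | y z. y \<in> N +>\<^bsub>M\<^esub> x \<and> z \<in> N}"
    then obtain m z where w: "m \<in> N" "z \<in> N" "w = a \<odot>\<^bsub>M\<^esub> (m \<oplus>\<^bsub>M\<^esub> x) \<oplus>\<^bsub>M\<^esub> z"
      unfolding coset by blast
    then have mz: "m \<in> carrier M" "z \<in> carrier M" using sub by auto
    then have "w = (a \<odot>\<^bsub>M\<^esub> m \<oplus>\<^bsub>M\<^esub> z) \<oplus>\<^bsub>M\<^esub> a \<odot>\<^bsub>M\<^esub> x"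
      using w(3) a x by (simp add: smult_r_distr M.a_ac)
    then show "w \<in> N +>\<^bsub>M\<^esub> (a \<odot>\<^bsub>M\<^esub> x)"
      unfolding coset using w add sm by blast
  next
    fix w assume "w \<in> N +>\<^bsub>M\<^esub> (a \<odot>\<^bsub>M\<^esub> x)"
    then obtain z where z: "z \<in> N" "w = z \<oplus>\<^bsub>M\<^esub> a \<odot>\<^bsub>M\<^esub> x" unfolding coset by blast
    then have "w = a \<odot>\<^bsub>M\<^esub> x \<oplus>\<^bsub>M\<^esub> z" using sub a x by (auto simp: M.a_comm)
    then show "w \<in> {a \<odot>\<^bsub>M\<^esub> y \<oplus>\<^bsub>M\<^esub> z | y z. y \<in> N +>\<^bsub>M\<^esub> x \<and> z \<in> N}"
      using z(1) N.a_rcos_self[OF x] by blast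
  qed
  then show ?thesis by (simp add: quotient_module_def)
qed

lemma module_quotient_module: "module R (quotient_module M N)"
proof (rule moduleI)
  show "cring R" by (rule R.is_cring)
  show "abelian_group (quotient_module M N)"
  proof (rule abelian_groupI)
    have "N = N +>\<^bsub>M\<^esub> \<zero>\<^bsub>M\<^esub>" using N.a_rcos_const N.zero_closed by simp
    then show zero: "\<zero>\<^bsub>quotient_module M N\<^esub> \<in> carrier (quotient_module M N)"
      unfolding quotient_module_simps by (metis M.zero_closed imageI)
    fix X assume "X \<in> carrier (quotient_module M N)"
    then obtain x where x: "x \<in> carrier M" "X = N +>\<^bsub>M\<^esub> x" unfolding quotient_module_simps by blast
    show "\<zero>\<^bsub>quotient_module M N\<^esub> \<oplus>\<^bsub>quotient_module M N\<^esub> X = X"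
      unfolding quotient_module_simps(2) using quotient_module_simps(3)[of "\<zero>\<^bsub>M\<^esub>" x] x
      by (simp flip: \<open>N = N +>\<^bsub>M\<^esub> \<zero>\<^bsub>M\<^esub>\<close>)
    show "\<exists>Y\<in>carrier (quotient_module M N). Y \<oplus>\<^bsub>quotient_module M N\<^esub> X = \<zero>\<^bsub>quotient_module M N\<^esub>"
    proof (rule bexI[of _ "N +>\<^bsub>M\<^esub> (\<ominus>\<^bsub>M\<^esub> x)"])
      show "(N +>\<^bsub>M\<^esub> (\<ominus>\<^bsub>M\<^esub> x)) \<oplus>\<^bsub>quotient_module M N\<^esub> X = \<zero>\<^bsub>quotient_module M N\<^esub>"
        using x by (simp add: quotient_module_simps M.l_neg flip: \<open>N = N +>\<^bsub>M\<^esub> \<zero>\<^bsub>M\<^esub>\<close>)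
    qed (use x in \<open>simp add: quotient_module_simps\<close>)
  qed (auto simp: quotient_module_simps M.a_ac)
qed (auto simp: quotient_module_simps quotient_module_smult smult_l_distr smult_r_distr smult_assoc1)

text \<open>Submodules of the quotient correspond to submodules of \<open>M\<close> containing
  \<open>N\<close>. Generation is phrased through submodules instead of linear combinations, to
  match \<open>generated_submodule\<close>.\<close>

lemma min_number_of_generators_quotient_le:
  assumes S: "finite S" "S \<subseteq> carrier M"
    and gen: "\<And>L. submodule L R M \<Longrightarrow> N \<subseteq> L \<Longrightarrow> S \<subseteq> L \<Longrightarrow> carrier M \<subseteq> L"
  shows "min_number_of_generators R (quotient_module M N) \<le> enat (card S)"
proof -
  interpret Q: module R "quotient_module M N" by (rule module_quotient_module)
  let ?Q = "quotient_module M N"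
  define S' where "S' = (\<lambda>x. N +>\<^bsub>M\<^esub> x) ` S"
  have S': "S' \<subseteq> carrier ?Q" using S by (auto simp: S'_def quotient_module_simps)
  have "carrier ?Q \<subseteq> L" if L: "submodule L R ?Q" "S' \<subseteq> L" for L
  proof -
    note LE = Q.submoduleE[OF L(1)]
    have zL: "N \<in> L"
    proof -
      obtain y where y: "y \<in> L" using LE(2) by blast
      then have "\<ominus>\<^bsub>?Q\<^esub> y \<oplus>\<^bsub>?Q\<^esub> y \<in> L" using LE(3,5) by blast
      then show ?thesis using y LE(1) Q.M.l_neg[of y] by (auto simp: quotient_module_simps)
    qed
    define L' where "L' = {x \<in> carrier M. N +>\<^bsub>M\<^esub> x \<in> L}"
    have NL: "N \<subseteq> L'" using zL N.a_rcos_const N.a_subset by (auto simp: L'_def)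
    have smL: "a \<odot>\<^bsub>M\<^esub> x \<in> L'" if "a \<in> carrier R" "x \<in> L'" for a x
      using that LE(4)[OF that(1), of "N +>\<^bsub>M\<^esub> x"] by (simp add: L'_def quotient_module_smult)
    have "submodule L' R M"
    proof (rule submoduleI)
      show "L' \<subseteq> carrier M" by (auto simp: L'_def)
      show "\<zero>\<^bsub>M\<^esub> \<in> L'" using NL N.zero_closed by blast
      show "a \<oplus>\<^bsub>M\<^esub> b \<in> L'" if "a \<in> L'" "b \<in> L'" for a b
        using that LE(5)[of "N +>\<^bsub>M\<^esub> a" "N +>\<^bsub>M\<^esub> b"] by (simp add: L'_def quotient_module_simps)
      show "\<ominus>\<^bsub>M\<^esub> a \<in> L'" if "a \<in> L'" for a
        using smL[of "\<ominus> \<one>" a] that by (simp add: L'_def smult_l_minus)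
    qed (use smL in auto)
    moreover have "S \<subseteq> L'" using S L(2) by (auto simp: L'_def S'_def)
    ultimately have "carrier M \<subseteq> L'" using gen NL by blast
    then show ?thesis by (auto simp: quotient_module_simps L'_def)
  qed
  then have "generated_submodule R ?Q S' = carrier ?Q"
    using Q.carrier_is_submodule S' unfolding generated_submodule_def by blast
  then have "S' \<in> {S. finite S \<and> S \<subseteq> carrier ?Q \<and> generated_submodule R ?Q S = carrier ?Q}"
    using S S' by (simp add: S'_def)
  then have "min_number_of_generators R ?Q \<le> enat (card S')"
    unfolding min_number_of_generators_def by (rule INF_lower)
  also have "card S' \<le> card S" unfolding S'_def using S(1) by (rule card_image_le)
  finally show ?thesis by simp
qed

end


section \<open>The algebra of Frobenius operators\<close>

lemma frobenius_mapsD: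
  assumes "\<phi> \<in> frobenius_maps p R M e"
  shows "x \<in> carrier M \<Longrightarrow> \<phi> x \<in> carrier M" "\<phi> \<in> extensional (carrier M)"
    "x \<in> carrier M \<Longrightarrow> y \<in> carrier M \<Longrightarrow> \<phi> (x \<oplus>\<^bsub>M\<^esub> y) = \<phi> x \<oplus>\<^bsub>M\<^esub> \<phi> y"
    "a \<in> carrier R \<Longrightarrow> x \<in> carrier M \<Longrightarrow> \<phi> (a \<odot>\<^bsub>M\<^esub> x) = (a [^] (p ^ e)) \<odot>\<^bsub>M\<^esub> \<phi> x"
  using assms by (auto simp: frobenius_maps_def PiE_def)

lemma frobenius_mapsI:
  assumes "\<And>x. x \<in> carrier M \<Longrightarrow> \<phi> x \<in> carrier M"
    "\<And>x y. x \<in> carrier M \<Longrightarrow> y \<in> carrier M \<Longrightarrow> \<phi> (x \<oplus>\<^bsub>M\<^esub> y) = \<phi> x \<oplus>\<^bsub>M\<^esub> \<phi> y"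
    "\<And>a x. a \<in> carrier R \<Longrightarrow> x \<in> carrier M \<Longrightarrow> \<phi> (a \<odot>\<^bsub>M\<^esub> x) = (a [^] (p ^ e)) \<odot>\<^bsub>M\<^esub> \<phi> x"
  shows "(\<lambda>x\<in>carrier M. \<phi> x) \<in> frobenius_maps p R M e"
  using assms by (auto simp: frobenius_maps_def)

lemma frobenius_map_zero:
  assumes "\<phi> \<in> frobenius_maps p R M e"
  shows "\<phi> \<zero>\<^bsub>M\<^esub> = \<zero>\<^bsub>M\<^esub>"
proof -
  have "\<phi> \<zero>\<^bsub>M\<^esub> \<oplus>\<^bsub>M\<^esub> \<phi> \<zero>\<^bsub>M\<^esub> = \<phi> \<zero>\<^bsub>M\<^esub>"
    using frobenius_mapsD(3)[OF assms, of "\<zero>\<^bsub>M\<^esub>" "\<zero>\<^bsub>M\<^esub>"] by simp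
  then show ?thesis using frobenius_mapsD(1)[OF assms, of "\<zero>\<^bsub>M\<^esub>"] by simp
qed

lemma zero_map_frobenius: "zero_map M \<in> frobenius_maps p R M e"
  unfolding zero_map_def by (rule frobenius_mapsI) auto

lemma frobenius_add:
  assumes "\<phi> \<in> frobenius_maps p R M e" "\<psi> \<in> frobenius_maps p R M e"
  shows "(\<lambda>x\<in>carrier M. \<phi> x \<oplus>\<^bsub>M\<^esub> \<psi> x) \<in> frobenius_maps p R M e"
  using frobenius_mapsD[OF assms(1)] frobenius_mapsD[OF assms(2)]
  by (intro frobenius_mapsI) (simp_all add: M.a_ac smult_r_distr)

lemma frobenius_smult:
  assumes a: "a \<in> carrier R" and \<phi>: "\<phi> \<in> frobenius_maps p R M e"
  shows "(\<lambda>x\<in>carrier M. a \<odot>\<^bsub>M\<^esub> \<phi> x) \<in> frobenius_maps p R M e"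
proof (rule frobenius_mapsI)
  fix b x assume "b \<in> carrier R" "x \<in> carrier M"
  then show "a \<odot>\<^bsub>M\<^esub> \<phi> (b \<odot>\<^bsub>M\<^esub> x) = (b [^] (p ^ e)) \<odot>\<^bsub>M\<^esub> (a \<odot>\<^bsub>M\<^esub> \<phi> x)"
    using a frobenius_mapsD[OF \<phi>] by (simp add: R.m_comm flip: smult_assoc1)
qed (use a frobenius_mapsD[OF \<phi>] in \<open>auto simp: smult_r_distr\<close>)

lemma frobenius_comp:
  assumes \<phi>: "\<phi> \<in> frobenius_maps p R M d" and \<psi>: "\<psi> \<in> frobenius_maps p R M e"
  shows "(\<lambda>x\<in>carrier M. \<phi> (\<psi> x)) \<in> frobenius_maps p R M (d + e)"
  using frobenius_mapsD[OF \<phi>] frobenius_mapsD[OF \<psi>]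
  by (intro frobenius_mapsI) (simp_all add: R.nat_pow_pow power_add mult.commute)

lemma frobenius_module_simps:
  "carrier (frobenius_module p R M e) = frobenius_maps p R M e"
  "\<zero>\<^bsub>frobenius_module p R M e\<^esub> = zero_map M"
  "\<phi> \<oplus>\<^bsub>frobenius_module p R M e\<^esub> \<psi> = (\<lambda>x\<in>carrier M. \<phi> x \<oplus>\<^bsub>M\<^esub> \<psi> x)"
  "a \<odot>\<^bsub>frobenius_module p R M e\<^esub> \<phi> = (\<lambda>x\<in>carrier M. a \<odot>\<^bsub>M\<^esub> \<phi> x)"
  by (simp_all add: frobenius_module_def)

lemma module_frobenius_module: "module R (frobenius_module p R M e)"
proof (rule moduleI)
  show "cring R" by (rule R.is_cring)
  show "abelian_group (frobenius_module p R M e)"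
  proof (rule abelian_groupI; unfold frobenius_module_simps)
    fix \<phi> assume \<phi>: "\<phi> \<in> frobenius_maps p R M e"
    show "(\<lambda>x\<in>carrier M. zero_map M x \<oplus>\<^bsub>M\<^esub> \<phi> x) = \<phi>"
      by (rule extensionalityI[OF _ frobenius_mapsD(2)[OF \<phi>]])
         (use frobenius_mapsD(1)[OF \<phi>] in \<open>auto simp: zero_map_def\<close>)
    show "\<exists>\<psi>\<in>frobenius_maps p R M e. (\<lambda>x\<in>carrier M. \<psi> x \<oplus>\<^bsub>M\<^esub> \<phi> x) = zero_map M"
    \<comment> \<open>Negation is taken as multiplication by -1, so that its Frobenius property is
      that of scalar multiples.\<close>
    proof (rule bexI[of _ "\<lambda>x\<in>carrier M. \<ominus> \<one> \<odot>\<^bsub>M\<^esub> \<phi> x"])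
      show "(\<lambda>x\<in>carrier M. \<ominus> \<one> \<odot>\<^bsub>M\<^esub> \<phi> x) \<in> frobenius_maps p R M e"
        by (rule frobenius_smult[OF _ \<phi>]) simp
      show "(\<lambda>x\<in>carrier M. (\<lambda>x\<in>carrier M. \<ominus> \<one> \<odot>\<^bsub>M\<^esub> \<phi> x) x \<oplus>\<^bsub>M\<^esub> \<phi> x) = zero_map M"
        unfolding zero_map_def
        by (rule restrict_ext) (simp add: frobenius_mapsD(1)[OF \<phi>] smult_l_minus M.l_neg)
    qed
  next
    fix \<phi> \<psi> \<theta> assume "\<phi> \<in> frobenius_maps p R M e" "\<psi> \<in> frobenius_maps p R M e" "\<theta> \<in> frobenius_maps p R M e"
    note D = frobenius_mapsD(1)[OF this(1)] frobenius_mapsD(1)[OF this(2)] frobenius_mapsD(1)[OF this(3)]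
    show "(\<lambda>x\<in>carrier M. (\<lambda>x\<in>carrier M. \<phi> x \<oplus>\<^bsub>M\<^esub> \<psi> x) x \<oplus>\<^bsub>M\<^esub> \<theta> x)
      = (\<lambda>x\<in>carrier M. \<phi> x \<oplus>\<^bsub>M\<^esub> (\<lambda>x\<in>carrier M. \<psi> x \<oplus>\<^bsub>M\<^esub> \<theta> x) x)"
      by (rule restrict_ext) (simp add: D M.a_assoc)
  next
    fix \<phi> \<psi> assume "\<phi> \<in> frobenius_maps p R M e" "\<psi> \<in> frobenius_maps p R M e"
    note D = frobenius_mapsD(1)[OF this(1)] frobenius_mapsD(1)[OF this(2)]
    show "(\<lambda>x\<in>carrier M. \<phi> x \<oplus>\<^bsub>M\<^esub> \<psi> x) = (\<lambda>x\<in>carrier M. \<psi> x \<oplus>\<^bsub>M\<^esub> \<phi> x)"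
      by (rule restrict_ext) (simp add: D M.a_comm)
  qed (auto intro: frobenius_add zero_map_frobenius)
next
  fix \<phi> assume \<phi>: "\<phi> \<in> carrier (frobenius_module p R M e)"
  show "\<one> \<odot>\<^bsub>frobenius_module p R M e\<^esub> \<phi> = \<phi>"
    unfolding frobenius_module_simps
    by (rule extensionalityI[OF _ frobenius_mapsD(2)])
       (use \<phi> frobenius_mapsD(1) in \<open>auto simp: frobenius_module_simps\<close>)
next
  fix a b \<phi> assume ab: "a \<in> carrier R" "b \<in> carrier R" and "\<phi> \<in> carrier (frobenius_module p R M e)"
  then have \<phi>: "\<phi> \<in> frobenius_maps p R M e" by (simp add: frobenius_module_simps)
  show "(a \<oplus> b) \<odot>\<^bsub>frobenius_module p R M e\<^esub> \<phi> =
      a \<odot>\<^bsub>frobenius_module p R M e\<^esub> \<phi> \<oplus>\<^bsub>frobenius_module p R M e\<^esub> b \<odot>\<^bsub>frobenius_module p R M e\<^esub> \<phi>"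
    unfolding frobenius_module_simps
    by (rule restrict_ext) (simp add: frobenius_mapsD(1)[OF \<phi>] ab smult_l_distr)
  show "a \<otimes> b \<odot>\<^bsub>frobenius_module p R M e\<^esub> \<phi> =
      a \<odot>\<^bsub>frobenius_module p R M e\<^esub> (b \<odot>\<^bsub>frobenius_module p R M e\<^esub> \<phi>)"
    unfolding frobenius_module_simps
    by (rule restrict_ext) (simp add: frobenius_mapsD(1)[OF \<phi>] ab smult_assoc1)
  show "a \<odot>\<^bsub>frobenius_module p R M e\<^esub> \<phi> \<in> carrier (frobenius_module p R M e)"
    unfolding frobenius_module_simps by (rule frobenius_smult[OF ab(1) \<phi>])
next
  fix a \<phi> \<psi> assume a: "a \<in> carrier R"
    and "\<phi> \<in> carrier (frobenius_module p R M e)" "\<psi> \<in> carrier (frobenius_module p R M e)"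
  then have \<phi>: "\<phi> \<in> frobenius_maps p R M e" and \<psi>: "\<psi> \<in> frobenius_maps p R M e"
    by (simp_all add: frobenius_module_simps)
  show "a \<odot>\<^bsub>frobenius_module p R M e\<^esub> (\<phi> \<oplus>\<^bsub>frobenius_module p R M e\<^esub> \<psi>) =
      a \<odot>\<^bsub>frobenius_module p R M e\<^esub> \<phi> \<oplus>\<^bsub>frobenius_module p R M e\<^esub> a \<odot>\<^bsub>frobenius_module p R M e\<^esub> \<psi>"
    unfolding frobenius_module_simps
    by (rule restrict_ext) (simp add: frobenius_mapsD(1)[OF \<phi>] frobenius_mapsD(1)[OF \<psi>] a smult_r_distr)
qed

text \<open>Off the index i = d the outer factor is zero. At i = d, in a degree other than d + e,
  the inner factor is zero and the outer map, being additive, preserves 0.\<close>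

lemma homogeneous_mult:
  assumes \<phi>: "\<phi> \<in> frobenius_maps p R M d" and \<psi>: "\<psi> \<in> frobenius_maps p R M e"
  shows "homogeneous_element M d \<phi> \<otimes>\<^bsub>frobenius_algebra p R M\<^esub> homogeneous_element M e \<psi> =
    homogeneous_element M (d + e) (\<lambda>x\<in>carrier M. \<phi> (\<psi> x))"
proof
  fix k
  let ?f = "\<lambda>x i. homogeneous_element M d \<phi> i (homogeneous_element M e \<psi> (k - i) x)"
  have f: "?f x i = (if d = i then (if k = d + e then \<phi> (\<psi> x) else \<zero>\<^bsub>M\<^esub>) else \<zero>\<^bsub>M\<^esub>)"
    if "x \<in> carrier M" "i \<le> k" for x i
  proof -
    have k: "k - i = e \<longleftrightarrow> k = i + e" using that by auto
    show ?thesis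
      using that frobenius_mapsD(1)[OF \<psi>] frobenius_map_zero[OF \<phi>]
      by (cases "d = i"; cases "k = i + e") (simp_all add: homogeneous_element_def zero_map_def k)
  qed
  have "(\<Oplus>\<^bsub>M\<^esub>i\<in>{..k}. ?f x i) = (if k = d + e then \<phi> (\<psi> x) else \<zero>\<^bsub>M\<^esub>)" if x: "x \<in> carrier M" for x
  proof -
    have c: "\<phi> (\<psi> x) \<in> carrier M" using x frobenius_mapsD(1)[OF \<phi>] frobenius_mapsD(1)[OF \<psi>] by simp
    have "(\<Oplus>\<^bsub>M\<^esub>i\<in>{..k}. ?f x i) =
      (\<Oplus>\<^bsub>M\<^esub>i\<in>{..k}. if d = i then (if k = d + e then \<phi> (\<psi> x) else \<zero>\<^bsub>M\<^esub>) else \<zero>\<^bsub>M\<^esub>)"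
      by (rule M.finsum_cong') (use f x c in auto)
    also have "\<dots> = (if k = d + e then \<phi> (\<psi> x) else \<zero>\<^bsub>M\<^esub>)"
    proof (cases "d \<le> k")
      case True
      then show ?thesis using c
        by (subst M.add.finprod_singleton[of d "{..k}" "\<lambda>_. if k = d + e then \<phi> (\<psi> x) else \<zero>\<^bsub>M\<^esub>"]) auto
    next
      case False
      have "(\<Oplus>\<^bsub>M\<^esub>i\<in>{..k}. if d = i then (if k = d + e then \<phi> (\<psi> x) else \<zero>\<^bsub>M\<^esub>) else \<zero>\<^bsub>M\<^esub>)
        = (\<Oplus>\<^bsub>M\<^esub>i\<in>{..k}. \<zero>\<^bsub>M\<^esub>)"
        by (rule M.finsum_cong') (use False in auto)
      then show ?thesis using False by simp
    qed
    finally show ?thesis .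
  qed
  then show "(homogeneous_element M d \<phi> \<otimes>\<^bsub>frobenius_algebra p R M\<^esub> homogeneous_element M e \<psi>) k =
    homogeneous_element M (d + e) (\<lambda>x\<in>carrier M. \<phi> (\<psi> x)) k"
    by (auto simp: frobenius_algebra_def homogeneous_element_def zero_map_def intro!: restrict_ext)
qed

lemma homogeneous_add:
  "homogeneous_element M e \<phi> \<oplus>\<^bsub>frobenius_algebra p R M\<^esub> homogeneous_element M e \<psi> =
    homogeneous_element M e (\<lambda>x\<in>carrier M. \<phi> x \<oplus>\<^bsub>M\<^esub> \<psi> x)"
  by (auto simp: frobenius_algebra_def homogeneous_element_def zero_map_def fun_eq_iff)

lemma homogeneous_generated:
  assumes "\<phi> \<in> frobenius_maps p R M d" "d < e"
  shows "homogeneous_element M d \<phi> \<in>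
    generate_ring (frobenius_algebra p R M) (\<Union>k<e. graded_piece p R M k)"
  by (intro generate_ring.incl UN_I[of d]) (use assms in \<open>auto simp: graded_piece_def\<close>)

text \<open>Positivity of both degrees puts both factors strictly below d + e, hence among the
  generators of the subring.\<close>

lemma old_maps_comp:
  assumes \<phi>: "\<phi> \<in> frobenius_maps p R M d" and \<psi>: "\<psi> \<in> frobenius_maps p R M e" and "d > 0" "e > 0"
  shows "(\<lambda>x\<in>carrier M. \<phi> (\<psi> x)) \<in> old_maps p R M (d + e)"
proof -
  let ?G = "generate_ring (frobenius_algebra p R M) (\<Union>k<d + e. graded_piece p R M k)"
  have "homogeneous_element M d \<phi> \<in> ?G" "homogeneous_element M e \<psi> \<in> ?G"
    using assms by (auto intro: homogeneous_generated)
  then have "homogeneous_element M (d + e) (\<lambda>x\<in>carrier M. \<phi> (\<psi> x)) \<in> ?G"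
    unfolding homogeneous_mult[OF \<phi> \<psi>, symmetric] by (rule generate_ring.eng_mult)
  then show ?thesis using frobenius_comp[OF \<phi> \<psi>] by (simp add: old_maps_def)
qed

text \<open>Scalar multiplication is itself an operator of degree 0, which is among the generators
  of the subring as soon as e \<ge> 1; closure under products thus gives closure under
  scalars.\<close>

lemma submodule_old_maps:
  assumes e: "e \<ge> 1"
  shows "submodule (old_maps p R M e) R (frobenius_module p R M e)"
proof -
  interpret F: module R "frobenius_module p R M e" by (rule module_frobenius_module)
  let ?G = "generate_ring (frobenius_algebra p R M) (\<Union>k<e. graded_piece p R M k)"
  have incl: "homogeneous_element M 0 \<phi> \<in> ?G" if "\<phi> \<in> frobenius_maps p R M 0" for \<phi>
    using that e by (auto intro: homogeneous_generated)
  have smult: "a \<odot>\<^bsub>frobenius_module p R M e\<^esub> \<phi> \<in> old_maps p R M e"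
    if a: "a \<in> carrier R" and \<phi>: "\<phi> \<in> old_maps p R M e" for a \<phi>
  proof -
    have \<phi>F: "\<phi> \<in> frobenius_maps p R M e" and \<phi>G: "homogeneous_element M e \<phi> \<in> ?G"
      using \<phi> by (auto simp: old_maps_def)
    have m: "(\<lambda>x\<in>carrier M. a \<odot>\<^bsub>M\<^esub> x) \<in> frobenius_maps p R M 0"
      by (rule frobenius_mapsI) (use a in \<open>auto simp: smult_r_distr R.m_comm simp flip: smult_assoc1\<close>)
    have "homogeneous_element M (0 + e) (\<lambda>x\<in>carrier M. (\<lambda>x\<in>carrier M. a \<odot>\<^bsub>M\<^esub> x) (\<phi> x)) \<in> ?G"
      unfolding homogeneous_mult[OF m \<phi>F, symmetric] using incl[OF m] \<phi>G by (rule generate_ring.eng_mult)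
    moreover have "(\<lambda>x\<in>carrier M. (\<lambda>x\<in>carrier M. a \<odot>\<^bsub>M\<^esub> x) (\<phi> x)) = (\<lambda>x\<in>carrier M. a \<odot>\<^bsub>M\<^esub> \<phi> x)"
      by (rule restrict_ext) (simp add: frobenius_mapsD(1)[OF \<phi>F])
    ultimately show ?thesis using frobenius_smult[OF a \<phi>F] by (simp add: old_maps_def frobenius_module_simps)
  qed
  show ?thesis
  proof (rule F.submoduleI)
    show sub: "old_maps p R M e \<subseteq> carrier (frobenius_module p R M e)"
      by (auto simp: old_maps_def frobenius_module_simps)
    have "homogeneous_element M 0 (zero_map M) = homogeneous_element M e (zero_map M)"
      by (auto simp: homogeneous_element_def)
    then show "\<zero>\<^bsub>frobenius_module p R M e\<^esub> \<in> old_maps p R M e"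
      using incl[OF zero_map_frobenius] zero_map_frobenius by (simp add: old_maps_def frobenius_module_simps)
    show "\<phi> \<oplus>\<^bsub>frobenius_module p R M e\<^esub> \<psi> \<in> old_maps p R M e"
      if "\<phi> \<in> old_maps p R M e" "\<psi> \<in> old_maps p R M e" for \<phi> \<psi>
      using that generate_ring.eng_add[of "homogeneous_element M e \<phi>" "frobenius_algebra p R M" _ "homogeneous_element M e \<psi>"]
      by (simp add: old_maps_def frobenius_module_simps homogeneous_add frobenius_add)
    show "\<ominus>\<^bsub>frobenius_module p R M e\<^esub> \<phi> \<in> old_maps p R M e" if \<phi>: "\<phi> \<in> old_maps p R M e" for \<phi>
    proof -
      have "\<phi> \<in> carrier (frobenius_module p R M e)" using \<phi> sub by blast
      then show ?thesis using smult[OF _ \<phi>, of "\<ominus> \<one>"] by (simp add: F.smult_l_minus)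
    qed
  qed (rule smult)
qed

end


section \<open>Generators of the Frobenius algebra\<close>

context sr_hull
begin

interpretation E: plain_module A E by (rule plain_module.intro) (rule module_E)

section \<open>Transport of operators along the isomorphism, and the count of generators\<close>

definition hull_iso :: "((nat \<Rightarrow> nat) \<Rightarrow> 'k) \<Rightarrow> 'e" where
  "hull_iso = (SOME \<tau>. linear_map \<tau> \<and> bij_betw \<tau> (invp n \<Delta>) (carrier E))"

lemma hull_iso: "linear_map hull_iso" "bij_betw hull_iso (invp n \<Delta>) (carrier E)"
  unfolding atomize_conj hull_iso_def by (rule someI_ex[OF hull_isomorphism])

lemmas iso_simps = linear_mapD[OF hull_iso(1)]

lemma iso_cases:
  assumes "x \<in> carrier E"
  obtains c where "c \<in> invp n \<Delta>" "x = hull_iso c"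
  using assms hull_iso(2) by (auto simp: bij_betw_def)

definition coord :: "'e \<Rightarrow> (nat \<Rightarrow> nat) \<Rightarrow> 'k" where
  "coord = the_inv_into (invp n \<Delta>) hull_iso"

lemma coord_iso [simp]: "c \<in> invp n \<Delta> \<Longrightarrow> coord (hull_iso c) = c"
  using hull_iso(2) by (auto simp: coord_def bij_betw_def the_inv_into_f_f)

lemma coord_closed: "x \<in> carrier E \<Longrightarrow> coord x \<in> invp n \<Delta>"
  by (erule iso_cases) simp

lemma iso_coord: "x \<in> carrier E \<Longrightarrow> hull_iso (coord x) = x"
  by (erule iso_cases) simp

definition twist_map :: "nat \<Rightarrow> 'k mps \<Rightarrow> 'e \<Rightarrow> 'e" where
  "twist_map e g = (\<lambda>x\<in>carrier E. hull_iso (twist n (p ^ e) g (coord x)))"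

lemma twist_map_iso: "c \<in> invp n \<Delta> \<Longrightarrow> twist_map e g (hull_iso c) = hull_iso (twist n (p ^ e) g c)"
  by (simp add: twist_map_def iso_simps)

lemma twist_map_frobenius:
  assumes g: "\<And>\<gamma>. mcoeff g \<gamma> \<noteq> 0 \<Longrightarrow> \<gamma> \<in> valid_exps n \<Delta> (p ^ e)"
  shows "twist_map e g \<in> frobenius_maps p A E e"
  unfolding twist_map_def
proof (rule E.frobenius_mapsI)
  fix x assume "x \<in> carrier E"
  then obtain c where c: "c \<in> invp n \<Delta>" "x = hull_iso c" by (rule iso_cases)
  note tc = twist_closed[OF g c(1)]
  show "hull_iso (twist n (p ^ e) g (coord x)) \<in> carrier E" using c tc by (simp add: iso_simps)
  show "hull_iso (twist n (p ^ e) g (coord (x \<oplus>\<^bsub>E\<^esub> y))) =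
      hull_iso (twist n (p ^ e) g (coord x)) \<oplus>\<^bsub>E\<^esub> hull_iso (twist n (p ^ e) g (coord y))" if y: "y \<in> carrier E" for y
  proof -
    obtain d where d: "d \<in> invp n \<Delta>" "y = hull_iso d" using y by (rule iso_cases)
    have "coord (x \<oplus>\<^bsub>E\<^esub> y) = c + d" using c d by (simp flip: iso_simps(2))
    then show ?thesis using c d tc twist_closed[OF g d(1)] by (simp add: twist_add iso_simps(2))
  qed
  show "hull_iso (twist n (p ^ e) g (coord (a \<odot>\<^bsub>E\<^esub> x))) =
      (a [^]\<^bsub>A\<^esub> (p ^ e)) \<odot>\<^bsub>E\<^esub> hull_iso (twist n (p ^ e) g (coord x))" if a: "a \<in> carrier A" for a
  proof -
    obtain f where f: "f \<in> series n" "a = cls f" using a by (auto simp: carrier_A)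
    have "a \<odot>\<^bsub>E\<^esub> x = hull_iso (act f c)" using c f by (simp add: iso_simps(3) sc_def)
    then have "coord (a \<odot>\<^bsub>E\<^esub> x) = act f c" using coord_iso[OF act_closed[OF c(1)]] by simp
    then show ?thesis using c f tc by (simp add: twist_act iso_simps(3) sc_def cls_power)
  qed
qed

definition generator :: "nat \<Rightarrow> nat set \<times> nat set \<Rightarrow> 'e \<Rightarrow> 'e" where
  "generator e P = twist_map e (mmonom (pair_exp n (p ^ e) P) 1)"

lemma generator_valid:
  assumes "P \<in> generating_pairs" "mcoeff (mmonom (pair_exp n (p ^ e) P) (1 :: 'k)) \<gamma> \<noteq> 0"
  shows "\<gamma> \<in> valid_exps n \<Delta> (p ^ e)"
proof -
  note v = generating_pair_valid[OF assms(1), of e]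
  then have "pair_exp n (p ^ e) P \<in> exps n" by (simp add: valid_exps_def)
  then show ?thesis using v assms(2) by (simp add: mcoeff_mmonom exps_finite split: if_splits)
qed

lemma generator_frobenius: "P \<in> generating_pairs \<Longrightarrow> generator e P \<in> frobenius_maps p A E e"
  unfolding generator_def using generator_valid by (intro twist_map_frobenius)

lemma generator_core_old:
  assumes "d > 0" "e > 0"
  shows "generator (d + e) ({}, core) \<in> old_maps p A E (d + e)"
proof -
  have P: "({}, core) \<in> generating_pairs" by (simp add: generating_pairs_def)
  have "generator (d + e) ({}, core) = (\<lambda>x\<in>carrier E. generator d ({}, core) (generator e ({}, core) x))"
  proof (rule extensionalityI[of _ "carrier E"])
    fix x assume "x \<in> carrier E"
    then obtain c where c: "c \<in> invp n \<Delta>" "x = hull_iso c" by (rule iso_cases)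
    have "twist n (p ^ e) (mmonom (pair_exp n (p ^ e) ({}, core)) 1) c \<in> invp n \<Delta>"
      using generator_valid[OF P] c(1) by (intro twist_closed)
    then show "generator (d + e) ({}, core) x =
        (\<lambda>x\<in>carrier E. generator d ({}, core) (generator e ({}, core) x)) x"
      using c twist_core[OF c(1), of d e] by (simp add: generator_def twist_map_iso iso_simps(1))
  qed (simp_all add: generator_def twist_map_def)
  then show ?thesis
    using E.old_maps_comp[OF generator_frobenius[OF P] generator_frobenius[OF P] assms] by simp
qed

text \<open>In the coordinates of the isomorphism an operator is Frobenius followed by a series
  \<open>g\<close>, and \<open>g\<close> lies in the monomial ideal generated by the exponents of
  the generating pairs. A finite combination of the generators therefore gives the operator.\<close>

lemma generators_span:
  assumes L: "submodule L A (frobenius_module p A E e)"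
    and gen: "\<And>P. P \<in> generating_pairs \<Longrightarrow> generator e P \<in> L"
  shows "frobenius_maps p A E e \<subseteq> L"
proof
  interpret F: module A "frobenius_module p A E e" by (rule E.module_frobenius_module)
  let ?q = "p ^ e"
  note LE = F.submoduleE[OF L, unfolded E.frobenius_module_simps]
  have zL: "zero_map E \<in> L"
  proof -
    obtain \<theta> where \<theta>: "\<theta> \<in> L" using LE(2) by blast
    have "\<theta> \<in> carrier (frobenius_module p A E e)"
      using \<theta> LE(1) unfolding E.frobenius_module_simps by blast
    then have "\<zero>\<^bsub>A\<^esub> \<odot>\<^bsub>frobenius_module p A E e\<^esub> \<theta> = zero_map E"
      by (simp add: F.smult_l_null E.frobenius_module_simps(2))
    moreover have "\<zero>\<^bsub>A\<^esub> \<odot>\<^bsub>frobenius_module p A E e\<^esub> \<theta> \<in> L"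
      unfolding E.frobenius_module_simps using LE(4) \<theta> E.R.zero_closed by blast
    ultimately show ?thesis by simp
  qed
  fix \<phi> assume \<phi>: "\<phi> \<in> frobenius_maps p A E e"
  note D = E.frobenius_mapsD[OF \<phi>]
  define \<psi> where "\<psi> c = coord (\<phi> (hull_iso c))" for c
  have \<psi>: "\<psi> c \<in> invp n \<Delta>" "hull_iso (\<psi> c) = \<phi> (hull_iso c)" if "c \<in> invp n \<Delta>" for c
    using that D(1) iso_simps(1) by (simp_all add: \<psi>_def coord_closed iso_coord)
  have add: "\<psi> (c + d) = \<psi> c + \<psi> d" if "c \<in> invp n \<Delta>" "d \<in> invp n \<Delta>" for c d
  proof -
    have "\<phi> (hull_iso (c + d)) = hull_iso (\<psi> c + \<psi> d)"
      using that \<psi> by (simp add: iso_simps D(3))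
    then show ?thesis using that \<psi> by (simp add: \<psi>_def[of "c + d"])
  qed
  have smult: "\<psi> (act f c) = act (f ^ ?q) (\<psi> c)" if "f \<in> series n" "c \<in> invp n \<Delta>" for f c
  proof -
    have "\<phi> (hull_iso (act f c)) = hull_iso (act (f ^ ?q) (\<psi> c))"
      using that \<psi>[OF that(2)] by (simp add: iso_simps sc_def D(4) cls_power)
    then show ?thesis
      using coord_iso[OF act_closed[OF \<psi>(1)[OF that(2)]]] by (simp add: \<psi>_def[of "act f c"])
  qed
  obtain g where g: "g \<in> series n" "\<And>\<gamma>. mcoeff g \<gamma> \<noteq> 0 \<Longrightarrow> \<gamma> \<in> valid_exps n \<Delta> ?q"
    "\<And>c. c \<in> invp n \<Delta> \<Longrightarrow> \<psi> c = twist n ?q g c"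
    using frobenius_map_eq_twist[of \<psi> e] \<psi>(1) add smult by blast
  \<comment> \<open>For arbitrary \<open>h\<close> the twisted inverse polynomial may leave the
    faces, where \<open>hull_iso\<close> is not controlled; closure is therefore part of the
    property carried through the induction.\<close>
  define realised where "realised h \<longleftrightarrow>
    (\<exists>\<theta>\<in>L. \<forall>c\<in>invp n \<Delta>. twist n ?q h c \<in> invp n \<Delta> \<and> \<theta> (hull_iso c) = hull_iso (twist n ?q h c))" for h
  have "realised g"
  proof (rule monomial_ideal_induct[where T = "pair_exp n ?q ` generating_pairs" and n = n])
    show "finite (pair_exp n ?q ` generating_pairs)" using finite_generating_pairs by simp
    show "pair_exp n ?q ` generating_pairs \<subseteq> exps n"
      using generating_pair_valid by (auto simp: valid_exps_def)
    show "\<exists>t\<in>pair_exp n ?q ` generating_pairs. t \<le> u" if "mcoeff g u \<noteq> 0" for u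
      using valid_exp_ge_generator[OF g(2)[OF that]] by blast
    show "realised 0"
    proof -
      have "hull_iso 0 = \<zero>\<^bsub>E\<^esub>" using iso_simps(3)[of 0 0] iso_simps(1) by simp
      then show ?thesis unfolding realised_def
        by (intro bexI[OF _ zL]) (simp add: twist_def zero_map_def iso_simps(1))
    qed
    show "realised (mmonom t 1)" if t: "t \<in> pair_exp n ?q ` generating_pairs" for t
    proof -
      obtain P where P: "P \<in> generating_pairs" "t = pair_exp n ?q P" using t by blast
      have "twist n ?q (mmonom t 1) c \<in> invp n \<Delta>" if "c \<in> invp n \<Delta>" for c :: "_ \<Rightarrow> 'k"
        unfolding P(2) using generator_valid[OF P(1)] that by (intro twist_closed)
      then show ?thesis unfolding realised_def
        by (intro bexI[OF _ gen[OF P(1)]]) (simp add: generator_def P(2) twist_map_iso)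
    qed
    show "realised (h1 + h2)" if h: "realised h1" "realised h2" for h1 h2
    proof -
      obtain \<theta>1 \<theta>2 where \<theta>: "\<theta>1 \<in> L" "\<theta>2 \<in> L"
        "\<forall>c\<in>invp n \<Delta>. twist n ?q h1 c \<in> invp n \<Delta> \<and> \<theta>1 (hull_iso c) = hull_iso (twist n ?q h1 c)"
        "\<forall>c\<in>invp n \<Delta>. twist n ?q h2 c \<in> invp n \<Delta> \<and> \<theta>2 (hull_iso c) = hull_iso (twist n ?q h2 c)"
        using h unfolding realised_def by blast
      show ?thesis unfolding realised_def
        by (rule bexI[OF _ LE(5)[OF \<theta>(1,2)]]) (use \<theta>(3,4) in \<open>simp add: twist_add_left iso_simps\<close>)
    qed
    show "realised (f * h)" if f: "f \<in> series n" and h: "realised h" for f h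
    proof -
      obtain \<theta> where \<theta>: "\<theta> \<in> L"
        "\<forall>c\<in>invp n \<Delta>. twist n ?q h c \<in> invp n \<Delta> \<and> \<theta> (hull_iso c) = hull_iso (twist n ?q h c)"
        using h unfolding realised_def by blast
      show ?thesis unfolding realised_def
        by (rule bexI[OF _ LE(4)[OF cls_carrier[OF f] \<theta>(1)]])
           (use \<theta>(2) f in \<open>simp add: twist_mult iso_simps act_closed sc_def\<close>)
    qed
  qed (rule g(1))
  then obtain \<theta> where \<theta>: "\<theta> \<in> L" "\<And>c. c \<in> invp n \<Delta> \<Longrightarrow> \<theta> (hull_iso c) = hull_iso (twist n ?q g c)"
    unfolding realised_def by blast
  have "\<phi> = \<theta>"
  proof (rule extensionalityI[OF D(2)])
    show "\<theta> \<in> extensional (carrier E)" using \<theta>(1) LE(1) E.frobenius_mapsD(2) by blast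
    fix x assume "x \<in> carrier E"
    then obtain c where c: "c \<in> invp n \<Delta>" "x = hull_iso c" by (rule iso_cases)
    then show "\<phi> x = \<theta> x" using \<theta>(2)[OF c(1)] \<psi>(2)[OF c(1)] g(3)[OF c(1)] by simp
  qed
  then show "\<phi> \<in> L" using \<theta>(1) by simp
qed

text \<open>The generators outside \<open>G\<close> vanish modulo old operators, so those in
  \<open>G\<close> generate the quotient.\<close>

lemma number_of_new_generators_le:
  assumes e: "e \<ge> 1"
    and G: "finite G" "G \<subseteq> generating_pairs"
    and old: "\<And>P. P \<in> generating_pairs - G \<Longrightarrow> generator e P \<in> old_maps p A E e"
  shows "number_of_new_generators p A E e \<le> enat (card G)"
proof -
  interpret F: plain_module A "frobenius_module p A E e"
    by (rule plain_module.intro) (rule E.module_frobenius_module)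
  have "number_of_new_generators p A E e \<le> enat (card (generator e ` G))"
    unfolding number_of_new_generators_def
  proof (rule F.min_number_of_generators_quotient_le[OF E.submodule_old_maps[OF e]])
    show "generator e ` G \<subseteq> carrier (frobenius_module p A E e)"
      using G generator_frobenius by (auto simp: E.frobenius_module_simps)
    show "carrier (frobenius_module p A E e) \<subseteq> L"
      if "submodule L A (frobenius_module p A E e)" "old_maps p A E e \<subseteq> L" "generator e ` G \<subseteq> L" for L
      unfolding E.frobenius_module_simps using that old by (intro generators_span) blast+
  qed (use G in simp)
  also have "enat (card (generator e ` G)) \<le> enat (card G)" using card_image_le[OF G(1)] by simp
  finally show ?thesis .
qed

text \<open>Degree 1 is not a sum of two positive degrees, so there ({}, core) is counted and
  accounts for the additional 1. For e \<ge> 2 the splitting e = 1 + (e - 1) makes its operator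
  old.\<close>

lemma number_of_new_generators_bound:
  assumes e: "e \<ge> 1"
  shows "number_of_new_generators p A E e
    \<le> (if e = 1 then enat (card (maximal_free_pairs n \<Delta>)) + 1 else enat (card (maximal_free_pairs n \<Delta>)))"
proof (cases "e = 1")
  case True
  have "number_of_new_generators p A E e \<le> enat (card generating_pairs)"
    by (rule number_of_new_generators_le[OF e finite_generating_pairs]) auto
  also have "card generating_pairs \<le> card (maximal_free_pairs n \<Delta>) + 1"
    unfolding generating_pairs_def by (simp add: card_insert_if finite_free_pairs maximal_free_pairs_def)
  finally show ?thesis using True by (simp add: one_enat_def)
next
  case False
  have "number_of_new_generators p A E e \<le> enat (card (maximal_free_pairs n \<Delta>))"
  proof (rule number_of_new_generators_le[OF e])
    show "finite (maximal_free_pairs n \<Delta>)" using finite_free_pairs by (simp add: maximal_free_pairs_def)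
    fix P assume "P \<in> generating_pairs - maximal_free_pairs n \<Delta>"
    then have "P = ({}, core)" by (auto simp: generating_pairs_def)
    then show "generator e P \<in> old_maps p A E e"
      using generator_core_old[of 1 "e - 1"] False e by simp
  qed (auto simp: generating_pairs_def)
  then show ?thesis using False by simp
qed

end

theorem theorem3p9:
  fixes n p e :: nat
    and \<Delta> :: "nat set set"
    and E :: "('k::field mpseries set, 'e) module"
  assumes "Factorial_Ring.prime p"
    and "CHAR('k) = p"
    and "simplicial_complex n \<Delta>"
    and "injective_hull (stanley_reisner_ring n \<Delta>) residue_module E"
    and "\<not> frobenius_algebra_finitely_generated p (stanley_reisner_ring n \<Delta>) E"
    and "e \<ge> 1"
  shows "number_of_new_generators p (stanley_reisner_ring n \<Delta>) E e
           \<le> (if e = 1 then enat (card (maximal_free_pairs n \<Delta>)) + 1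
              else enat (card (maximal_free_pairs n \<Delta>)))"
proof -
  interpret sr_hull n p \<Delta> E
    using assms by unfold_locales
  show ?thesis using \<open>e \<ge> 1\<close> by (rule number_of_new_generators_bound)
qed

end
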